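(* Let $\alpha \in (0,1)$ and let $X$ and $Y$ be Hilbert spaces. Suppose that $A$ is the generator of a contractive $C_0$-semigroup $(T(t))_{t \ge 0}$ on $X$ and let $T := (I+A)(I-A)^{-1} \in \mathcal{L}(X)$. Suppose that for every $D \in \mathcal{L}(X,Y)$ the discrete resolvent condition $$\sup_{\omega \in \mathbb{D}} (1-|\omega|^2)^{\frac{1-\alpha}{2}} \|D(I-\bar\omega T)^{-1}\|_{\mathcal{L}(X,Y)} < \infty$$ implies that $D$ is discrete $\alpha$-admissible for $T$, i.e. that there exists $M>0$ with $$\sum_{n=0}^\infty (1+n)^\alpha \|D T^n x\|_Y^2 \leq M^2 \|x\|_X^2 \quad \text{for all } x \in X.$$ Then for every $C \in \mathcal{L}(D(A),Y)$ the continuous resolvent condition $$\sup_{\lambda \in \mathbb{C}_+} (\mathrm{Re}\,\lambda)^{\frac{1-\alpha}{2}} \|C R(\lambda,A)\|_{\mathcal{L}(X,Y)} < \infty$$ implies that $C$ is $\alpha$-admissible for $A$, i.e. that there exists $M>0$ with $$\int_0^\infty t^\alpha \|C T(t) x_0\|_Y^2 \, dt \leq M^2 \|x_0\|_X^2 \quad \text{for all } x_0 \in D(A).$$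
   Context: Hilbert spaces are complex. $\mathbb{C}_+ = \{\lambda \in \mathbb{C} : \mathrm{Re}\,\lambda > 0\}$ and $\mathbb{D}$ is the open unit disc. $R(\lambda,A) = (\lambda I - A)^{-1}$. $D(A)$ denotes the domain of $A$ with the graph norm $\|x\|_{D(A)} = \|x\|_X + \|Ax\|_X$, and $\mathcal{L}(D(A),Y)$ is the space of operators bounded from $D(A)$ with this norm into $Y$. A contractive semigroup is one with $\|T(t)\|_{\mathcal{L}(X)} \le 1$ for all $t \ge 0$; in this case $T$ is a contraction on $X$ (here $T$ without argument is the operator $(I+A)(I-A)^{-1}$, whereas $T(t)$ denotes the semigroup). *)

theory Defs
  imports "HOL-Analysis.Analysis"
begin

(* A complex inner product space is organised on top of the library class real_inner: the
   underlying real inner product is the real part of the complex one, so the norm (and hence the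
   metric and topology) inherited from real_inner is the one induced by cinner. Positive
   definiteness of cinner is inherited from real_inner, see cinner_self below.
   The inner product is linear in its first argument. *)
class complex_inner = real_inner +
  fixes scaleC :: "complex \<Rightarrow> 'a \<Rightarrow> 'a" (infixr "*\<^sub>C" 75)
    and cinner :: "'a \<Rightarrow> 'a \<Rightarrow> complex"
  assumes scaleC_add_right: "a *\<^sub>C (x + y) = a *\<^sub>C x + a *\<^sub>C y"
    and scaleC_add_left: "(a + b) *\<^sub>C x = a *\<^sub>C x + b *\<^sub>C x"
    and scaleC_scaleC: "a *\<^sub>C (b *\<^sub>C x) = (a * b) *\<^sub>C x"
    and scaleC_of_real: "complex_of_real r *\<^sub>C x = r *\<^sub>R x"
    and cinner_commute: "cinner x y = cnj (cinner y x)"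
    and cinner_add_left: "cinner (x + y) z = cinner x z + cinner y z"
    and cinner_scaleC_left: "cinner (a *\<^sub>C x) y = a * cinner x y"
    and inner_eq_Re_cinner: "inner x y = Re (cinner x y)"

class complex_hilbert = complex_inner + complete_space
begin
subclass banach ..
end

lemma scaleC_one: "1 *\<^sub>C x = (x :: 'a :: complex_inner)"
  using scaleC_of_real[of 1 x] by simp

lemma cinner_self: "cinner x x = complex_of_real ((norm x)\<^sup>2)"
  for x :: "'a :: complex_inner"
proof (rule complex_eqI)
  show "Re (cinner x x) = Re (complex_of_real ((norm x)\<^sup>2))"
    by (simp add: inner_eq_Re_cinner[symmetric] power2_norm_eq_inner)
  have "Im (cinner x x) = - Im (cinner x x)"
    by (subst cinner_commute) simp
  then show "Im (cinner x x) = Im (complex_of_real ((norm x)\<^sup>2))"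
    by simp
qed

lemma norm_scaleC: "norm (a *\<^sub>C x) = cmod a * norm x"
  for x :: "'a :: complex_inner"
proof -
  have "cinner (a *\<^sub>C x) (a *\<^sub>C x) = a * cnj (a * cinner x x)"
    by (metis cinner_commute cinner_scaleC_left)
  also have "\<dots> = (a * cnj a) * complex_of_real ((norm x)\<^sup>2)"
    by (simp add: cinner_self)
  also have "\<dots> = complex_of_real ((cmod a * norm x)\<^sup>2)"
    by (simp only: complex_norm_square[symmetric] of_real_mult power_mult_distrib of_real_power)
  finally have "(norm (a *\<^sub>C x))\<^sup>2 = (cmod a * norm x)\<^sup>2"
    by (simp only: cinner_self of_real_eq_iff)
  then show ?thesis
    by (simp add: power2_eq_iff_nonneg)
qed

instantiation complex :: complex_hilbert
begin
definition "scaleC a x = a * x" for a x :: complex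
definition "cinner x y = x * cnj y" for x y :: complex
instance
  by standard
    (simp_all add: scaleC_complex_def cinner_complex_def algebra_simps scaleR_conv_of_real
      inner_complex_def)
end

definition bounded_clinear :: "('x::complex_hilbert \<Rightarrow> 'y::complex_hilbert) \<Rightarrow> bool" where
  "bounded_clinear D \<longleftrightarrow> bounded_linear D \<and> (\<forall>a x. D (a *\<^sub>C x) = a *\<^sub>C D x)"

(* An unbounded operator is given by its domain DA and a function A that is only meaningful
   on DA. The same convention applies to C in L(D(A),Y), where D(A) carries the graph norm. *)
definition bounded_on_domain ::
  "'x::complex_hilbert set \<Rightarrow> ('x \<Rightarrow> 'x) \<Rightarrow> ('x \<Rightarrow> 'y::complex_hilbert) \<Rightarrow> bool" where
  "bounded_on_domain DA A C \<longleftrightarrow>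
     (\<forall>x\<in>DA. \<forall>y\<in>DA. C (x + y) = C x + C y) \<and>
     (\<forall>a. \<forall>x\<in>DA. C (a *\<^sub>C x) = a *\<^sub>C C x) \<and>
     (\<exists>K. \<forall>x\<in>DA. norm (C x) \<le> K * (norm x + norm (A x)))"

definition resolvent ::
  "'x::complex_hilbert set \<Rightarrow> ('x \<Rightarrow> 'x) \<Rightarrow> complex \<Rightarrow> 'x \<Rightarrow> 'x" where
  "resolvent DA A l = inv_into DA (\<lambda>x. l *\<^sub>C x - A x)"

definition cayley :: "'x::complex_hilbert set \<Rightarrow> ('x \<Rightarrow> 'x) \<Rightarrow> 'x \<Rightarrow> 'x" where
  "cayley DA A = (\<lambda>x. x + A x) \<circ> inv_into DA (\<lambda>x. x - A x)"

(* Only the values of S at times t \<ge> 0 are relevant. *)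
definition C0_semigroup :: "(real \<Rightarrow> 'x::complex_hilbert \<Rightarrow> 'x) \<Rightarrow> bool" where
  "C0_semigroup S \<longleftrightarrow>
     (\<forall>t\<ge>0. bounded_clinear (S t)) \<and>
     (\<forall>x. S 0 x = x) \<and>
     (\<forall>s\<ge>0. \<forall>t\<ge>0. \<forall>x. S (s + t) x = S s (S t x)) \<and>
     (\<forall>x. ((\<lambda>t. S t x) \<longlongrightarrow> x) (at_right 0))"

definition contractive_C0_semigroup :: "(real \<Rightarrow> 'x::complex_hilbert \<Rightarrow> 'x) \<Rightarrow> bool" where
  "contractive_C0_semigroup S \<longleftrightarrow> C0_semigroup S \<and> (\<forall>t\<ge>0. onorm (S t) \<le> 1)"

definition is_generator ::
  "(real \<Rightarrow> 'x::complex_hilbert \<Rightarrow> 'x) \<Rightarrow> 'x set \<Rightarrow> ('x \<Rightarrow> 'x) \<Rightarrow> bool" where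
  "is_generator S DA A \<longleftrightarrow>
     DA = {x. \<exists>y. ((\<lambda>h. (1 / h) *\<^sub>R (S h x - x)) \<longlongrightarrow> y) (at_right 0)} \<and>
     (\<forall>x\<in>DA. ((\<lambda>h. (1 / h) *\<^sub>R (S h x - x)) \<longlongrightarrow> A x) (at_right 0))"

(* The operators whose onorm is taken in the two resolvent conditions are bounded whenever T is
   a contraction and D is bounded, respectively A generates a contractive semigroup and C is
   bounded on D(A). Finiteness of the supremum is expressed by bdd_above. *)
definition discrete_resolvent_condition ::
  "real \<Rightarrow> ('x::complex_hilbert \<Rightarrow> 'x) \<Rightarrow> ('x \<Rightarrow> 'y::complex_hilbert) \<Rightarrow> bool" where
  "discrete_resolvent_condition \<alpha> T D \<longleftrightarrow>
     bdd_above ((\<lambda>w. (1 - (cmod w)\<^sup>2) powr ((1 - \<alpha>) / 2) *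
                     onorm (D \<circ> inv (\<lambda>x. x - cnj w *\<^sub>C T x))) ` {w. cmod w < 1})"

definition continuous_resolvent_condition ::
  "real \<Rightarrow> 'x::complex_hilbert set \<Rightarrow> ('x \<Rightarrow> 'x) \<Rightarrow> ('x \<Rightarrow> 'y::complex_hilbert) \<Rightarrow> bool" where
  "continuous_resolvent_condition \<alpha> DA A C \<longleftrightarrow>
     bdd_above ((\<lambda>l. Re l powr ((1 - \<alpha>) / 2) * onorm (C \<circ> resolvent DA A l)) ` {l. Re l > 0})"

(* Sum and integral are taken in [0, \<infinity>], so the inequalities include convergence. *)
definition discrete_admissible ::
  "real \<Rightarrow> ('x::complex_hilbert \<Rightarrow> 'x) \<Rightarrow> ('x \<Rightarrow> 'y::complex_hilbert) \<Rightarrow> bool" where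
  "discrete_admissible \<alpha> T D \<longleftrightarrow>
     (\<exists>M>0. \<forall>x. (\<Sum>n. ennreal ((1 + real n) powr \<alpha> * (norm (D ((T ^^ n) x)))\<^sup>2))
                   \<le> ennreal (M\<^sup>2 * (norm x)\<^sup>2))"

definition admissible ::
  "real \<Rightarrow> (real \<Rightarrow> 'x::complex_hilbert \<Rightarrow> 'x) \<Rightarrow> 'x set \<Rightarrow> ('x \<Rightarrow> 'y::complex_hilbert) \<Rightarrow> bool" where
  "admissible \<alpha> S DA C \<longleftrightarrow>
     (\<exists>M>0. \<forall>x\<in>DA. (\<integral>\<^sup>+t\<in>{0..}. ennreal (t powr \<alpha> * (norm (C (S t x)))\<^sup>2) \<partial>lborel)
                      \<le> ennreal (M\<^sup>2 * (norm x)\<^sup>2))"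

end

theory Submission
  imports Defs
begin

text \<open>
  Let $T$ be the Cayley transform of $A$, so that $D(A) = (1+T)X$ and $A(1+T)q = (T-1)q$, and put
  $E = C(1+T)$ and $D = E(1+T)^\alpha$, up to constants $C(I-A)^{-1-\alpha}$. The fractional power is
  the binomial series, absolutely convergent because $T$ is a contraction.

  Admissibility: $(I+A)^n (I-A)^{-n-1-\alpha}$ is the integral of the semigroup against
  $t^\alpha e^{-t} L_n^{(\alpha)}(2t)$ up to a constant, so the $D T^n x$ are the coefficients of
  $C T(t) x$ with respect to the functions $e_n(t) = (-1)^n e^{-t} L_n^{(\alpha)}(2t)$, which are
  orthogonal in $L^2(t^\alpha dt)$ with squared norms at most $(1+n)^\alpha$. Instead of completeness
  of this system, Abel summation is used: $\sum_n r^n e_n(t) T^n$ is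
  $(1+rT)^{-1-\alpha} e^{t A_r}$ with $A_r = -(1-rT)(1+rT)^{-1}$, a bounded dissipative
  approximation of $A$. Its strong convergence as $r \to 1$ and Fatou's lemma give the bound.

  Resolvent condition: with $\lambda = (1-z)/(1+z)$ the continuous condition says
  $\|E(1-zT)^{-1}\| \le m |1+z|^{-\alpha} (1-|z|^2)^{-(1-\alpha)/2}$. To absorb the factor
  $|1+z|^{-\alpha}$, write $(1+T)^\alpha$ as an integral over $\tau \in (0,1)$ of
  $(1+T)(1+\tau T)^{-1}$ and use the resolvent identity where $1-\tau > 2|1+z|$.
\<close>

section \<open>Power series in a contraction\<close>

text \<open>Why E alone does not suffice: in disc coordinates the continuous condition leaves the
  factor |1+z|^(-\<alpha>), singular at z = -1, the point corresponding to infinity in the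
  half-plane. The power (1+T)^\<alpha> is there to cancel it. This is not a pointwise inequality,
  because the hypothesis controls E only in front of resolvents; so (1+T)^\<alpha> has to be
  expressed through resolvents too. In the admissibility part the obstacle is that
  (1+rT)^(-1-\<alpha>) may blow up as r -> 1. It is applied only to vectors (1+T)^\<alpha> (1+T) y.
  There, replacing (1+T)^\<alpha> by (1+rT)^\<alpha> costs (1-r)^\<alpha>, which offsets the growth
  (1-r)^(-\<alpha>) of the remaining negative power. This settles t = 0, and dissipativity carries
  the convergence to later times. With x = (1+T) y one has C T(t) x = E T(t) y, so the discrete
  inequality at x gives the continuous one at x with the same constant M.\<close>

lemma bounded_bilinear_scaleC:
  "bounded_bilinear (scaleC :: complex \<Rightarrow> 'a::complex_inner \<Rightarrow> 'a)"
proof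
  fix a a' :: complex and x x' :: 'a and r :: real
  show "(a + a') *\<^sub>C x = a *\<^sub>C x + a' *\<^sub>C x" by (rule scaleC_add_left)
  show "a *\<^sub>C (x + x') = a *\<^sub>C x + a *\<^sub>C x'" by (rule scaleC_add_right)
  show "(r *\<^sub>R a) *\<^sub>C x = r *\<^sub>R (a *\<^sub>C x)"
    by (metis scaleC_of_real scaleC_scaleC scaleR_conv_of_real)
  show "a *\<^sub>C (r *\<^sub>R x) = r *\<^sub>R (a *\<^sub>C x)"
    by (metis scaleC_of_real scaleC_scaleC mult.commute)
  show "\<exists>K. \<forall>(a::complex) x::'a. norm (a *\<^sub>C x) \<le> norm a * norm x * K"
    by (rule exI[of _ 1]) (simp add: norm_scaleC)
qed

interpretation scaleC: bounded_bilinear scaleC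
  by (rule bounded_bilinear_scaleC)

lemma bounded_clinear_imp_bounded_linear: "bounded_clinear f \<Longrightarrow> bounded_linear f"
  by (simp add: bounded_clinear_def)

lemma bounded_clinear_scaleC: "bounded_clinear f \<Longrightarrow> f (a *\<^sub>C x) = a *\<^sub>C f x"
  by (simp add: bounded_clinear_def)

lemma bounded_clinear_add: "bounded_clinear f \<Longrightarrow> f (x + y) = f x + f y"
  by (intro linear_add bounded_linear.linear bounded_clinear_imp_bounded_linear)

lemma bounded_clinear_diff: "bounded_clinear f \<Longrightarrow> f (x - y) = f x - f y"
  by (intro linear_diff bounded_linear.linear bounded_clinear_imp_bounded_linear)

lemma bounded_clinear_scaleR: "bounded_clinear f \<Longrightarrow> f (r *\<^sub>R x) = r *\<^sub>R f x"
  by (intro linear_scale bounded_linear.linear bounded_clinear_imp_bounded_linear)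

lemma bounded_clinear_compose:
  "bounded_clinear f \<Longrightarrow> bounded_clinear g \<Longrightarrow> bounded_clinear (\<lambda>x. f (g x))"
  by (simp add: bounded_clinear_def bounded_linear_compose)

lemma abs_summable_convolution:
  fixes a b :: "nat \<Rightarrow> complex"
  assumes "summable (\<lambda>n. cmod (a n))" "summable (\<lambda>n. cmod (b n))"
  shows "summable (\<lambda>n. cmod (\<Sum>i\<le>n. a i * b (n - i)))"
proof (rule summable_comparison_test')
  show "summable (\<lambda>n. \<Sum>i\<le>n. cmod (a i) * cmod (b (n - i)))"
    by (rule summable_Cauchy_product) (simp_all add: assms)
  show "norm (cmod (\<Sum>i\<le>n. a i * b (n - i))) \<le> (\<Sum>i\<le>n. cmod (a i) * cmod (b (n - i)))" for n
    using norm_sum[of "\<lambda>i. a i * b (n - i)" "{..n}"] by (simp only: norm_mult real_norm_def abs_norm_cancel)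
qed

lemma infsum_eq_suminf:
  fixes f :: "nat \<Rightarrow> 'a::banach"
  assumes "summable (\<lambda>n. norm (f n))"
  shows "infsum f UNIV = suminf f"
  by (rule infsumI[OF norm_summable_imp_has_sum[OF assms
        summable_sums[OF summable_norm_cancel[OF assms]]]])

locale contraction_operator =
  fixes T :: "'x::complex_hilbert \<Rightarrow> 'x"
  assumes clinear_T: "bounded_clinear T"
    and norm_T_le: "norm (T x) \<le> norm x"
begin

lemma clinear_one_plus_T: "bounded_clinear (\<lambda>x. x + T x)"
  using clinear_T
  by (auto simp: bounded_clinear_def scaleC_add_right intro!: bounded_linear_add bounded_linear_ident)

lemma norm_pow_le: "norm ((T ^^ n) x) \<le> norm x"
  by (induction n) (auto intro: order_trans[OF norm_T_le])

lemma clinear_pow: "bounded_clinear (T ^^ n)"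
proof (induction n)
  case 0
  show ?case by (simp add: bounded_clinear_def id_def bounded_linear_ident)
next
  case (Suc n)
  then show ?case using bounded_clinear_compose[OF clinear_T Suc] by (simp add: o_def)
qed

text \<open>For absolutely summable \<open>a\<close> this is f(T) with f(w) = sum of a_n w^n,
  bounded by the l1 norm of \<open>a\<close> because the powers of \<open>T\<close> are
  contractions. Neumann series, fractional powers and Laguerre sums are all instances, hence commute
  with \<open>T\<close> and with each other.\<close>

definition opser :: "(nat \<Rightarrow> complex) \<Rightarrow> 'x \<Rightarrow> 'x" where
  "opser a x = (\<Sum>n. a n *\<^sub>C (T ^^ n) x)"

lemma norm_opser_term_le: "norm (a n *\<^sub>C (T ^^ n) x) \<le> cmod (a n) * norm x"
  by (simp add: norm_scaleC mult_left_mono norm_pow_le)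

lemma summable_norm_opser:
  assumes "summable (\<lambda>n. cmod (a n))"
  shows "summable (\<lambda>n. norm (a n *\<^sub>C (T ^^ n) x))"
  by (rule summable_comparison_test'[OF summable_mult2[OF assms, of "norm x"]])
    (simp add: norm_opser_term_le)

lemma opser_sums:
  assumes "summable (\<lambda>n. cmod (a n))"
  shows "(\<lambda>n. a n *\<^sub>C (T ^^ n) x) sums opser a x"
  unfolding opser_def
  by (rule summable_sums[OF summable_norm_cancel[OF summable_norm_opser[OF assms]]])

lemma norm_opser_le:
  assumes "summable (\<lambda>n. cmod (a n))"
  shows "norm (opser a x) \<le> (\<Sum>n. cmod (a n)) * norm x"
proof -
  have "norm (opser a x) \<le> (\<Sum>n. norm (a n *\<^sub>C (T ^^ n) x))"
    unfolding opser_def by (intro summable_norm summable_norm_opser assms)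
  also have "\<dots> \<le> (\<Sum>n. cmod (a n) * norm x)"
    by (intro suminf_le norm_opser_term_le summable_norm_opser summable_mult2 assms)
  also have "\<dots> = (\<Sum>n. cmod (a n)) * norm x"
    by (rule suminf_mult2[symmetric, OF assms])
  finally show ?thesis .
qed

text \<open>Besides functions of \<open>T\<close>, the commuting operator \<open>R\<close> will also
  be the semigroup at a fixed time.\<close>

lemma commute_opser:
  assumes "summable (\<lambda>n. cmod (a n))" "bounded_clinear R" "\<And>x. R (T x) = T (R x)"
  shows "R (opser a x) = opser a (R x)"
proof -
  have "R ((T ^^ n) x) = (T ^^ n) (R x)" for n x
    by (induction n) (simp_all add: assms(3))
  then have "(\<lambda>n. a n *\<^sub>C (T ^^ n) (R x)) sums R (opser a x)"
    using bounded_linear.sums[OF bounded_clinear_imp_bounded_linear[OF assms(2)]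
        opser_sums[OF assms(1), of x]]
    by (simp add: bounded_clinear_scaleC[OF assms(2)])
  then show ?thesis
    using opser_sums[OF assms(1)] sums_unique2 by blast
qed

lemma T_opser: "summable (\<lambda>n. cmod (a n)) \<Longrightarrow> T (opser a x) = opser a (T x)"
  by (rule commute_opser[OF _ clinear_T]) simp_all

lemma clinear_opser:
  assumes "summable (\<lambda>n. cmod (a n))"
  shows "bounded_clinear (opser a)"
  unfolding bounded_clinear_def
proof
  show "bounded_linear (opser a)"
  proof (rule bounded_linear_intro)
    fix x y and r :: real
    have "(\<lambda>n. a n *\<^sub>C (T ^^ n) (x + y)) sums (opser a x + opser a y)"
      using sums_add[OF opser_sums[OF assms, of x] opser_sums[OF assms, of y]]
      by (simp add: bounded_clinear_add[OF clinear_pow] scaleC.add_right)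
    then show "opser a (x + y) = opser a x + opser a y"
      using opser_sums[OF assms] sums_unique2 by blast
    have "(\<lambda>n. a n *\<^sub>C (T ^^ n) (r *\<^sub>R x)) sums (r *\<^sub>R opser a x)"
      using sums_scaleR_right[OF opser_sums[OF assms, of x], of r]
      by (simp add: bounded_clinear_scaleR[OF clinear_pow] scaleC.scaleR_right)
    then show "opser a (r *\<^sub>R x) = r *\<^sub>R opser a x"
      using opser_sums[OF assms] sums_unique2 by blast
    show "norm (opser a x) \<le> norm x * (\<Sum>n. cmod (a n))"
      using norm_opser_le[OF assms] by (simp add: mult.commute)
  qed
  show "\<forall>c x. opser a (c *\<^sub>C x) = c *\<^sub>C opser a x"
  proof (intro allI)
    fix c x
    have "(\<lambda>n. a n *\<^sub>C (T ^^ n) (c *\<^sub>C x)) sums (c *\<^sub>C opser a x)"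
      using bounded_linear.sums[OF scaleC.bounded_linear_right opser_sums[OF assms, of x], of c]
      by (simp add: bounded_clinear_scaleC[OF clinear_pow] scaleC_scaleC mult.commute)
    then show "opser a (c *\<^sub>C x) = c *\<^sub>C opser a x"
      using opser_sums[OF assms] sums_unique2 by blast
  qed
qed

lemma opser_cong: "(\<And>n. a n = b n) \<Longrightarrow> opser a x = opser b x"
  by (simp add: opser_def)

lemma opser_diff:
  assumes "summable (\<lambda>n. cmod (a n))" "summable (\<lambda>n. cmod (b n))"
  shows "opser (\<lambda>n. a n - b n) x = opser a x - opser b x"
  using sums_diff[OF opser_sums[OF assms(1), of x] opser_sums[OF assms(2), of x]]
  by (simp add: opser_def scaleC.diff_left sums_iff)

lemma opser_finite:
  assumes "\<And>n. n \<ge> N \<Longrightarrow> a n = 0"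
  shows "opser a x = (\<Sum>n<N. a n *\<^sub>C (T ^^ n) x)"
  unfolding opser_def by (rule suminf_finite) (auto simp: assms scaleC.zero_left)

text \<open>Fubini for the absolutely summable double family \<open>f\<close>: summing by rows gives
  the composition, summing along the diagonals n + m = k gives the Cauchy product. Identities
  between scalar power series thereby become operator identities.\<close>

lemma opser_mult:
  assumes a: "summable (\<lambda>n. cmod (a n))" and b: "summable (\<lambda>n. cmod (b n))"
  shows "opser a (opser b x) = opser (\<lambda>n. \<Sum>i\<le>n. a i * b (n - i)) x"
proof -
  define f where "f = (\<lambda>(n, m). (a n * b m) *\<^sub>C (T ^^ (n + m)) x)"
  define c where "c = (\<lambda>n. \<Sum>i\<le>n. a i * b (n - i))"
  have f_le: "norm (f (n, m)) \<le> cmod (a n) * cmod (b m) * norm x" for n m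
    using norm_opser_term_le[of "\<lambda>_. a n * b m" "n + m" x] by (simp add: f_def norm_mult)
  have "(\<lambda>(n, m). cmod (a n) * cmod (b m)) summable_on UNIV \<times> UNIV"
  proof (rule summable_on_SigmaI)
    show "((\<lambda>m. (\<lambda>(n, m). cmod (a n) * cmod (b m)) (n, m)) has_sum
        cmod (a n) * (\<Sum>m. cmod (b m))) UNIV" for n
      using norm_summable_imp_has_sum[of "\<lambda>m. cmod (b m)"] b
      by (auto intro!: has_sum_cmult_right simp: summable_sums)
    show "(\<lambda>n. cmod (a n) * (\<Sum>m. cmod (b m))) summable_on UNIV"
      using norm_summable_imp_summable_on[of "\<lambda>m. cmod (a m)"] a
      by (intro summable_on_cmult_left) simp
  qed simp
  then have "(\<lambda>p. (\<lambda>(n, m). cmod (a n) * cmod (b m)) p * norm x) summable_on UNIV \<times> UNIV"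
    by (rule summable_on_cmult_left)
  then have "f abs_summable_on UNIV \<times> UNIV"
    by (rule summable_on_comparison_test) (auto intro: f_le)
  then have f_summable: "f summable_on UNIV \<times> UNIV"
    by (rule abs_summable_summable)
  have inner_sum: "(\<Sum>\<^sub>\<infinity>m. f (n, m)) = a n *\<^sub>C (T ^^ n) (opser b x)" for n
  proof -
    have "bounded_linear (\<lambda>v. a n *\<^sub>C (T ^^ n) v)"
      by (intro bounded_linear_compose[OF scaleC.bounded_linear_right]
          bounded_clinear_imp_bounded_linear clinear_pow)
    from bounded_linear.sums[OF this opser_sums[OF b, of x]]
    have "(\<lambda>m. f (n, m)) sums (a n *\<^sub>C (T ^^ n) (opser b x))"
      by (simp add: f_def bounded_clinear_scaleC[OF clinear_pow] scaleC_scaleC funpow_add)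
    moreover have "summable (\<lambda>m. norm (f (n, m)))"
      by (rule summable_comparison_test'[OF summable_mult2[OF summable_mult[OF b, of "cmod (a n)"],
              of "norm x"]]) (simp add: f_le)
    ultimately show ?thesis by (simp add: infsum_eq_suminf sums_iff)
  qed
  have "opser a (opser b x) = (\<Sum>\<^sub>\<infinity>n. a n *\<^sub>C (T ^^ n) (opser b x))"
    unfolding opser_def[of a] by (rule infsum_eq_suminf[symmetric]) (rule summable_norm_opser[OF a])
  also have "\<dots> = (\<Sum>\<^sub>\<infinity>n. \<Sum>\<^sub>\<infinity>m. f (n, m))"
    by (simp add: inner_sum)
  also have "\<dots> = infsum f (UNIV \<times> UNIV)"
    using infsum_Sigma'_banach[of "\<lambda>n m. f (n, m)" UNIV "\<lambda>_. UNIV"] f_summable by simp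
  also have "\<dots> = (\<Sum>\<^sub>\<infinity>n. \<Sum>\<^sub>\<infinity>i\<in>{..n}. f (i, n - i))"
  proof -
    have bij: "bij_betw (\<lambda>(k, i). (i, k - i)) (SIGMA n:UNIV. {..n::nat}) (UNIV \<times> UNIV)"
      by (rule bij_betw_byWitness[where f' = "\<lambda>(n, m). (n + m, n)"]) auto
    have "(\<lambda>(n, i). f (i, n - i)) summable_on (SIGMA n:UNIV. {..n})"
      using summable_on_reindex_bij_betw[OF bij, of f] f_summable by (simp add: case_prod_unfold)
    then have "(\<Sum>\<^sub>\<infinity>n. \<Sum>\<^sub>\<infinity>i\<in>{..n}. f (i, n - i)) =
        infsum (\<lambda>(n, i). f (i, n - i)) (SIGMA n:UNIV. {..n})"
      using infsum_Sigma'_banach[of "\<lambda>n i. f (i, n - i)" UNIV "\<lambda>n. {..n}"] by simp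
    then show ?thesis
      using infsum_reindex_bij_betw[OF bij, of f] by (simp add: case_prod_unfold)
  qed
  also have "\<dots> = (\<Sum>\<^sub>\<infinity>n. c n *\<^sub>C (T ^^ n) x)"
    by (simp add: f_def c_def scaleC.sum_left)
  also have "\<dots> = opser c x"
    unfolding opser_def c_def
    by (intro infsum_eq_suminf summable_norm_opser abs_summable_convolution a b)
  finally show ?thesis by (simp add: c_def)
qed

end

section \<open>Contraction semigroups and the Cayley transform\<close>

lemma has_vector_derivative_iff_quotient:
  fixes f :: "real \<Rightarrow> 'a::real_normed_vector"
  shows "(f has_vector_derivative d) (at t within X) \<longleftrightarrow>
    ((\<lambda>s. (1 / (s - t)) *\<^sub>R (f s - f t)) \<longlongrightarrow> d) (at t within X)"
proof -
  have "(f has_vector_derivative d) (at t within X) \<longleftrightarrow>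
      ((\<lambda>s. norm ((1 / norm (s - t)) *\<^sub>R (f s - (f t + (s - t) *\<^sub>R d)))) \<longlongrightarrow> 0) (at t within X)"
    unfolding tendsto_norm_zero_iff
    by (simp add: has_vector_derivative_def has_derivative_within bounded_linear_scaleR_left)
  also have "\<dots> \<longleftrightarrow> ((\<lambda>s. norm ((1 / (s - t)) *\<^sub>R (f s - f t) - d)) \<longlongrightarrow> 0) (at t within X)"
  proof (rule tendsto_cong, unfold eventually_at_filter, intro eventuallyI impI)
    fix s assume "s \<noteq> t" "s \<in> X"
    then have "(1 / (s - t)) *\<^sub>R (f s - f t) - d = (1 / (s - t)) *\<^sub>R (f s - (f t + (s - t) *\<^sub>R d))"
      by (simp add: scaleR_diff_right scaleR_add_right)
    then show "norm ((1 / norm (s - t)) *\<^sub>R (f s - (f t + (s - t) *\<^sub>R d))) =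
        norm ((1 / (s - t)) *\<^sub>R (f s - f t) - d)"
      by simp
  qed
  also have "\<dots> \<longleftrightarrow> ((\<lambda>s. (1 / (s - t)) *\<^sub>R (f s - f t)) \<longlongrightarrow> d) (at t within X)"
    unfolding tendsto_norm_zero_iff LIM_zero_iff ..
  finally show ?thesis .
qed

locale contraction_semigroup =
  fixes S :: "real \<Rightarrow> 'x::complex_hilbert \<Rightarrow> 'x" and DA :: "'x set" and A :: "'x \<Rightarrow> 'x"
  assumes contractive: "contractive_C0_semigroup S"
    and generator: "is_generator S DA A"
begin

lemma clinear_S: "t \<ge> 0 \<Longrightarrow> bounded_clinear (S t)"
  using contractive by (simp add: contractive_C0_semigroup_def C0_semigroup_def)

lemma S_0: "S 0 x = x"
  using contractive by (simp add: contractive_C0_semigroup_def C0_semigroup_def)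

lemma S_add: "s \<ge> 0 \<Longrightarrow> t \<ge> 0 \<Longrightarrow> S (s + t) x = S s (S t x)"
  using contractive by (simp add: contractive_C0_semigroup_def C0_semigroup_def)

lemma S_tendsto: "((\<lambda>t. S t x) \<longlongrightarrow> x) (at_right 0)"
  using contractive by (simp add: contractive_C0_semigroup_def C0_semigroup_def)

lemma norm_S_le:
  assumes "t \<ge> 0"
  shows "norm (S t x) \<le> norm x"
proof -
  have "norm (S t x) \<le> onorm (S t) * norm x"
    by (intro onorm bounded_clinear_imp_bounded_linear clinear_S assms)
  also have "\<dots> \<le> 1 * norm x"
    using contractive assms by (intro mult_right_mono) (auto simp: contractive_C0_semigroup_def)
  finally show ?thesis by simp
qed

text \<open>Factoring out the semigroup at the smaller time reduces continuity from both sides at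
  any time to right continuity at 0.\<close>

lemma norm_S_diff_le:
  assumes "0 \<le> s" "0 \<le> t"
  shows "norm (S t x - S s x) \<le> norm (S \<bar>t - s\<bar> x - x)"
  using assms
proof (induction s t rule: linorder_wlog)
  case (le s t)
  then have "S t x - S s x = S s (S (t - s) x - x)"
    using S_add[of s "t - s" x] by (simp add: bounded_clinear_diff[OF clinear_S])
  then show ?case using le norm_S_le by simp
next
  case (sym s t)
  then show ?case by (simp add: norm_minus_commute abs_minus_commute)
qed

lemma S_abs_tendsto: "((\<lambda>s. S \<bar>s - t\<bar> x) \<longlongrightarrow> x) (at t within X)"
proof -
  have "((\<lambda>s. S \<bar>s - t\<bar> x) \<longlongrightarrow> x) (at t)"
  proof (rule filterlim_compose[OF S_tendsto])
    show "filterlim (\<lambda>s. \<bar>s - t\<bar>) (at_right 0) (at t)"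
      unfolding filterlim_at by (auto intro!: tendsto_eq_intros eventually_neq_at_within
        simp: eventually_at_filter)
  qed
  then show ?thesis by (rule tendsto_within_subset) simp
qed

lemma continuous_on_S: "continuous_on {0..} (\<lambda>t. S t x)"
  unfolding continuous_on_def
proof
  fix t :: real assume t: "t \<in> {0..}"
  have "((\<lambda>s. norm (S \<bar>s - t\<bar> x - x)) \<longlongrightarrow> 0) (at t within {0..})"
    using S_abs_tendsto[of t x "{0..}"] by (intro tendsto_norm_zero LIM_zero)
  then have "((\<lambda>s. S s x - S t x) \<longlongrightarrow> 0) (at t within {0..})"
    by (rule Lim_null_comparison[rotated])
      (use t norm_S_diff_le in \<open>auto simp: eventually_at_filter\<close>)
  then show "((\<lambda>s. S s x) \<longlongrightarrow> S t x) (at t within {0..})"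
    by (rule LIM_zero_cancel)
qed

lemma A_tendsto: "x \<in> DA \<Longrightarrow> ((\<lambda>h. (1 / h) *\<^sub>R (S h x - x)) \<longlongrightarrow> A x) (at_right 0)"
  using generator by (simp add: is_generator_def)

lemma generatorI:
  assumes "((\<lambda>h. (1 / h) *\<^sub>R (S h x - x)) \<longlongrightarrow> y) (at_right 0)"
  shows "x \<in> DA" "A x = y"
proof -
  show "x \<in> DA" using generator assms by (auto simp: is_generator_def)
  then show "A x = y"
    using tendsto_unique[OF _ A_tendsto assms] by simp
qed

lemma eventually_pos_at_right_0: "eventually (\<lambda>h::real. h > 0) (at_right 0)"
  by (simp add: eventually_at_right_less)

lemma
  assumes "x \<in> DA" "y \<in> DA"
  shows DA_add: "x + y \<in> DA" and A_add: "A (x + y) = A x + A y"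
proof -
  have "((\<lambda>h. (1 / h) *\<^sub>R (S h (x + y) - (x + y))) \<longlongrightarrow> A x + A y) (at_right 0)"
  proof (rule Lim_transform_eventually[OF tendsto_add[OF A_tendsto A_tendsto]])
    show "\<forall>\<^sub>F h in at_right 0. (1 / h) *\<^sub>R (S h x - x) + (1 / h) *\<^sub>R (S h y - y) =
        (1 / h) *\<^sub>R (S h (x + y) - (x + y))"
      using eventually_pos_at_right_0
      by eventually_elim
        (simp add: bounded_clinear_add[OF clinear_S] algebra_simps)
  qed (use assms in auto)
  from generatorI[OF this] show "x + y \<in> DA" "A (x + y) = A x + A y" .
qed

lemma
  assumes "x \<in> DA"
  shows DA_scaleC: "c *\<^sub>C x \<in> DA" and A_scaleC: "A (c *\<^sub>C x) = c *\<^sub>C A x"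
proof -
  have "((\<lambda>h. (1 / h) *\<^sub>R (S h (c *\<^sub>C x) - c *\<^sub>C x)) \<longlongrightarrow> c *\<^sub>C A x) (at_right 0)"
  proof (rule Lim_transform_eventually[OF bounded_linear.tendsto[OF scaleC.bounded_linear_right
          A_tendsto[OF assms]]])
    show "\<forall>\<^sub>F h in at_right 0. c *\<^sub>C (1 / h) *\<^sub>R (S h x - x) =
        (1 / h) *\<^sub>R (S h (c *\<^sub>C x) - c *\<^sub>C x)"
      using eventually_pos_at_right_0
      by eventually_elim
        (simp add: bounded_clinear_scaleC[OF clinear_S] scaleC.scaleR_right scaleC.diff_right)
  qed
  from generatorI[OF this] show "c *\<^sub>C x \<in> DA" "A (c *\<^sub>C x) = c *\<^sub>C A x" .
qed

lemma
  assumes "x \<in> DA"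
  shows DA_scaleR: "r *\<^sub>R x \<in> DA" and A_scaleR: "A (r *\<^sub>R x) = r *\<^sub>R A x"
  using DA_scaleC[OF assms, of "of_real r"] A_scaleC[OF assms, of "of_real r"]
  by (simp_all add: scaleC_of_real)

lemma
  assumes "x \<in> DA" "y \<in> DA"
  shows DA_diff: "x - y \<in> DA" and A_diff: "A (x - y) = A x - A y"
  using DA_add[OF assms(1) DA_scaleR[OF assms(2)], of "-1"]
    A_add[OF assms(1) DA_scaleR[OF assms(2)], of "-1"] A_scaleR[OF assms(2), of "-1"]
  by simp_all

lemma
  assumes "x \<in> DA" "t \<ge> 0"
  shows DA_S: "S t x \<in> DA" and A_S: "A (S t x) = S t (A x)"
proof -
  have "((\<lambda>h. (1 / h) *\<^sub>R (S h (S t x) - S t x)) \<longlongrightarrow> S t (A x)) (at_right 0)"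
  proof (rule Lim_transform_eventually[OF bounded_linear.tendsto[OF
          bounded_clinear_imp_bounded_linear[OF clinear_S[OF assms(2)]] A_tendsto[OF assms(1)]]])
    show "\<forall>\<^sub>F h in at_right 0. S t ((1 / h) *\<^sub>R (S h x - x)) = (1 / h) *\<^sub>R (S h (S t x) - S t x)"
      using eventually_pos_at_right_0
    proof eventually_elim
      case (elim h)
      then have "S h (S t x) = S t (S h x)"
        using S_add[of h t x] S_add[of t h x] assms(2) by (simp add: add.commute)
      then show ?case
        by (simp add: bounded_clinear_scaleR[OF clinear_S[OF assms(2)]]
            bounded_clinear_diff[OF clinear_S[OF assms(2)]])
    qed
  qed
  from generatorI[OF this] show "S t x \<in> DA" "A (S t x) = S t (A x)" .
qed

lemma inner_A_nonpos:
  assumes "x \<in> DA"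
  shows "inner (A x) x \<le> 0"
proof (rule tendsto_upperbound[OF tendsto_inner[OF A_tendsto[OF assms] tendsto_const]])
  show "\<forall>\<^sub>F h in at_right 0. inner ((1 / h) *\<^sub>R (S h x - x)) x \<le> 0"
    using eventually_pos_at_right_0
  proof eventually_elim
    case (elim h)
    have "inner (S h x) x \<le> norm (S h x) * norm x"
      by (rule norm_cauchy_schwarz)
    also have "\<dots> \<le> norm x * norm x"
      using elim by (intro mult_right_mono norm_S_le) auto
    finally show ?case
      using elim by (simp add: inner_diff_left dot_square_norm power2_eq_square divide_nonpos_pos)
  qed
qed simp

text \<open>The generator is only a right derivative at 0. For s < t the factor \<open>S s\<close>
  is pulled out, which produces \<open>S s (A x)\<close> instead of \<open>S t (A x)\<close>; strong
  continuity closes this gap and accounts for the second term of the majorant.\<close>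

lemma has_vector_derivative_S:
  assumes x: "x \<in> DA" and t: "t \<ge> 0"
  shows "((\<lambda>s. S s x) has_vector_derivative S t (A x)) (at t within {0..})"
proof -
  define q where "q = (\<lambda>h. (1 / h) *\<^sub>R (S h x - x) - A x)"
  have "((\<lambda>s. norm (q \<bar>s - t\<bar>) + norm (S \<bar>s - t\<bar> (A x) - A x)) \<longlongrightarrow> 0) (at t within {0..})"
  proof (intro tendsto_add_zero tendsto_norm_zero)
    have "(q \<longlongrightarrow> 0) (at_right 0)"
      unfolding q_def by (intro LIM_zero A_tendsto x)
    then have "((\<lambda>s. q \<bar>s - t\<bar>) \<longlongrightarrow> 0) (at t)"
      by (rule filterlim_compose) (auto simp: filterlim_at eventually_at_filter
          intro!: tendsto_eq_intros)
    then show "((\<lambda>s. q \<bar>s - t\<bar>) \<longlongrightarrow> 0) (at t within {0..})"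
      by (rule tendsto_within_subset) simp
    show "((\<lambda>s. S \<bar>s - t\<bar> (A x) - A x) \<longlongrightarrow> 0) (at t within {0..})"
      by (intro LIM_zero S_abs_tendsto)
  qed
  then have "((\<lambda>s. (1 / (s - t)) *\<^sub>R (S s x - S t x) - S t (A x)) \<longlongrightarrow> 0) (at t within {0..})"
  proof (rule Lim_null_comparison[rotated])
    show "\<forall>\<^sub>F s in at t within {0..}. norm ((1 / (s - t)) *\<^sub>R (S s x - S t x) - S t (A x))
        \<le> norm (q \<bar>s - t\<bar>) + norm (S \<bar>s - t\<bar> (A x) - A x)"
      unfolding eventually_at_filter
    proof (intro eventuallyI impI)
      fix s :: real assume s: "s \<noteq> t" "s \<in> {0..}"
      have q_le: "norm (S u (q h)) \<le> norm (q h)" if "u \<ge> 0" for u h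
        using that by (rule norm_S_le)
      show "norm ((1 / (s - t)) *\<^sub>R (S s x - S t x) - S t (A x))
          \<le> norm (q \<bar>s - t\<bar>) + norm (S \<bar>s - t\<bar> (A x) - A x)"
      proof (cases "s > t")
        case True
        then have "(1 / (s - t)) *\<^sub>R (S s x - S t x) - S t (A x) = S t (q \<bar>s - t\<bar>)"
          using S_add[of t "s - t" x] t
          by (simp add: q_def bounded_clinear_scaleR[OF clinear_S] bounded_clinear_diff[OF clinear_S])
        then show ?thesis using q_le[OF t, of "\<bar>s - t\<bar>"] by (simp add: add_increasing2)
      next
        case False
        then have st: "s < t" "\<bar>s - t\<bar> = t - s" "0 \<le> s" using s by auto
        have "(1 / (s - t)) *\<^sub>R (S s x - S t x) = (1 / (t - s)) *\<^sub>R (S t x - S s x)"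
        proof -
          have "1 / (s - t) = - (1 / (t - s))"
            by (simp flip: divide_minus_right)
          then show ?thesis by (simp add: scaleR_diff_right)
        qed
        also have "\<dots> = S s (q (t - s)) + S s (A x)"
          using S_add[of s "t - s" x] st
          by (simp add: q_def bounded_clinear_scaleR[OF clinear_S] bounded_clinear_diff[OF clinear_S])
        finally have "(1 / (s - t)) *\<^sub>R (S s x - S t x) - S t (A x) =
            S s (q (t - s)) - (S t (A x) - S s (A x))" by simp
        then have "norm ((1 / (s - t)) *\<^sub>R (S s x - S t x) - S t (A x)) \<le>
            norm (S s (q (t - s))) + norm (S t (A x) - S s (A x))"
          by (simp only: norm_triangle_ineq4)
        also have "\<dots> \<le> norm (q (t - s)) + norm (S \<bar>t - s\<bar> (A x) - A x)"
          using st t by (intro add_mono q_le norm_S_diff_le) auto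
        finally show ?thesis using st by (simp add: abs_minus_commute)
      qed
    qed
  qed
  from LIM_zero_cancel[OF this] show ?thesis
    by (simp add: has_vector_derivative_iff_quotient)
qed

section \<open>Truncated Laplace integrals: density of the domain and surjectivity of I - A\<close>

definition damped :: "'x \<Rightarrow> real \<Rightarrow> 'x" where
  "damped x s = exp (- s) *\<^sub>R S s x"

definition damped_integral :: "real \<Rightarrow> 'x \<Rightarrow> 'x" where
  "damped_integral u x = integral {0..u} (damped x)"

lemma continuous_on_damped: "continuous_on {0..u} (damped x)"
  unfolding damped_def
  by (intro continuous_intros continuous_on_subset[OF continuous_on_S]) auto

lemma damped_integral_quotient:
  assumes "u \<ge> 0"
  shows "((\<lambda>h. (1 / h) *\<^sub>R (damped_integral (u + h) x - damped_integral u x)) \<longlongrightarrow> damped x u)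
    (at_right 0)"
proof -
  have "((\<lambda>s. (1 / (s - u)) *\<^sub>R (damped_integral s x - damped_integral u x)) \<longlongrightarrow> damped x u)
      (at u within {0..u + 1})"
    using integral_has_vector_derivative[OF continuous_on_damped, of u "u + 1" x] assms
    by (simp add: has_vector_derivative_iff_quotient damped_integral_def)
  moreover have "filterlim (\<lambda>h. u + h) (at u within {0..u + 1}) (at_right 0)"
    unfolding filterlim_at
  proof
    show "((+) u \<longlongrightarrow> u) (at_right 0)"
      by (auto intro!: tendsto_eq_intros)
    have "\<forall>\<^sub>F h in at_right (0::real). h < 1"
      by (rule eventually_at_right_real[THEN eventually_mono]) (auto intro: zero_less_one)
    with eventually_pos_at_right_0 show "\<forall>\<^sub>F h in at_right 0. u + h \<in> {0..u + 1} \<and> u + h \<noteq> u"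
      by eventually_elim (use assms in auto)
  qed
  ultimately show ?thesis
    by (auto dest: filterlim_compose)
qed

lemma S_damped_integral:
  assumes "h \<ge> 0" "u \<ge> 0"
  shows "S h (damped_integral u x) = exp h *\<^sub>R (damped_integral (u + h) x - damped_integral h x)"
proof -
  have int: "damped x integrable_on {a..b}" if "0 \<le> a" for a b
    using that continuous_on_subset[OF continuous_on_damped[of b x]]
    by (intro integrable_continuous_real) auto
  have "S h (damped_integral u x) = integral {0..u} (S h \<circ> damped x)"
    unfolding damped_integral_def
    by (intro integral_linear[symmetric] int bounded_clinear_imp_bounded_linear clinear_S assms) simp
  also have "\<dots> = integral {0..u} (\<lambda>s. exp h *\<^sub>R damped x (s + h))"
    using assms
    by (intro integral_cong)
      (simp add: damped_def bounded_clinear_scaleR[OF clinear_S] S_add[symmetric] add.commute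
        flip: exp_add)
  also have "\<dots> = exp h *\<^sub>R integral {0..u} (\<lambda>s. damped x (s + h))"
    by (rule integral_cmul)
  also have "integral {0..u} (\<lambda>s. damped x (s + h)) = integral {h..u + h} (damped x)"
    using integral_shift_real_ivl[where a = h and b = "u + h" and c = h and f = "damped x"] by simp
  also have "\<dots> = damped_integral (u + h) x - damped_integral h x"
    unfolding damped_integral_def
    using Henstock_Kurzweil_Integration.integral_combine[where a = 0 and c = h and b = "u + h" and f = "damped x"] int[of 0 "u + h"] assms
    by (simp add: algebra_simps)
  finally show ?thesis .
qed

lemma damped_integral_0: "damped_integral 0 x = 0"
  by (simp add: damped_integral_def)

text \<open>Formally this is integration by parts of e^(-s) times the derivative of
  \<open>S s x\<close>. Rigorously, \<open>S_damped_integral\<close> turns the difference quotient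
  into increments of the primitive, which exists for every x, in the domain or not.\<close>

lemma
  assumes "u \<ge> 0"
  shows damped_integral_in_DA: "damped_integral u x \<in> DA"
    and A_damped_integral:
      "A (damped_integral u x) = damped_integral u x + damped x u - x"
proof -
  define J where "J = (\<lambda>u. damped_integral u x)"
  have "((\<lambda>h. (exp h - 1) / h) \<longlongrightarrow> 1) (at_right (0::real))"
    using DERIV_exp[of "0::real"]
    by (auto simp: has_field_derivative_iff intro: tendsto_within_subset)
  moreover have "((\<lambda>h. (1 / h) *\<^sub>R (J (u + h) - J u)) \<longlongrightarrow> damped x u) (at_right 0)"
    unfolding J_def by (rule damped_integral_quotient[OF assms])
  moreover have "((\<lambda>h. (1 / h) *\<^sub>R J h) \<longlongrightarrow> x) (at_right 0)"
    using damped_integral_quotient[of 0 x] by (simp add: J_def damped_integral_0 damped_def S_0)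
  moreover have "((\<lambda>h. exp h) \<longlongrightarrow> exp 0) (at_right (0::real))"
    by (intro tendsto_intros)
  ultimately have "((\<lambda>h. exp h *\<^sub>R ((1 / h) *\<^sub>R (J (u + h) - J u) - (1 / h) *\<^sub>R J h) +
      ((exp h - 1) / h) *\<^sub>R J u) \<longlongrightarrow> exp 0 *\<^sub>R (damped x u - x) + 1 *\<^sub>R J u) (at_right 0)"
    by (intro tendsto_intros)
  then have "((\<lambda>h. (1 / h) *\<^sub>R (S h (J u) - J u)) \<longlongrightarrow> exp 0 *\<^sub>R (damped x u - x) + 1 *\<^sub>R J u)
      (at_right 0)"
  proof (rule Lim_transform_eventually)
    show "\<forall>\<^sub>F h in at_right 0. exp h *\<^sub>R ((1 / h) *\<^sub>R (J (u + h) - J u) - (1 / h) *\<^sub>R J h) +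
        ((exp h - 1) / h) *\<^sub>R J u = (1 / h) *\<^sub>R (S h (J u) - J u)"
      using eventually_pos_at_right_0
    proof eventually_elim
      case (elim h)
      have "S h (J u) = exp h *\<^sub>R (J (u + h) - J h)"
        unfolding J_def by (intro S_damped_integral assms) (use elim in auto)
      show ?case
        unfolding \<open>S h (J u) = exp h *\<^sub>R (J (u + h) - J h)\<close>
        by (simp add: algebra_simps diff_divide_distrib)
    qed
  qed
  from generatorI[OF this]
  show "damped_integral u x \<in> DA"
    "A (damped_integral u x) = damped_integral u x + damped x u - x"
    by (simp_all add: J_def)
qed

lemma DA_dense:
  assumes "e > 0"
  obtains z where "z \<in> DA" "norm (x - z) < e"
proof -
  have "((\<lambda>h. (1 / h) *\<^sub>R damped_integral h x) \<longlongrightarrow> x) (at_right 0)"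
    using damped_integral_quotient[of 0 x] by (simp add: damped_integral_0 damped_def S_0)
  from tendstoD[OF this assms] eventually_pos_at_right_0
  have "\<forall>\<^sub>F h in at_right 0. dist ((1 / h) *\<^sub>R damped_integral h x) x < e \<and> h > 0"
    by eventually_elim simp
  then obtain h where "dist ((1 / h) *\<^sub>R damped_integral h x) x < e" "h > 0"
    using eventually_happens'[OF trivial_limit_at_right_real] by blast
  then show ?thesis
    by (intro that[of "(1 / h) *\<^sub>R damped_integral h x"] DA_scaleR damped_integral_in_DA)
      (auto simp: dist_norm norm_minus_commute)
qed

text \<open>By \<open>A_damped_integral\<close>, I - A maps the integral over [0,1] started at y to
  y - e^(-1) S(1) y. This perturbs the identity by an operator of norm at most e^(-1) < 1, so a
  fixed point solves for y and no integral up to infinity is needed.\<close>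

lemma one_minus_A_surj:
  obtains x where "x \<in> DA" "x - A x = v"
proof -
  have "\<exists>!y. v + exp (- 1) *\<^sub>R S 1 y = y"
  proof (rule banach_fix_type[of "exp (- 1)"])
    show "\<forall>x y. dist (v + exp (- 1) *\<^sub>R S 1 x) (v + exp (- 1) *\<^sub>R S 1 y) \<le> exp (- 1) * dist x y"
      using norm_S_le[of 1]
      by (simp add: dist_norm bounded_clinear_diff[OF clinear_S, symmetric] mult_left_mono
          flip: scaleR_diff_right)
  qed auto
  then obtain y where y: "y = v + exp (- 1) *\<^sub>R S 1 y" by metis
  show ?thesis
  proof (rule that[of "damped_integral 1 y"])
    show "damped_integral 1 y \<in> DA" by (rule damped_integral_in_DA) simp
    have "damped_integral 1 y - A (damped_integral 1 y) = y - damped y 1"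
      by (subst A_damped_integral) auto
    also have "\<dots> = v"
      using y by (simp add: damped_def algebra_simps)
    finally show "damped_integral 1 y - A (damped_integral 1 y) = v" .
  qed
qed

text \<open>Dissipativity, used through the two expansions of the squared norms. The first
  inequality makes the Cayley transform a contraction, the second makes I - A injective.\<close>

lemma norm_one_plus_A_le:
  assumes "x \<in> DA"
  shows "norm (x + A x) \<le> norm (x - A x)" "norm x \<le> norm (x - A x)"
proof -
  have "(norm (x - A x))\<^sup>2 - (norm (x + A x))\<^sup>2 = - 4 * inner (A x) x"
    by (simp add: power2_norm_eq_inner inner_simps inner_commute)
  then have "(norm (x + A x))\<^sup>2 \<le> (norm (x - A x))\<^sup>2"
    using inner_A_nonpos[OF assms] by linarith
  then show "norm (x + A x) \<le> norm (x - A x)"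
    by (rule power2_le_imp_le) simp
  have "(norm (x - A x))\<^sup>2 = (norm x)\<^sup>2 + (norm (A x))\<^sup>2 - 2 * inner (A x) x"
    by (simp add: power2_norm_eq_inner inner_simps inner_commute)
  then have "(norm x)\<^sup>2 \<le> (norm (x - A x))\<^sup>2"
    using inner_A_nonpos[OF assms] by (smt (verit) zero_le_power2)
  then show "norm x \<le> norm (x - A x)"
    by (rule power2_le_imp_le) simp
qed

lemma inj_one_minus_A: "inj_on (\<lambda>x. x - A x) DA"
proof
  fix x y assume xy: "x \<in> DA" "y \<in> DA" "x - A x = y - A y"
  have "norm (x - y) \<le> norm ((x - y) - A (x - y))"
    by (intro norm_one_plus_A_le DA_diff xy)
  also have "(x - y) - A (x - y) = 0"
    using xy by (simp add: A_diff algebra_simps)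
  finally show "x = y" by simp
qed

section \<open>The Cayley transform as a contraction commuting with the semigroup\<close>

abbreviation T :: "'x \<Rightarrow> 'x" where "T \<equiv> cayley DA A"

lemma cayley_apply: "x \<in> DA \<Longrightarrow> T (x - A x) = x + A x"
  by (simp add: cayley_def inv_into_f_f[OF inj_one_minus_A])

sublocale contraction_operator T
proof
  have add: "T (v + w) = T v + T w" for v w
  proof -
    obtain x where x: "x \<in> DA" "x - A x = v" by (rule one_minus_A_surj)
    obtain y where y: "y \<in> DA" "y - A y = w" by (rule one_minus_A_surj)
    have "v + w = (x + y) - A (x + y)"
      using x y by (auto simp: A_add)
    then have "T (v + w) = (x + y) + A (x + y)"
      using x(1) y(1) by (simp only: cayley_apply DA_add)
    moreover have "T v = x + A x" "T w = y + A y"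
      using cayley_apply[OF x(1)] cayley_apply[OF y(1)] x(2) y(2) by simp_all
    ultimately show ?thesis
      using x(1) y(1) by (simp add: A_add)
  qed
  have scaleC: "T (c *\<^sub>C v) = c *\<^sub>C T v" for c v
  proof -
    obtain x where x: "x \<in> DA" "x - A x = v" by (rule one_minus_A_surj)
    then have "c *\<^sub>C v = c *\<^sub>C x - A (c *\<^sub>C x)"
      by (auto simp: A_scaleC scaleC.diff_right)
    then have "T (c *\<^sub>C v) = c *\<^sub>C x + A (c *\<^sub>C x)"
      using x(1) by (simp only: cayley_apply DA_scaleC)
    moreover have "T v = x + A x"
      using cayley_apply[OF x(1)] x(2) by simp
    ultimately show ?thesis
      using x(1) by (simp add: A_scaleC scaleC.add_right)
  qed
  show norm: "norm (T v) \<le> norm v" for v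
    using one_minus_A_surj[of v] norm_one_plus_A_le(1) cayley_apply by metis
  have "T (r *\<^sub>R v) = r *\<^sub>R T v" for r v
    using scaleC[of "of_real r" v] by (simp add: scaleC_of_real)
  with add have "bounded_linear T"
    by (rule bounded_linear_intro[where K = 1]) (simp add: norm)
  with scaleC show "bounded_clinear T"
    by (simp add: bounded_clinear_def)
qed

lemma
  shows one_plus_cayley_in_DA: "q + T q \<in> DA"
    and A_one_plus_cayley: "A (q + T q) = T q - q"
proof -
  obtain x where x: "x \<in> DA" "x - A x = q"
    by (rule one_minus_A_surj)
  have "T q = x + A x"
    using cayley_apply[OF x(1)] x(2) by simp
  then have *: "q + T q = 2 *\<^sub>R x" "T q - q = 2 *\<^sub>R A x"
    using x(2) by (auto simp: scaleR_2)
  show "q + T q \<in> DA" "A (q + T q) = T q - q"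
    unfolding * using x(1) by (simp_all add: DA_scaleR A_scaleR)
qed

lemma DA_eq_range:
  assumes "x \<in> DA"
  obtains q where "x = q + T q"
\<comment> \<open>For v = x - A x the Cayley transform gives v + T v = 2 x, hence the factor
  1/2.\<close>
proof (rule that[of "(1/2) *\<^sub>R (x - A x)"])
  show "x = (1/2) *\<^sub>R (x - A x) + T ((1/2) *\<^sub>R (x - A x))"
    using scaleR_half_double[of x]
    by (simp add: bounded_clinear_scaleR[OF clinear_T] cayley_apply[OF assms]
        flip: scaleR_add_right)
qed

lemma S_cayley:
  assumes "t \<ge> 0"
  shows "S t (T v) = T (S t v)"
proof -
  obtain x where x: "x \<in> DA" "x - A x = v"
    by (rule one_minus_A_surj)
  have "S t (T v) = S t x + A (S t x)"
    using cayley_apply[OF x(1)] x assms by (simp add: bounded_clinear_add[OF clinear_S] A_S)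
  also have "\<dots> = T (S t x - A (S t x))"
    by (rule cayley_apply[symmetric]) (rule DA_S[OF x(1) assms])
  also have "S t x - A (S t x) = S t v"
    using x assms by (simp add: A_S flip: bounded_clinear_diff[OF clinear_S])
  finally show ?thesis .
qed

end

section \<open>Laguerre polynomials\<close>

text \<open>The generalized Laguerre polynomial L_n^(a).\<close>

definition laguerre :: "real \<Rightarrow> nat \<Rightarrow> real \<Rightarrow> real" where
  "laguerre a n u = (\<Sum>k\<le>n. (- 1) ^ k * ((of_nat n + a) gchoose (n - k)) / fact k * u ^ k)"

text \<open>This is -L_(n-1)^(a+1); the empty sum takes care of n = 0.\<close>

definition laguerre_deriv :: "real \<Rightarrow> nat \<Rightarrow> real \<Rightarrow> real" where
  "laguerre_deriv a n u =
    (\<Sum>k<n. (- 1) ^ Suc k * ((of_nat n + a) gchoose (n - Suc k)) / fact k * u ^ k)"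

lemma DERIV_laguerre: "(laguerre a n has_real_derivative laguerre_deriv a n u) (at u)"
proof (cases n)
  case 0
  then show ?thesis by (simp add: laguerre_def[abs_def] laguerre_deriv_def)
next
  case (Suc m)
  define c where "c = (\<lambda>k. (- 1) ^ k * ((of_nat n + a) gchoose (n - k)) / fact k)"
  have "((\<lambda>u. \<Sum>k\<le>n. c k * u ^ k) has_real_derivative (\<Sum>k\<le>n. c k * (of_nat k * u ^ (k - 1)))) (at u)"
    by (auto intro!: derivative_eq_intros sum.cong)
  also have "(\<Sum>k\<le>n. c k * (of_nat k * u ^ (k - 1))) =
      (\<Sum>k\<le>m. c (Suc k) * (of_nat (Suc k) * u ^ k))"
    unfolding Suc by (subst sum.atMost_Suc_shift) simp
  also have "\<dots> = laguerre_deriv a n u"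
    unfolding laguerre_deriv_def Suc lessThan_Suc_atMost c_def
    by (intro sum.cong) (auto simp: divide_simps)
  finally show ?thesis by (simp add: laguerre_def[abs_def] c_def)
qed

lemma laguerre_0: "laguerre a n 0 = (of_nat n + a) gchoose n"
proof -
  have "laguerre a n 0 = (\<Sum>k\<in>{0}. (- 1) ^ k * ((of_nat n + a) gchoose (n - k)) / fact k * 0 ^ k)"
    unfolding laguerre_def by (rule sum.mono_neutral_right) auto
  then show ?thesis by simp
qed

text \<open>Pascal's rule, coefficient by coefficient, with the top power split off. Summed up, it
  expresses the derivative by the lower polynomials; rewritten for the Laguerre functions, it
  becomes their recurrence in n.\<close>

lemma laguerre_deriv_Suc:
  "laguerre_deriv a (Suc n) u = laguerre_deriv a n u - laguerre a n u"
proof -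
  have "laguerre_deriv a (Suc n) u =
      (\<Sum>k\<le>n. (- 1) ^ Suc k * ((of_nat (Suc n) + a) gchoose (n - k)) / fact k * u ^ k)"
    by (simp add: laguerre_deriv_def lessThan_Suc_atMost)
  also have "\<dots> = (\<Sum>k<n. (- 1) ^ Suc k * ((of_nat (Suc n) + a) gchoose (n - k)) / fact k * u ^ k)
      + (- 1) ^ Suc n / fact n * u ^ n"
    by (simp flip: lessThan_Suc_atMost)
  also have "(\<Sum>k<n. (- 1) ^ Suc k * ((of_nat (Suc n) + a) gchoose (n - k)) / fact k * u ^ k) =
      (\<Sum>k<n. (- 1) ^ Suc k * ((of_nat n + a) gchoose (n - Suc k)) / fact k * u ^ k) -
      (\<Sum>k<n. (- 1) ^ k * ((of_nat n + a) gchoose (n - k)) / fact k * u ^ k)"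
    unfolding sum_subtractf[symmetric]
  proof (rule sum.cong[OF refl])
    fix k assume "k \<in> {..<n}"
    then have "n - k = Suc (n - Suc k)" by auto
    then have "(of_nat (Suc n) + a) gchoose (n - k) =
        ((of_nat n + a) gchoose (n - Suc k)) + ((of_nat n + a) gchoose (n - k))"
      using gbinomial_Suc_Suc[of "of_nat n + a" "n - Suc k"] by (simp add: ac_simps)
    then show "(- 1) ^ Suc k * ((of_nat (Suc n) + a) gchoose (n - k)) / fact k * u ^ k =
        (- 1) ^ Suc k * ((of_nat n + a) gchoose (n - Suc k)) / fact k * u ^ k -
        (- 1) ^ k * ((of_nat n + a) gchoose (n - k)) / fact k * u ^ k"
      by (simp add: field_simps)
  qed
  also have "(\<Sum>k<n. (- 1) ^ k * ((of_nat n + a) gchoose (n - k)) / fact k * u ^ k) =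
      laguerre a n u - (- 1) ^ n / fact n * u ^ n"
    unfolding laguerre_def by (simp flip: lessThan_Suc_atMost)
  finally show ?thesis
    by (simp add: laguerre_deriv_def)
qed

lemma laguerre_deriv_eq: "laguerre_deriv a n u = - (\<Sum>j<n. laguerre a j u)"
  by (induction n) (simp_all add: laguerre_deriv_Suc, simp add: laguerre_deriv_def)

text \<open>At time 0 the generating function of the Laguerre functions is (1+z)^(-1-a), and these
  are its coefficients.\<close>

lemma neg_gbinomial_conv_laguerre: "((- 1 - a) gchoose n) = (- 1) ^ n * laguerre a n 0"
  unfolding laguerre_0 by (subst gbinomial_negated_upper) (simp add: algebra_simps)

text \<open>Subexponential growth in n, locally uniformly in u, so that r^n times a Laguerre
  function stays summable for r < 1. At u = 0 it follows from convergence of the binomial series at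
  1/q. Strong induction extends it to u > 0, since the derivative is minus the sum of all lower
  polynomials and a geometric sum bounds that.\<close>

lemma laguerre_bound:
  assumes "q > 1"
  obtains K b where "K > 0" "b > 0"
    "\<And>n u. u \<ge> 0 \<Longrightarrow> \<bar>laguerre a n u\<bar> \<le> K * q ^ n * exp (b * u)"
    "\<And>n u. u \<ge> 0 \<Longrightarrow> \<bar>laguerre_deriv a n u\<bar> \<le> K * q ^ n * exp (b * u)"
proof -
  have "\<bar>1 / q\<bar> < 1" using assms by simp
  from sums_summable[OF gen_binomial_real[OF this, of "- 1 - a"]]
  have "Bseq (\<lambda>n. ((- 1 - a) gchoose n) * (1 / q) ^ n)"
    by (rule convergent_imp_Bseq[OF convergentI[OF summable_LIMSEQ_zero]])
  then obtain K0 where K0: "K0 > 0" "\<And>n. norm (((- 1 - a) gchoose n) * (1 / q) ^ n) \<le> K0"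
    by (auto simp: Bseq_def)
  have L0: "\<bar>laguerre a n 0\<bar> \<le> K0 * q ^ n" for n
  proof -
    have "\<bar>laguerre a n 0\<bar> * (1 / q) ^ n \<le> K0"
      using K0(2)[of n] assms by (simp add: neg_gbinomial_conv_laguerre abs_mult)
    then show ?thesis using assms by (simp add: field_simps)
  qed
  define K where "K = 2 * K0"
  define b where "b = 2 / (q - 1)"
  have b: "b > 0" and K: "K > 0" using assms K0 by (auto simp: b_def K_def)
  have geo: "(\<Sum>j<n. q ^ j) \<le> q ^ n / (q - 1)" for n
    using assms by (simp add: geometric_sum divide_right_mono)
  have der: "\<bar>laguerre_deriv a n u\<bar> \<le> K * (q ^ n / (q - 1)) * exp (b * u)"
    if "\<And>j. j < n \<Longrightarrow> \<bar>laguerre a j u\<bar> \<le> K * q ^ j * exp (b * u)" for n u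
  proof -
    have "\<bar>laguerre_deriv a n u\<bar> \<le> (\<Sum>j<n. \<bar>laguerre a j u\<bar>)"
      unfolding laguerre_deriv_eq by (simp add: sum_abs)
    also have "\<dots> \<le> (\<Sum>j<n. K * q ^ j * exp (b * u))"
      by (intro sum_mono that) auto
    also have "\<dots> = K * (\<Sum>j<n. q ^ j) * exp (b * u)"
      by (simp add: sum_distrib_left sum_distrib_right)
    also have "\<dots> \<le> K * (q ^ n / (q - 1)) * exp (b * u)"
      using K by (intro mult_right_mono mult_left_mono geo) auto
    finally show ?thesis .
  qed
  have L: "\<bar>laguerre a n u\<bar> \<le> K * q ^ n * exp (b * u)" if "u \<ge> 0" for n u
    using that
  proof (induction n arbitrary: u rule: less_induct)
    case (less n)
    \<comment> \<open>By the choice b = 2/(q-1) the derivative of \<open>g\<close> is exactly the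
      bound supplied by \<open>der\<close>, and \<open>g 0 = K0 * q ^ n\<close> dominates the value
      at 0. Comparing \<open>laguerre a n\<close> and its negative with \<open>g\<close> gives the
      claim.\<close>
    define g where "g = (\<lambda>u. K * q ^ n / 2 * exp (b * u))"
    have g': "(g has_real_derivative K * (q ^ n / (q - 1)) * exp (b * x)) (at x)" for x
    proof -
      have "K * (q ^ n / (q - 1)) = K * q ^ n / 2 * b" by (simp add: b_def)
      then show ?thesis unfolding g_def by (simp only:) (auto intro!: derivative_eq_intros)
    qed
    have bound: "\<bar>laguerre_deriv a n x\<bar> \<le> K * (q ^ n / (q - 1)) * exp (b * x)" if "x \<ge> 0" for x
      by (intro der less.IH that)
    have "laguerre a n 0 - g 0 \<ge> laguerre a n u - g u"
      using bound
      by (intro DERIV_nonpos_imp_nonincreasing[OF less.prems])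
        (fastforce intro!: DERIV_diff DERIV_laguerre g' simp: abs_le_iff)
    moreover have "- laguerre a n 0 - g 0 \<ge> - laguerre a n u - g u"
      using bound
      by (intro DERIV_nonpos_imp_nonincreasing[OF less.prems])
        (fastforce intro!: DERIV_diff DERIV_minus DERIV_laguerre g' simp: abs_le_iff)
    moreover have "g 0 = K0 * q ^ n" by (simp add: g_def K_def)
    moreover have "K0 * q ^ n \<le> g u"
      using K0(1) assms b less.prems by (simp add: g_def K_def)
    ultimately have "\<bar>laguerre a n u\<bar> \<le> 2 * g u"
      using L0[of n] K0(1) assms by (smt (verit) zero_le_power mult_nonneg_nonneg)
    then show ?case by (simp add: g_def)
  qed
  have "K * max 1 (1 / (q - 1)) > 0" using K by simp
  moreover have "\<bar>laguerre a n u\<bar> \<le> K * max 1 (1 / (q - 1)) * q ^ n * exp (b * u)" if "u \<ge> 0" for n u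
  proof -
    have "K * q ^ n * exp (b * u) * 1 \<le> K * q ^ n * exp (b * u) * max 1 (1 / (q - 1))"
      using K assms by (intro mult_left_mono) auto
    then show ?thesis using L[OF that, of n] by (simp add: mult_ac)
  qed
  moreover have "\<bar>laguerre_deriv a n u\<bar> \<le> K * max 1 (1 / (q - 1)) * q ^ n * exp (b * u)"
    if "u \<ge> 0" for n u
  proof -
    have "K * q ^ n * exp (b * u) * (1 / (q - 1)) \<le> K * q ^ n * exp (b * u) * max 1 (1 / (q - 1))"
      using K assms by (intro mult_left_mono) auto
    then show ?thesis using der[OF L[OF that], of n] by (simp add: mult_ac)
  qed
  ultimately show ?thesis using that b by blast
qed

section \<open>Finite differences and orthogonality of the Laguerre polynomials\<close>

lemma alternating_binomial_sum_Suc: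
  fixes g :: "nat \<Rightarrow> real"
  shows "(\<Sum>k\<le>Suc n. (- 1) ^ k * of_nat (Suc n choose k) * g k) =
    (\<Sum>k\<le>n. (- 1) ^ k * of_nat (n choose k) * (g k - g (Suc k)))"
proof -
  have "(\<Sum>k\<le>Suc n. (- 1) ^ k * of_nat (Suc n choose k) * g k) =
      g 0 + (\<Sum>k\<le>n. (- 1) ^ Suc k * of_nat (Suc n choose Suc k) * g (Suc k))"
    by (subst sum.atMost_Suc_shift) simp
  also have "(\<Sum>k\<le>n. (- 1) ^ Suc k * of_nat (Suc n choose Suc k) * g (Suc k)) =
      (\<Sum>k\<le>n. (- 1) ^ Suc k * of_nat (n choose Suc k) * g (Suc k)) -
      (\<Sum>k\<le>n. (- 1) ^ k * of_nat (n choose k) * g (Suc k))"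
    unfolding sum_subtractf[symmetric] by (intro sum.cong refl) (simp add: algebra_simps)
  also have "g 0 + ((\<Sum>k\<le>n. (- 1) ^ Suc k * of_nat (n choose Suc k) * g (Suc k)) -
      (\<Sum>k\<le>n. (- 1) ^ k * of_nat (n choose k) * g (Suc k))) =
      (\<Sum>k\<le>Suc n. (- 1) ^ k * of_nat (n choose k) * g k) -
      (\<Sum>k\<le>n. (- 1) ^ k * of_nat (n choose k) * g (Suc k))"
  proof -
    have "(\<Sum>k\<le>Suc n. (- 1) ^ k * of_nat (n choose k) * g k) =
        g 0 + (\<Sum>k\<le>n. (- 1) ^ Suc k * of_nat (n choose Suc k) * g (Suc k))"
      by (subst sum.atMost_Suc_shift) simp
    then show ?thesis by (simp only: add_diff_eq)
  qed
  also have "(\<Sum>k\<le>Suc n. (- 1) ^ k * of_nat (n choose k) * g k) =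
      (\<Sum>k\<le>n. (- 1) ^ k * of_nat (n choose k) * g k)"
    by simp
  finally show ?thesis by (simp add: right_diff_distrib sum_subtractf)
qed

lemma pochhammer_shift_diff:
  "pochhammer a (Suc i) - pochhammer (a + 1) (Suc i) = - of_nat (Suc i) * pochhammer (a + 1) i"
  for a :: real
  unfolding pochhammer_rec[of a] pochhammer_Suc[of "a + 1"] by (simp add: algebra_simps)

text \<open>Up to sign, the left side is the n-th finite difference in k of a monic polynomial of
  degree j: it vanishes for j < n and is the factorial for j = n. Induction works because the
  difference of a rising factorial is a multiple of the next lower one, started at a + 1.\<close>

lemma alternating_pochhammer_sum:
  fixes a :: real
  shows "j \<le> n \<Longrightarrow> (\<Sum>k\<le>n. (- 1) ^ k * of_nat (n choose k) * pochhammer (a + of_nat k) j) =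
    (if j = n then (- 1) ^ n * fact n else 0)"
proof (induction n arbitrary: a j)
  case 0
  then show ?case by simp
next
  case (Suc n)
  show ?case
  proof (cases j)
    case 0
    then show ?thesis
      by (simp only: alternating_binomial_sum_Suc) simp
  next
    case j: (Suc i)
    have diff: "pochhammer (a + of_nat k) (Suc i) - pochhammer (a + of_nat (Suc k)) (Suc i) =
        - of_nat (Suc i) * pochhammer ((a + 1) + of_nat k) i" for k
      using pochhammer_shift_diff[of "a + of_nat k" i] by (simp add: add_ac)
    have "(\<Sum>k\<le>Suc n. (- 1) ^ k * of_nat (Suc n choose k) * pochhammer (a + of_nat k) (Suc i)) =
        - of_nat (Suc i) * (\<Sum>k\<le>n. (- 1) ^ k * of_nat (n choose k) * pochhammer ((a + 1) + of_nat k) i)"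
      unfolding alternating_binomial_sum_Suc diff by (simp add: sum_distrib_left mult_ac)
    also have "\<dots> = - of_nat (Suc i) * (if i = n then (- 1) ^ n * fact n else 0)"
      using Suc.prems j by (subst Suc.IH) auto
    finally show ?thesis unfolding j by (simp only:) (simp add: algebra_simps)
  qed
qed

text \<open>Log-convexity of Gamma between n + 1 and n + 2. It compares the squared norms of the
  Laguerre system with the weight of the discrete inequality without loss of a constant.\<close>

lemma Gamma_le_fact_powr:
  assumes "0 < a" "a < 1"
  shows "Gamma (of_nat n + 1 + a) \<le> fact n * (1 + real n) powr a"
proof -
  have pos: "Gamma (of_nat n + 1 + a) > 0"
    using assms by (intro Gamma_real_pos) simp
  have "(ln \<circ> Gamma) ((1 - a) *\<^sub>R (real n + 1) + a *\<^sub>R (real n + 2)) \<le>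
      (1 - a) * (ln \<circ> Gamma) (real n + 1) + a * (ln \<circ> Gamma) (real n + 2)"
    using assms by (intro convex_onD[OF log_convex_Gamma_real]) auto
  moreover have "(1 - a) *\<^sub>R (real n + 1) + a *\<^sub>R (real n + 2) = real n + 1 + a"
    by (simp add: algebra_simps)
  moreover have "Gamma (real n + 1) = fact n"
    using Gamma_fact[of n, where ?'a = real] by (simp add: add.commute)
  moreover have "Gamma (real n + 2) = fact n * (1 + real n)"
    using Gamma_fact[of "Suc n", where ?'a = real] by (simp add: add_ac)
  ultimately have "ln (Gamma (real n + 1 + a)) \<le> (1 - a) * ln (fact n) + a * ln (fact n * (1 + real n))"
    by simp
  also have "ln (fact n * (1 + real n)) = ln (fact n) + ln (1 + real n)"
    by (simp add: ln_mult)
  also have "(1 - a) * ln (fact n) + a * (ln (fact n) + ln (1 + real n)) =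
      ln (fact n) + a * ln (1 + real n)"
    by (simp add: algebra_simps)
  also have "\<dots> = ln (fact n * (1 + real n) powr a)"
    by (simp add: ln_mult ln_powr)
  finally show ?thesis
    using pos by (simp add: add_pos_nonneg)
qed

text \<open>Termwise the integrals are Gamma values. Once the common factor Gamma(n+1+a)/n! is taken
  out, the remaining sum over k is the n-th difference evaluated above.\<close>

lemma laguerre_moment:
  assumes a: "a > 0" and j: "j \<le> n"
  shows "((\<lambda>u. u powr a * exp (- u) * u ^ j * laguerre a n u) has_integral
    (if j = n then (- 1) ^ n * Gamma (of_nat n + 1 + a) else 0)) {0..}"
proof -
  define c where "c = (\<lambda>k. (- 1) ^ k * ((of_nat n + a) gchoose (n - k)) / fact k)"
  have mono: "((\<lambda>u. u powr a * exp (- u) * u ^ m) has_integral Gamma (of_nat m + 1 + a)) {0..}" for m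
  proof (rule has_integral_eq[rotated])
    show "((\<lambda>u. u powr ((of_nat m + 1 + a) - 1) / exp u) has_integral Gamma (of_nat m + 1 + a)) {0..}"
      by (rule Gamma_integral_real) (use a in simp)
    show "u powr ((of_nat m + 1 + a) - 1) / exp u = u powr a * exp (- u) * u ^ m" if "u \<in> {0..}" for u
      using that a by (cases "u = 0") (simp_all add: powr_add powr_realpow exp_minus field_simps)
  qed
  have "((\<lambda>u. \<Sum>k\<le>n. c k * (u powr a * exp (- u) * u ^ (j + k))) has_integral
      (\<Sum>k\<le>n. c k * Gamma (of_nat (j + k) + 1 + a))) {0..}"
    by (intro has_integral_sum has_integral_mult_right mono) simp
  moreover have "(\<lambda>u. \<Sum>k\<le>n. c k * (u powr a * exp (- u) * u ^ (j + k))) =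
      (\<lambda>u. u powr a * exp (- u) * u ^ j * laguerre a n u)"
    by (simp add: laguerre_def c_def sum_distrib_left power_add mult_ac)
  moreover have "(\<Sum>k\<le>n. c k * Gamma (of_nat (j + k) + 1 + a)) =
      Gamma (of_nat n + 1 + a) / fact n *
      (\<Sum>k\<le>n. (- 1) ^ k * of_nat (n choose k) * pochhammer ((1 + a) + of_nat k) j)"
    unfolding sum_distrib_left
  proof (rule sum.cong[OF refl])
    fix k assume "k \<in> {..n}"
    then have k: "k \<le> n" by simp
    have ni: "of_nat k + 1 + a \<notin> \<int>\<^sub>\<le>\<^sub>0"
      using a by (auto elim!: nonpos_Ints_cases)
    have pos: "Gamma (of_nat k + 1 + a) > 0" by (rule Gamma_real_pos) (use a in simp)
    have "pochhammer (of_nat k + 1 + a) (n - k) = Gamma (of_nat n + 1 + a) / Gamma (of_nat k + 1 + a)"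
      using k by (subst pochhammer_Gamma[OF ni]) (simp add: of_nat_diff add_ac)
    then have 1: "(of_nat n + a) gchoose (n - k) =
        Gamma (of_nat n + 1 + a) / Gamma (of_nat k + 1 + a) / fact (n - k)"
      using k by (subst gbinomial_pochhammer') (simp add: of_nat_diff add_ac)
    have 2: "Gamma (of_nat (j + k) + 1 + a) =
        pochhammer ((1 + a) + of_nat k) j * Gamma (of_nat k + 1 + a)"
      using pochhammer_Gamma[OF ni, of j] pos by (simp add: field_simps add_ac)
    show "c k * Gamma (of_nat (j + k) + 1 + a) = Gamma (of_nat n + 1 + a) / fact n *
        ((- 1) ^ k * of_nat (n choose k) * pochhammer ((1 + a) + of_nat k) j)"
      unfolding c_def 1 2 binomial_fact[OF k]
      using pos by (simp add: field_simps)
  qed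
  moreover have "Gamma (of_nat n + 1 + a) / fact n * (if j = n then (- 1) ^ n * fact n else 0) =
      (if j = n then (- 1) ^ n * Gamma (of_nat n + 1 + a) else 0)" by simp
  ultimately show ?thesis
    by (simp only: alternating_pochhammer_sum[OF j])
qed

text \<open>Only the polynomial of smaller degree is expanded; all moments of the other one then
  vanish except possibly the top one.\<close>

lemma laguerre_orthogonal:
  assumes "a > 0"
  shows "((\<lambda>u. u powr a * exp (- u) * (laguerre a n u * laguerre a m u)) has_integral
    (if m = n then Gamma (of_nat n + 1 + a) / fact n else 0)) {0..}"
proof (induction m n rule: linorder_wlog)
  case (le m n)
  define c where "c = (\<lambda>k. (- 1) ^ k * ((of_nat m + a) gchoose (m - k)) / fact k)"
  have "((\<lambda>u. \<Sum>k\<le>m. c k * (u powr a * exp (- u) * u ^ k * laguerre a n u)) has_integral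
      (\<Sum>k\<le>m. c k * (if k = n then (- 1) ^ n * Gamma (of_nat n + 1 + a) else 0))) {0..}"
    using le by (intro has_integral_sum has_integral_mult_right laguerre_moment assms) auto
  moreover have "(\<lambda>u. \<Sum>k\<le>m. c k * (u powr a * exp (- u) * u ^ k * laguerre a n u)) =
      (\<lambda>u. u powr a * exp (- u) * (laguerre a n u * laguerre a m u))"
    by (simp add: laguerre_def[of a m] c_def sum_distrib_left mult_ac)
  moreover have "(\<Sum>k\<le>m. c k * (if k = n then (- 1) ^ n * Gamma (of_nat n + 1 + a) else 0)) =
      (if m = n then Gamma (of_nat n + 1 + a) / fact n else 0)"
    using le by (auto simp: c_def if_distrib sum.delta cong: if_cong)
  ultimately show ?case by simp
next
  case (sym m n)
  have "laguerre a n u * laguerre a m u = laguerre a m u * laguerre a n u" for u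
    by (rule mult.commute)
  moreover have "(if m = n then Gamma (of_nat n + 1 + a) / fact n else 0) =
      (if n = m then Gamma (of_nat m + 1 + a) / fact m else 0)"
    by auto
  ultimately show ?case using sym by (simp only:)
qed

lemma laguerre_parseval:
  fixes d :: "nat \<Rightarrow> 'y::real_inner"
  assumes a: "a > 0"
  shows "((\<lambda>u. u powr a * exp (- u) * (norm (\<Sum>n<N. laguerre a n u *\<^sub>R d n))\<^sup>2) has_integral
    (\<Sum>n<N. Gamma (of_nat n + 1 + a) / fact n * (norm (d n))\<^sup>2)) {0..}"
proof -
  have "((\<lambda>u. \<Sum>n<N. \<Sum>m<N. inner (d m) (d n) *
      (u powr a * exp (- u) * (laguerre a n u * laguerre a m u))) has_integral
      (\<Sum>n<N. \<Sum>m<N. inner (d m) (d n) * (if m = n then Gamma (of_nat n + 1 + a) / fact n else 0))) {0..}"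
    by (intro has_integral_sum has_integral_mult_right laguerre_orthogonal a) simp_all
  moreover have "(\<lambda>u. \<Sum>n<N. \<Sum>m<N. inner (d m) (d n) *
      (u powr a * exp (- u) * (laguerre a n u * laguerre a m u))) =
      (\<lambda>u. u powr a * exp (- u) * (norm (\<Sum>n<N. laguerre a n u *\<^sub>R d n))\<^sup>2)"
    by (simp add: power2_norm_eq_inner inner_sum_left inner_sum_right sum_distrib_left mult_ac)
  moreover have "(\<Sum>n<N. \<Sum>m<N. inner (d m) (d n) * (if m = n then Gamma (of_nat n + 1 + a) / fact n else 0)) =
      (\<Sum>n<N. Gamma (of_nat n + 1 + a) / fact n * (norm (d n))\<^sup>2)"
    by (simp add: if_distrib sum.delta power2_norm_eq_inner mult.commute cong: if_cong)
  ultimately show ?thesis by simp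
qed

definition laguerre_fun :: "real \<Rightarrow> nat \<Rightarrow> real \<Rightarrow> real" where
  "laguerre_fun a n t = (- 1) ^ n * exp (- t) * laguerre a n (2 * t)"

lemma continuous_on_laguerre: "continuous_on X (laguerre a n)"
  unfolding laguerre_def[abs_def] by (intro continuous_intros)

lemma laguerre_fun_bessel:
  fixes c :: "nat \<Rightarrow> 'y::real_inner"
  assumes a: "0 < a" "a < 1"
  shows "(\<integral>\<^sup>+t\<in>{0..}. ennreal (t powr a * (norm (\<Sum>n<N. laguerre_fun a n t *\<^sub>R c n))\<^sup>2) \<partial>lborel)
    \<le> (\<Sum>n<N. ennreal ((1 + real n) powr a * (norm (c n))\<^sup>2))"
proof -
  define d where "d = (\<lambda>n. (- 1) ^ n *\<^sub>R c n)"
  define f where "f = (\<lambda>u. ennreal (u powr a * exp (- u) * (norm (\<Sum>n<N. laguerre a n u *\<^sub>R d n))\<^sup>2) *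
    indicator {0..} u)"
  have norm_d: "norm (d n) = norm (c n)" for n by (simp add: d_def)
  have [measurable]: "(\<lambda>u. norm (\<Sum>n<N. laguerre a n u *\<^sub>R d n)) \<in> borel_measurable borel"
    by (intro borel_measurable_continuous_onI continuous_intros continuous_on_laguerre)
  have f_meas: "f \<in> borel_measurable borel" unfolding f_def by measurable
  have "ennreal (t powr a * (norm (\<Sum>n<N. laguerre_fun a n t *\<^sub>R c n))\<^sup>2) * indicator {0..} t
      = ennreal (2 powr (- a)) * f (0 + 2 * t)" for t
  proof (cases "t \<ge> 0")
    case True
    have "(\<Sum>n<N. laguerre_fun a n t *\<^sub>R c n) = exp (- t) *\<^sub>R (\<Sum>n<N. laguerre a n (2 * t) *\<^sub>R d n)"
      by (simp add: laguerre_fun_def d_def scaleR_sum_right mult_ac)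
    then have "(norm (\<Sum>n<N. laguerre_fun a n t *\<^sub>R c n))\<^sup>2 =
        exp (- (2 * t)) * (norm (\<Sum>n<N. laguerre a n (2 * t) *\<^sub>R d n))\<^sup>2"
      by (simp add: power_mult_distrib flip: exp_double)
    moreover have "t powr a = 2 powr (- a) * (2 * t) powr a"
      using True by (simp add: powr_mult flip: powr_add mult.assoc)
    ultimately show ?thesis
      using True by (simp add: f_def mult_ac flip: ennreal_mult)
  qed (simp add: f_def)
  then have "(\<integral>\<^sup>+t\<in>{0..}. ennreal (t powr a * (norm (\<Sum>n<N. laguerre_fun a n t *\<^sub>R c n))\<^sup>2) \<partial>lborel) =
      ennreal (2 powr (- a)) * (\<integral>\<^sup>+t. f (0 + 2 * t) \<partial>lborel)"
    using f_meas by (simp add: nn_integral_cmult)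
  \<comment> \<open>The exact factor of the substitution u = 2 t is 2^(-1-a). Enlarging 2^(-a) to
    the Jacobian 2 discards it, so the final estimate has constant 1.\<close>
  also have "\<dots> \<le> ennreal \<bar>2\<bar> * (\<integral>\<^sup>+t. f (0 + 2 * t) \<partial>lborel)"
  proof (rule mult_right_mono)
    have "2 powr (- a) \<le> (2::real) powr 0" using a by (intro powr_mono) auto
    then show "ennreal (2 powr (- a)) \<le> ennreal \<bar>2\<bar>"
      by (intro ennreal_leI) simp
  qed simp
  also have "\<dots> = (\<integral>\<^sup>+u. f u \<partial>lborel)"
    using nn_integral_real_affine[OF f_meas, of 2 0] by simp
  also have "\<dots> = ennreal (\<Sum>n<N. Gamma (of_nat n + 1 + a) / fact n * (norm (d n))\<^sup>2)"
    unfolding f_def by (rule nn_integral_has_integral_lebesgue'[OF _ laguerre_parseval]) (use a in auto)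
  also have "\<dots> \<le> ennreal (\<Sum>n<N. (1 + real n) powr a * (norm (c n))\<^sup>2)"
  proof (intro ennreal_leI sum_mono)
    fix n
    have "Gamma (of_nat n + 1 + a) / fact n \<le> (1 + real n) powr a"
      using Gamma_le_fact_powr[OF a, of n] by (simp add: divide_le_eq mult.commute)
    then show "Gamma (of_nat n + 1 + a) / fact n * (norm (d n))\<^sup>2 \<le> (1 + real n) powr a * (norm (c n))\<^sup>2"
      unfolding norm_d by (rule mult_right_mono) simp
  qed
  also have "\<dots> = (\<Sum>n<N. ennreal ((1 + real n) powr a * (norm (c n))\<^sup>2))"
    by (simp add: sum_ennreal)
  finally show ?thesis .
qed

section \<open>Binomial series and the Beta integral\<close>

lemma pochhammer_nonneg':
  fixes x :: real
  shows "x \<ge> 0 \<Longrightarrow> pochhammer x n \<ge> 0"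
  by (induction n) (simp_all add: pochhammer_Suc)

lemma gbinomial_Suc_pochhammer:
  "(b gchoose Suc k) = (- 1) ^ k * (b * pochhammer (1 - b) k / fact (Suc k))" for b :: real
proof -
  have "pochhammer (- b) (Suc k) = - b * pochhammer (1 - b) k"
    by (subst pochhammer_rec) simp
  then show ?thesis by (simp add: gbinomial_pochhammer)
qed

text \<open>For 0 < b \<le> 1 all non-constant coefficients of (1-w)^b are nonpositive. Sums of
  absolute values can therefore be evaluated in closed form at w = r; the coefficients of (1-w)^(-c)
  below are nonnegative and serve in the same way.\<close>

lemma abs_gbinomial_Suc:
  fixes b :: real
  assumes "0 < b" "b \<le> 1"
  shows "\<bar>b gchoose Suc k\<bar> = (- 1) ^ k * (b gchoose Suc k)"
proof -
  have "pochhammer (1 - b) k \<ge> 0"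
    using assms by (intro pochhammer_nonneg') auto
  then show ?thesis
    using assms by (simp add: gbinomial_Suc_pochhammer abs_mult flip: power_mult_distrib)
qed

lemma abs_gbinomial_neg:
  fixes c :: real
  assumes "0 \<le> c"
  shows "\<bar>(- c) gchoose k\<bar> = (- 1) ^ k * ((- c) gchoose k)"
proof -
  have "pochhammer c k \<ge> 0" using assms by (intro pochhammer_nonneg') auto
  then show ?thesis
    by (simp add: gbinomial_pochhammer abs_mult flip: power_mult_distrib)
qed

lemma summable_abs_gbinomial:
  fixes b r :: real
  assumes "0 \<le> r" "r < 1"
  shows "summable (\<lambda>n. \<bar>b gchoose n\<bar> * r ^ n)"
proof -
  have "\<bar>(r + 1) / 2\<bar> < 1" using assms by simp
  from sums_summable[OF gen_binomial_real[OF this, of b]]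
  have "summable (\<lambda>n. norm ((b gchoose n) * r ^ n))"
    by (rule powser_insidea) (use assms in simp)
  then show ?thesis using assms by (simp add: abs_mult)
qed

lemma abs_gbinomial_neg_sums:
  fixes c r :: real
  assumes "0 \<le> c" "0 \<le> r" "r < 1"
  shows "(\<lambda>n. \<bar>(- c) gchoose n\<bar> * r ^ n) sums ((1 - r) powr (- c))"
proof -
  have "(\<lambda>n. ((- c) gchoose n) * (- r) ^ n) sums ((1 + (- r)) powr (- c))"
    by (rule gen_binomial_real) (use assms in simp)
  moreover have "((- c) gchoose n) * (- r) ^ n = \<bar>(- c) gchoose n\<bar> * r ^ n" for n
    by (simp add: abs_gbinomial_neg[OF assms(1)] power_minus[of r])
  ultimately show ?thesis by simp
qed

lemma abs_gbinomial_Suc_sums: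
  fixes b r :: real
  assumes "0 < b" "b \<le> 1" "0 \<le> r" "r < 1"
  shows "(\<lambda>n. \<bar>b gchoose Suc n\<bar> * r ^ Suc n) sums (1 - (1 - r) powr b)"
proof -
  have "(\<lambda>n. (b gchoose n) * (- r) ^ n) sums ((1 + (- r)) powr b)"
    by (rule gen_binomial_real) (use assms in simp)
  then have "(\<lambda>n. (b gchoose Suc n) * (- r) ^ Suc n) sums ((1 - r) powr b - 1)"
    by (subst sums_Suc_iff) simp
  from sums_minus[OF this]
  have "(\<lambda>n. - ((b gchoose Suc n) * (- r) ^ Suc n)) sums (1 - (1 - r) powr b)" by simp
  moreover have "- ((b gchoose Suc n) * (- r) ^ Suc n) = \<bar>b gchoose Suc n\<bar> * r ^ Suc n" for n
    by (simp add: abs_gbinomial_Suc[OF assms(1,2)] power_minus[of r])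
  ultimately show ?thesis by (simp only:)
qed

text \<open>For r < 1 the partial sums are at most 1 - (1-r)^b \<le> 1, and in a finite sum the
  bound survives r -> 1. This is what makes (1+T)^b a norm convergent series at r = 1.\<close>

lemma
  fixes b :: real
  assumes "0 < b" "b \<le> 1"
  shows summable_abs_gbinomial_Suc: "summable (\<lambda>n. \<bar>b gchoose Suc n\<bar>)"
    and suminf_abs_gbinomial_Suc_le: "(\<Sum>n. \<bar>b gchoose Suc n\<bar>) \<le> 1"
proof -
  have partial: "(\<Sum>n<N. \<bar>b gchoose Suc n\<bar>) \<le> 1" for N
  proof (rule tendsto_upperbound)
    show "((\<lambda>r. \<Sum>n<N. \<bar>b gchoose Suc n\<bar> * r ^ Suc n) \<longlongrightarrow> (\<Sum>n<N. \<bar>b gchoose Suc n\<bar>)) (at_left (1::real))"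
      by (auto intro!: tendsto_eq_intros)
    have "\<forall>\<^sub>F r in at_left (1::real). r \<in> {0<..<1}"
      by (rule eventually_at_left_real) simp
    then show "\<forall>\<^sub>F r in at_left 1. (\<Sum>n<N. \<bar>b gchoose Suc n\<bar> * r ^ Suc n) \<le> 1"
    proof eventually_elim
      case (elim r)
      then have r: "0 \<le> r" "r < 1" by auto
      note sums = abs_gbinomial_Suc_sums[OF assms r]
      have "(\<Sum>n<N. \<bar>b gchoose Suc n\<bar> * r ^ Suc n) \<le> 1 - (1 - r) powr b"
        unfolding sums_unique[OF sums]
        using sums_summable[OF sums] r by (intro sum_le_suminf) auto
      then show ?case using powr_ge_zero[of "1 - r" b] by linarith
    qed
  qed simp
  show "summable (\<lambda>n. \<bar>b gchoose Suc n\<bar>)"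
    by (rule bounded_imp_summable[where B = 1])
      (use partial[of "Suc _"] in \<open>simp_all only: lessThan_Suc_atMost abs_ge_zero\<close>)
  then show "(\<Sum>n. \<bar>b gchoose Suc n\<bar>) \<le> 1"
    by (rule suminf_le_const) (rule partial)
qed

lemma
  fixes b r :: real
  assumes b: "0 < b" "b \<le> 1" and r: "0 \<le> r" "r \<le> 1"
  shows summable_abs_gbinomial_pos: "summable (\<lambda>n. \<bar>b gchoose n\<bar> * r ^ n)"
    and suminf_abs_gbinomial_pos_le: "(\<Sum>n. \<bar>b gchoose n\<bar> * r ^ n) \<le> 2"
proof -
  have le: "\<bar>b gchoose Suc n\<bar> * r ^ Suc n \<le> \<bar>b gchoose Suc n\<bar>" for n
    using r power_le_one[OF r, of "Suc n"] by (simp only: mult_left_le abs_ge_zero)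
  have sum_Suc: "summable (\<lambda>n. \<bar>b gchoose Suc n\<bar> * r ^ Suc n)"
    by (rule summable_comparison_test'[OF summable_abs_gbinomial_Suc[OF b]])
      (use le r in \<open>simp add: abs_mult\<close>)
  then show *: "summable (\<lambda>n. \<bar>b gchoose n\<bar> * r ^ n)"
    by (subst (asm) summable_Suc_iff)
  have "(\<Sum>n. \<bar>b gchoose Suc n\<bar> * r ^ Suc n) \<le> (\<Sum>n. \<bar>b gchoose Suc n\<bar>)"
    by (intro suminf_le le sum_Suc summable_abs_gbinomial_Suc b)
  also have "\<dots> \<le> 1" by (rule suminf_abs_gbinomial_Suc_le[OF b])
  finally show "(\<Sum>n. \<bar>b gchoose n\<bar> * r ^ n) \<le> 2"
    by (subst suminf_split_head[OF *, symmetric, unfolded diff_eq_eq]) simp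
qed

text \<open>Since the coefficients have one sign, the sum is a difference of two closed forms. The
  rate (1-r)^b is exactly what compensates the norm (1-r)^(-b) of the negative power later
  on.\<close>

lemma suminf_abs_gbinomial_diff_le:
  fixes b r :: real
  assumes b: "0 < b" "b \<le> 1" and r: "0 \<le> r" "r < 1"
  shows "(\<Sum>n. \<bar>b gchoose n\<bar> * (1 - r ^ n)) \<le> (1 - r) powr b"
proof -
  note s1 = summable_abs_gbinomial_Suc[OF b] and sr = abs_gbinomial_Suc_sums[OF b r]
  have diff: "(\<lambda>n. \<bar>b gchoose Suc n\<bar> * (1 - r ^ Suc n)) sums
      ((\<Sum>n. \<bar>b gchoose Suc n\<bar>) - (1 - (1 - r) powr b))"
    using sums_diff[OF summable_sums[OF s1] sr] by (simp add: right_diff_distrib)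
  then have "(\<lambda>n. \<bar>b gchoose n\<bar> * (1 - r ^ n)) sums
      ((\<Sum>n. \<bar>b gchoose Suc n\<bar>) - (1 - (1 - r) powr b))"
    by (subst (asm) sums_Suc_iff) simp
  then show ?thesis
    using suminf_abs_gbinomial_Suc_le[OF b] by (simp add: sums_iff)
qed

text \<open>The integral of \<tau>^(k-a) (1-\<tau>)^a over (0,1) is, up to a constant free of k, the
  absolute value of a binomial coefficient: the moments needed for the termwise integration
  below.\<close>

lemma Beta_gbinomial:
  fixes a :: real
  assumes "0 < a" "a < 1"
  shows "Beta (of_nat k + 1 - a) (1 + a) = Beta (1 - a) a * \<bar>a gchoose Suc k\<bar>"
proof -
  have ni: "1 - a \<notin> \<int>\<^sub>\<le>\<^sub>0" using assms by (auto elim!: nonpos_Ints_cases)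
  have pos: "Gamma (1 - a) > 0" using assms by (intro Gamma_real_pos) simp
  have "pochhammer (1 - a) k \<ge> 0"
    using assms by (intro pochhammer_nonneg') auto
  then have "\<bar>a gchoose Suc k\<bar> = a * pochhammer (1 - a) k / fact (Suc k)"
    using assms by (simp add: gbinomial_Suc_pochhammer abs_mult del: fact_Suc)
  also have "pochhammer (1 - a) k = Gamma (of_nat k + 1 - a) / Gamma (1 - a)"
    by (subst pochhammer_Gamma[OF ni]) (simp add: algebra_simps)
  finally have 1: "\<bar>a gchoose Suc k\<bar> = a * (Gamma (of_nat k + 1 - a) / Gamma (1 - a)) / fact (Suc k)" .
  have 2: "Gamma (1 + a) = a * Gamma a"
  proof -
    have "a \<notin> \<int>\<^sub>\<le>\<^sub>0" using assms by (auto elim!: nonpos_Ints_cases)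
    then show ?thesis using Gamma_plus1[of a] by (simp add: add.commute)
  qed
  have 3: "Gamma ((of_nat k + 1 - a) + (1 + a)) = fact (Suc k)"
    using Gamma_fact[of "Suc k", where ?'a = real] by (simp add: add_ac)
  have 4: "Gamma (1 - a + a) = (1::real)" by simp
  show ?thesis
    unfolding Beta_def 1 2 3 4 using pos by (simp add: field_simps del: fact_Suc)
qed

text \<open>
  Termwise integration of the Beta integral representation
  $(1+w)^a = c \int_0^1 \tau^{-a} (1-\tau)^{a-1} \frac{1+w}{1+\tau w} \, d\tau$, with the powers of $w$
  replaced by a bounded sequence.
\<close>

lemma has_integral_gbinomial_series:
  fixes a b0 :: real and b :: "nat \<Rightarrow> real"
  assumes a: "0 < a" "a < 1" and b: "\<And>k. \<bar>b k\<bar> \<le> M"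
  shows "((\<lambda>\<tau>. \<tau> powr (- a) * (1 - \<tau>) powr (a - 1) * (b0 + (1 - \<tau>) * (\<Sum>k. (- \<tau>) ^ k * b k)))
    has_integral (Beta (1 - a) a * (b0 + (\<Sum>k. (a gchoose Suc k) * b k)))) {0..1}"
proof -
  define g where "g = (\<lambda>k \<tau>. indicator {0..1} \<tau> *\<^sub>R
    (\<tau> powr ((of_nat k + 1 - a) - 1) * (1 - \<tau>) powr ((1 + a) - 1)) :: real)"
  define f where "f = (\<lambda>k \<tau>. g k \<tau> * ((- 1) ^ k * b k))"
  have g_nonneg: "g k \<tau> \<ge> 0" for k \<tau> by (simp add: g_def)
  have g_int: "integrable lborel (g k)" for k
    unfolding g_def set_integrable_def[symmetric] using a by (intro integrable_Beta) auto
  have g_eq: "integral\<^sup>L lborel (g k) = Beta (1 - a) a * \<bar>a gchoose Suc k\<bar>" for k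
  proof -
    have "(g k has_integral integral\<^sup>L lborel (g k)) UNIV"
      by (rule has_integral_integral_lborel[OF g_int])
    then have "((\<lambda>\<tau>. \<tau> powr ((of_nat k + 1 - a) - 1) * (1 - \<tau>) powr ((1 + a) - 1))
        has_integral integral\<^sup>L lborel (g k)) {0..1}"
      by (subst has_integral_restrict_UNIV[symmetric])
        (simp add: g_def indicator_def of_bool_def if_distrib[of "\<lambda>c. c * _"] cong: if_cong)
    moreover have "((\<lambda>\<tau>. \<tau> powr ((of_nat k + 1 - a) - 1) * (1 - \<tau>) powr ((1 + a) - 1))
        has_integral Beta (of_nat k + 1 - a) (1 + a)) {0..1}"
      using a by (intro has_integral_Beta_real) auto
    ultimately show ?thesis
      using has_integral_unique Beta_gbinomial[OF a, of k] by metis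
  qed
  have f_int: "integrable lborel (f k)" for k
    unfolding f_def by (intro integrable_mult_left g_int)
  have M: "M \<ge> 0" using b[of 0] by linarith
  have norm_f: "norm (f k \<tau>) = g k \<tau> * \<bar>b k\<bar>" for k \<tau>
    using g_nonneg[of k \<tau>] by (simp add: f_def abs_mult)
  have f_norm_sum: "summable (\<lambda>k. norm (f k \<tau>))" for \<tau>
  proof (cases "\<tau> \<in> {0<..<1}")
    case True
    have "norm (norm (f k \<tau>)) \<le> (\<tau> powr (- a) * (1 - \<tau>) powr a * M) * \<tau> ^ k" for k
    proof -
      have "g k \<tau> = \<tau> powr (- a) * (1 - \<tau>) powr a * \<tau> ^ k"
        using True by (simp add: g_def powr_diff powr_minus powr_realpow field_simps)
      then have "norm (f k \<tau>) \<le> \<tau> powr (- a) * (1 - \<tau>) powr a * \<tau> ^ k * M"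
        unfolding norm_f using b[of k] g_nonneg[of k \<tau>] by (simp only: mult_left_mono)
      then show ?thesis by (simp add: mult_ac)
    qed
    moreover have "summable (\<lambda>k. (\<tau> powr (- a) * (1 - \<tau>) powr a * M) * \<tau> ^ k)"
      using True by (intro summable_mult summable_geometric) simp
    ultimately show ?thesis by (rule summable_comparison_test'[rotated])
  next
    case False
    \<comment> \<open>At the endpoints this relies on the value \<open>0 powr x = 0\<close> for
      every exponent, including the negative one that occurs at \<tau> = 0 for k = 0.\<close>
    then have "g k \<tau> = 0" for k
      by (cases "\<tau> = 0"; cases "\<tau> = 1") (auto simp: g_def)
    then show ?thesis by (simp add: f_def)
  qed
  have "summable (\<lambda>k. Beta (1 - a) a * (\<bar>a gchoose Suc k\<bar> * M))"
    using a by (intro summable_mult summable_mult2 summable_abs_gbinomial_Suc) auto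
  then have norm_int_sum: "summable (\<lambda>k. \<integral>\<tau>. norm (f k \<tau>) \<partial>lborel)"
  proof (rule summable_comparison_test')
    fix k
    have "Beta (1 - a) a \<ge> 0" using a by (auto simp: Beta_def intro!: mult_nonneg_nonneg Gamma_real_nonneg)
    then show "norm (\<integral>\<tau>. norm (f k \<tau>) \<partial>lborel) \<le> Beta (1 - a) a * (\<bar>a gchoose Suc k\<bar> * M)"
      unfolding norm_f using b[of k] by (simp add: g_eq abs_mult mult_left_mono mult.assoc)
  qed
  have sums: "(\<lambda>k. integral\<^sup>L lborel (f k)) sums (\<integral>\<tau>. (\<Sum>k. f k \<tau>) \<partial>lborel)"
    using f_int f_norm_sum norm_int_sum by (intro sums_integral) auto
  have F_int: "integrable lborel (\<lambda>\<tau>. \<Sum>k. f k \<tau>)"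
    using f_int f_norm_sum norm_int_sum by (intro integrable_suminf) auto
  have "integral\<^sup>L lborel (f k) = Beta (1 - a) a * ((a gchoose Suc k) * b k)" for k
    unfolding f_def using abs_gbinomial_Suc[of a k] a by (simp add: g_eq mult_ac)
  with sums have "(\<integral>\<tau>. (\<Sum>k. f k \<tau>) \<partial>lborel) = (\<Sum>k. Beta (1 - a) a * ((a gchoose Suc k) * b k))"
    by (simp add: sums_iff)
  also have "\<dots> = Beta (1 - a) a * (\<Sum>k. (a gchoose Suc k) * b k)"
  proof (rule suminf_mult)
    show "summable (\<lambda>k. (a gchoose Suc k) * b k)"
      by (rule summable_comparison_test'[OF summable_mult2[OF summable_abs_gbinomial_Suc, of a M]])
        (use a b in \<open>auto simp: abs_mult intro!: mult_left_mono\<close>)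
  qed
  finally have "((\<lambda>\<tau>. \<Sum>k. f k \<tau>) has_integral Beta (1 - a) a * (\<Sum>k. (a gchoose Suc k) * b k)) UNIV"
    using has_integral_integral_lborel[OF F_int] by simp
  moreover have "(\<Sum>k. f k \<tau>) = (if \<tau> \<in> {0..1} then
      \<tau> powr (- a) * (1 - \<tau>) powr (a - 1) * ((1 - \<tau>) * (\<Sum>k. (- \<tau>) ^ k * b k)) else 0)" for \<tau>
  proof (cases "\<tau> \<in> {0<..<1}")
    case True
    have "summable (\<lambda>k. (- \<tau>) ^ k * b k)"
    proof (rule summable_comparison_test')
      show "summable (\<lambda>k. \<tau> ^ k * M)"
        using True by (intro summable_mult2 summable_geometric) simp
      show "norm ((- \<tau>) ^ k * b k) \<le> \<tau> ^ k * M" for k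
        using True b[of k] by (simp add: abs_mult power_abs mult_left_mono)
    qed
    moreover have "f k \<tau> = (\<tau> powr (- a) * (1 - \<tau>) powr (a - 1) * (1 - \<tau>)) * ((- \<tau>) ^ k * b k)" for k
      using True by (simp add: f_def g_def powr_diff powr_minus powr_realpow field_simps
          power_minus[of \<tau>])
    ultimately show ?thesis using True by (simp add: suminf_mult mult.assoc)
  next
    case False
    then have "g k \<tau> = 0" for k
      by (cases "\<tau> = 0"; cases "\<tau> = 1") (auto simp: g_def)
    then have "(\<Sum>k. f k \<tau>) = 0" by (simp add: f_def)
    moreover have "\<tau> = 0 \<or> \<tau> = 1 \<or> \<tau> \<notin> {0..1}" using False by auto
    ultimately show ?thesis by auto
  qed
  ultimately have series: "((\<lambda>\<tau>. \<tau> powr (- a) * (1 - \<tau>) powr (a - 1) * ((1 - \<tau>) * (\<Sum>k. (- \<tau>) ^ k * b k)))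
      has_integral Beta (1 - a) a * (\<Sum>k. (a gchoose Suc k) * b k)) {0..1}"
    by (simp only: has_integral_restrict_UNIV)
  have "((\<lambda>\<tau>. \<tau> powr ((1 - a) - 1) * (1 - \<tau>) powr (a - 1) * b0) has_integral
      Beta (1 - a) a * b0) {0..1}"
    using a by (intro has_integral_mult_left has_integral_Beta_real) auto
  from has_integral_add[OF this series] show ?thesis
    by (simp add: distrib_left)
qed

lemma has_real_derivative_one_minus_powr:
  fixes x r :: real
  assumes "x < 1"
  shows "((\<lambda>x. (1 - x) powr r) has_real_derivative - r * (1 - x) powr (r - 1)) (at x within X)"
proof -
  have "((\<lambda>x. 1 - x) has_real_derivative - 1) (at x within X)"
    by (auto intro!: derivative_eq_intros)
  from DERIV_chain2[OF has_real_derivative_powr this] assms show ?thesis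
    by simp
qed

text \<open>Both pieces are scaled so that d drops out: the part near \<tau> = 1 integrates to 1/a,
  the other one to (1 - d^c)/c. The bound is therefore uniform in d, which will be 2|1+z|.\<close>

lemma has_integral_cutoff_weight:
  fixes a c d :: real
  assumes a: "0 < a" "a < 1" and c: "0 < c" and d: "0 < d" "d < 1"
  obtains I where "I \<le> 2 / a + 2 / c + 4 / (1 - a)"
    "((\<lambda>\<tau>. 2 * (if 1 - \<tau> \<le> d then d powr (- a) * (1 - \<tau>) powr (a - 1)
      else d powr c * (1 - \<tau>) powr (- c - 1)) + 4 * \<tau> powr (- a)) has_integral I) {0..1}"
proof -
  let ?h = "\<lambda>\<tau>. if 1 - \<tau> \<le> d then d powr (- a) * (1 - \<tau>) powr (a - 1)
      else d powr c * (1 - \<tau>) powr (- c - 1)"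
  have "((\<lambda>\<tau>. d powr c * (1 - \<tau>) powr (- c - 1)) has_integral
      d powr c * ((1 - (1 - d)) powr (- c) / c) - d powr c * ((1 - 0) powr (- c) / c)) {0..1 - d}"
  proof (rule fundamental_theorem_of_calculus)
    fix \<tau> assume "\<tau> \<in> {0..1 - d}"
    then show "((\<lambda>\<tau>. d powr c * ((1 - \<tau>) powr (- c) / c)) has_vector_derivative
        d powr c * (1 - \<tau>) powr (- c - 1)) (at \<tau> within {0..1 - d})"
      unfolding has_real_derivative_iff_has_vector_derivative[symmetric]
      using c d
      by (auto intro!: derivative_eq_intros has_real_derivative_one_minus_powr)
  qed (use d in simp)
  then have h1: "(?h has_integral
      d powr c * ((1 - (1 - d)) powr (- c) / c) - d powr c * ((1 - 0) powr (- c) / c)) {0..1 - d}"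
    by (rule has_integral_spike[of "{1 - d}", rotated 2]) auto
  have "((\<lambda>\<tau>. d powr (- a) * (1 - \<tau>) powr (a - 1)) has_integral
      (- (d powr (- a) * ((1 - 1) powr a / a))) - (- (d powr (- a) * ((1 - (1 - d)) powr a / a)))) {1 - d..1}"
  \<comment> \<open>The integrand is singular at \<tau> = 1, but its primitive is continuous there
    because a > 0.\<close>
  proof (rule fundamental_theorem_of_calculus_interior)
    show "continuous_on {1 - d..1} (\<lambda>\<tau>. - (d powr (- a) * ((1 - \<tau>) powr a / a)))"
      using a by (intro continuous_intros continuous_on_powr') auto
    fix \<tau> assume "\<tau> \<in> {1 - d<..<1}"
    then show "((\<lambda>\<tau>. - (d powr (- a) * ((1 - \<tau>) powr a / a))) has_vector_derivative
        d powr (- a) * (1 - \<tau>) powr (a - 1)) (at \<tau>)"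
      unfolding has_real_derivative_iff_has_vector_derivative[symmetric]
      using a d
      by (auto intro!: derivative_eq_intros has_real_derivative_one_minus_powr)
  qed (use d in simp)
  then have h2: "(?h has_integral
      (- (d powr (- a) * ((1 - 1) powr a / a))) - (- (d powr (- a) * ((1 - (1 - d)) powr a / a)))) {1 - d..1}"
    by (rule has_integral_eq[rotated]) auto
  have h3: "((\<lambda>\<tau>. \<tau> powr (- a)) has_integral 1 powr (- a + 1) / (- a + 1)) {0..1}"
    by (rule has_integral_powr_from_0) (use a in auto)
  note h = has_integral_add[OF has_integral_mult_right[OF has_integral_combine[OF _ _ h1 h2], of 2]
      has_integral_mult_right[OF h3, of 4]]
  show ?thesis
  proof (rule that[OF _ h])
    show "2 * (d powr c * ((1 - (1 - d)) powr (- c) / c) - d powr c * ((1 - 0) powr (- c) / c) +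
        ((- (d powr (- a) * ((1 - 1) powr a / a))) - (- (d powr (- a) * ((1 - (1 - d)) powr a / a))))) +
        4 * (1 powr (- a + 1) / (- a + 1)) \<le> 2 / a + 2 / c + 4 / (1 - a)"
    proof -
      have "d powr c * d powr (- c) = 1" "d powr (- a) * d powr a = 1"
        using d by (simp_all add: powr_minus)
      moreover have "0 \<le> 2 * d powr c / c" using c by simp
      ultimately show ?thesis using a by simp
    qed
  qed (use d in auto)
qed

section \<open>Fractional powers of $1 + rT$\<close>

context contraction_operator
begin

definition neumann :: "complex \<Rightarrow> 'x \<Rightarrow> 'x" where
  "neumann z = opser (\<lambda>n. z ^ n)"

lemma summable_neumann: "cmod z < 1 \<Longrightarrow> summable (\<lambda>n. cmod (z ^ n))"
  by (simp add: norm_power summable_geometric)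

lemma clinear_neumann: "cmod z < 1 \<Longrightarrow> bounded_clinear (neumann z)"
  unfolding neumann_def by (intro clinear_opser summable_neumann)

lemma norm_neumann_le: "cmod z < 1 \<Longrightarrow> norm (neumann z x) \<le> norm x / (1 - cmod z)"
  using norm_opser_le[OF summable_neumann, of z x]
  by (simp add: neumann_def norm_power suminf_geometric)

lemma T_neumann: "cmod z < 1 \<Longrightarrow> T (neumann z x) = neumann z (T x)"
  unfolding neumann_def by (intro T_opser summable_neumann)

lemma neumann_right:
  assumes "cmod z < 1"
  shows "neumann z v - z *\<^sub>C T (neumann z v) = v"
proof -
  have "bounded_linear (\<lambda>x. z *\<^sub>C T x)"
    by (intro bounded_linear_compose[OF scaleC.bounded_linear_right]
        bounded_clinear_imp_bounded_linear clinear_T)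
  from bounded_linear.sums[OF this opser_sums[OF summable_neumann[OF assms], of v]]
  have "(\<lambda>n. z ^ Suc n *\<^sub>C (T ^^ Suc n) v) sums (z *\<^sub>C T (neumann z v))"
    by (simp add: neumann_def bounded_clinear_scaleC[OF clinear_T] scaleC_scaleC)
  then have "(\<lambda>n. z ^ n *\<^sub>C (T ^^ n) v) sums (z *\<^sub>C T (neumann z v) + z ^ 0 *\<^sub>C (T ^^ 0) v)"
    by (subst (asm) sums_Suc_iff) simp
  then have "neumann z v = z *\<^sub>C T (neumann z v) + z ^ 0 *\<^sub>C (T ^^ 0) v"
    using opser_sums[OF summable_neumann[OF assms], of v] sums_unique2
    unfolding neumann_def by blast
  then show ?thesis by (simp add: scaleC_one diff_eq_eq add.commute)
qed

lemma neumann_left: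
  assumes "cmod z < 1"
  shows "neumann z (v - z *\<^sub>C T v) = v"
  using neumann_right[OF assms, of v]
  by (simp add: bounded_clinear_diff[OF clinear_neumann[OF assms]]
      bounded_clinear_scaleC[OF clinear_neumann[OF assms]] T_neumann[OF assms])

lemma inv_eq_neumann:
  assumes "cmod z < 1"
  shows "inv (\<lambda>x. x - z *\<^sub>C T x) = neumann z"
  by (rule inv_equality) (simp_all add: neumann_left neumann_right assms)

text \<open>The operator $(1 + rT)^b$, given by its binomial series.\<close>

definition binom_coeff :: "real \<Rightarrow> real \<Rightarrow> nat \<Rightarrow> complex" where
  "binom_coeff b r n = of_real ((b gchoose n) * r ^ n)"

definition binom_op :: "real \<Rightarrow> real \<Rightarrow> 'x \<Rightarrow> 'x" where
  "binom_op b r = opser (binom_coeff b r)"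

lemma cmod_binom_coeff: "0 \<le> r \<Longrightarrow> cmod (binom_coeff b r n) = \<bar>b gchoose n\<bar> * r ^ n"
  by (simp add: binom_coeff_def abs_mult norm_mult norm_power flip: of_real_mult of_real_power)

definition binom_summable :: "real \<Rightarrow> real \<Rightarrow> bool" where
  "binom_summable b r \<longleftrightarrow> summable (\<lambda>n. cmod (binom_coeff b r n))"

lemma binom_summable_less: "0 \<le> r \<Longrightarrow> r < 1 \<Longrightarrow> binom_summable b r"
  by (simp add: binom_summable_def cmod_binom_coeff summable_abs_gbinomial)

lemma binom_summable_pos: "0 < b \<Longrightarrow> b \<le> 1 \<Longrightarrow> 0 \<le> r \<Longrightarrow> r \<le> 1 \<Longrightarrow> binom_summable b r"
  by (simp add: binom_summable_def cmod_binom_coeff summable_abs_gbinomial_pos)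

lemma clinear_binom_op: "binom_summable b r \<Longrightarrow> bounded_clinear (binom_op b r)"
  unfolding binom_op_def binom_summable_def by (rule clinear_opser)

lemma norm_binom_op_neg_le:
  assumes "0 \<le> c" "0 \<le> r" "r < 1"
  shows "norm (binom_op (- c) r x) \<le> (1 - r) powr (- c) * norm x"
  using norm_opser_le[of "binom_coeff (- c) r" x] binom_summable_less[of r "- c"]
    abs_gbinomial_neg_sums[OF assms] assms
  by (simp add: binom_op_def binom_summable_def cmod_binom_coeff sums_iff)

lemma norm_binom_op_pos_le:
  assumes "0 < b" "b \<le> 1" "0 \<le> r" "r \<le> 1"
  shows "norm (binom_op b r x) \<le> 2 * norm x"
proof -
  have "norm (binom_op b r x) \<le> (\<Sum>n. \<bar>b gchoose n\<bar> * r ^ n) * norm x"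
    using norm_opser_le[of "binom_coeff b r" x] binom_summable_pos[OF assms] assms
    by (simp add: binom_op_def binom_summable_def cmod_binom_coeff)
  also have "\<dots> \<le> 2 * norm x"
    by (intro mult_right_mono suminf_abs_gbinomial_pos_le assms) simp
  finally show ?thesis .
qed

lemma norm_binom_op_diff_le:
  assumes b: "0 < b" "b \<le> 1" and r: "0 \<le> r" "r < 1"
  shows "norm (binom_op b 1 x - binom_op b r x) \<le> (1 - r) powr b * norm x"
proof -
  have s1: "summable (\<lambda>n. cmod (binom_coeff b 1 n))"
    using binom_summable_pos[OF b, of 1] by (simp add: binom_summable_def)
  have sr: "summable (\<lambda>n. cmod (binom_coeff b r n))"
    using binom_summable_less[OF r] by (simp add: binom_summable_def)
  have cmod: "cmod (binom_coeff b 1 n - binom_coeff b r n) = \<bar>b gchoose n\<bar> * (1 - r ^ n)" for n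
  proof -
    have "binom_coeff b 1 n - binom_coeff b r n = of_real ((b gchoose n) * (1 - r ^ n))"
      by (simp add: binom_coeff_def algebra_simps)
    then show ?thesis
      using r power_le_one[of r n] by (simp only: norm_of_real abs_mult) simp
  qed
  have sd: "summable (\<lambda>n. cmod (binom_coeff b 1 n - binom_coeff b r n))"
    by (rule summable_comparison_test'[OF summable_add[OF s1 sr]]) (simp add: norm_triangle_ineq4)
  have "norm (binom_op b 1 x - binom_op b r x) =
      norm (opser (\<lambda>n. binom_coeff b 1 n - binom_coeff b r n) x)"
    unfolding binom_op_def by (simp add: opser_diff[OF s1 sr])
  also have "\<dots> \<le> (\<Sum>n. \<bar>b gchoose n\<bar> * (1 - r ^ n)) * norm x"
    using norm_opser_le[OF sd, of x] by (simp add: cmod)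
  also have "\<dots> \<le> (1 - r) powr b * norm x"
    by (intro mult_right_mono suminf_abs_gbinomial_diff_le b r) simp
  finally show ?thesis .
qed

lemma binom_op_mult:
  assumes "binom_summable b r" "binom_summable c r"
  shows "binom_op b r (binom_op c r x) = binom_op (b + c) r x"
proof -
  have "(\<Sum>i\<le>n. binom_coeff b r i * binom_coeff c r (n - i)) = binom_coeff (b + c) r n" for n
  proof -
    have "(\<Sum>i\<le>n. binom_coeff b r i * binom_coeff c r (n - i)) =
        of_real ((\<Sum>i\<le>n. (b gchoose i) * (c gchoose (n - i))) * r ^ n)"
      unfolding binom_coeff_def of_real_mult[symmetric] of_real_sum[symmetric] of_real_eq_iff
        sum_distrib_right
    proof (rule sum.cong[OF refl])
      fix i assume "i \<in> {..n}"
      then have "r ^ n = r ^ i * r ^ (n - i)" by (simp flip: power_add)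
      then show "(b gchoose i) * r ^ i * ((c gchoose (n - i)) * r ^ (n - i)) =
          (b gchoose i) * (c gchoose (n - i)) * r ^ n"
        by simp
    qed
    also have "(\<Sum>i\<le>n. (b gchoose i) * (c gchoose (n - i))) = (b + c) gchoose n"
      using gbinomial_Vandermonde[of b c n] by (simp add: atLeast0AtMost)
    finally show ?thesis by (simp only: binom_coeff_def)
  qed
  then show ?thesis
    unfolding binom_op_def
    using assms by (subst opser_mult) (simp_all add: binom_summable_def)
qed

lemma binom_op_1: "binom_op 1 r x = x + r *\<^sub>R T x"
proof -
  have "binom_coeff 1 r n = 0" if "n \<ge> 2" for n
  proof -
    have "(1 gchoose n) = (of_nat (1 choose n) :: real)"
      using binomial_gbinomial[of 1 n, where ?'a = real] by simp
    then show ?thesis using that by (simp add: binom_coeff_def)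
  qed
  then have "binom_op 1 r x = (\<Sum>n<2. binom_coeff 1 r n *\<^sub>C (T ^^ n) x)"
    unfolding binom_op_def by (rule opser_finite)
  also have "{..<2::nat} = {0, 1}" by auto
  finally show ?thesis
    by (simp add: binom_coeff_def scaleC_one scaleC_of_real)
qed

lemma binom_op_minus_1: "binom_op (- 1) r = neumann (of_real (- r))"
proof -
  have "binom_coeff (- 1) r n = (of_real (- r)) ^ n" for n
  proof -
    have "((- 1) gchoose n) = (- 1 :: real) ^ n"
      using gbinomial_minus[of "1::real" n] binomial_gbinomial[of n n, where ?'a = real] by simp
    then have "((- 1) gchoose n) * r ^ n = (- r) ^ n"
      by (simp flip: power_mult_distrib)
    then show ?thesis
      unfolding binom_coeff_def by (simp only: of_real_power)
  qed
  then show ?thesis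
    unfolding binom_op_def neumann_def by (intro ext opser_cong)
qed

text \<open>
  The operator $V_\tau = (1+T)(1+\tau T)^{-1} = 1 + (1-\tau) T (1+\tau T)^{-1}$ tends strongly to
  the identity as $\tau \to 1$ if $1 + T$ has dense range.
\<close>

definition regularizer :: "real \<Rightarrow> 'x \<Rightarrow> 'x" where
  "regularizer \<tau> x = neumann (of_real (- \<tau>)) (x + T x)"

lemma regularizer_eq:
  assumes "0 \<le> \<tau>" "\<tau> < 1"
  shows "regularizer \<tau> x = x + (1 - \<tau>) *\<^sub>R neumann (of_real (- \<tau>)) (T x)"
proof -
  have \<tau>: "cmod (of_real (- \<tau>)) < 1" using assms by simp
  have "x + T x = (x - of_real (- \<tau>) *\<^sub>C T x) + (1 - \<tau>) *\<^sub>R T x"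
    by (simp only: scaleC_of_real) (simp add: algebra_simps)
  then have "regularizer \<tau> x = neumann (of_real (- \<tau>)) (x - of_real (- \<tau>) *\<^sub>C T x) +
      neumann (of_real (- \<tau>)) ((1 - \<tau>) *\<^sub>R T x)"
    unfolding regularizer_def by (simp only: bounded_clinear_add[OF clinear_neumann[OF \<tau>]])
  then show ?thesis
    by (simp only: neumann_left[OF \<tau>] bounded_clinear_scaleR[OF clinear_neumann[OF \<tau>]])
qed

lemma clinear_regularizer:
  assumes "0 \<le> \<tau>" "\<tau> < 1"
  shows "bounded_clinear (regularizer \<tau>)"
proof -
  have "cmod (of_real (- \<tau>)) < 1" using assms by simp
  from bounded_clinear_compose[OF clinear_neumann[OF this] clinear_one_plus_T]
  show ?thesis unfolding regularizer_def[abs_def] .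
qed

lemma norm_regularizer_le:
  assumes "0 \<le> \<tau>" "\<tau> < 1"
  shows "norm (regularizer \<tau> x) \<le> 2 * norm x"
proof -
  have "norm (neumann (of_real (- \<tau>)) (T x)) \<le> norm (T x) / (1 - \<tau>)"
    using norm_neumann_le[of "of_real (- \<tau>)" "T x"] assms by simp
  also have "\<dots> \<le> norm x / (1 - \<tau>)"
    using assms norm_T_le by (intro divide_right_mono) auto
  finally have "(1 - \<tau>) * norm (neumann (of_real (- \<tau>)) (T x)) \<le> norm x"
    using assms by (simp add: field_simps)
  moreover have "norm (regularizer \<tau> x) \<le> norm x + (1 - \<tau>) * norm (neumann (of_real (- \<tau>)) (T x))"
    unfolding regularizer_eq[OF assms] using assms by (intro norm_triangle_le) simp
  ultimately show ?thesis by simp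
qed

lemma neumann_regularizer:
  assumes z: "cmod z < 1" and \<tau>: "0 \<le> \<tau>" "\<tau> < 1"
  shows "neumann z (regularizer \<tau> v) = regularizer \<tau> (neumann z v)"
proof -
  have "regularizer \<tau> (T x) = T (regularizer \<tau> x)" for x
    using \<tau> by (simp add: regularizer_def T_neumann bounded_clinear_add[OF clinear_T])
  then show ?thesis
    unfolding neumann_def
    by (intro commute_opser[OF _ clinear_regularizer, symmetric] summable_neumann z \<tau>)
qed

text \<open>The partial fraction identity (z+\<tau>)(1+w) = (\<tau>-1)(1-zw) + (1+z)(1+\<tau>w),
  divided by (1+\<tau>w)(1-zw), with w replaced by T. On the right only resolvents remain, which is
  where the hypothesis on E applies.\<close>

lemma regularizer_neumann:
  assumes z: "cmod z < 1" and \<tau>: "0 \<le> \<tau>" "\<tau> < 1"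
  shows "(z + of_real \<tau>) *\<^sub>C regularizer \<tau> (neumann z v) =
    (of_real \<tau> - 1) *\<^sub>C neumann (of_real (- \<tau>)) v + (1 + z) *\<^sub>C neumann z v"
proof -
  define q where "q = neumann z v"
  have v: "v = q - z *\<^sub>C T q"
    unfolding q_def by (rule neumann_right[OF z, symmetric])
  have t: "cmod (of_real (- \<tau>)) < 1" using \<tau> by simp
  note N = bounded_clinear_diff[OF clinear_neumann[OF t]] bounded_clinear_scaleC[OF clinear_neumann[OF t]]
  have "(z + of_real \<tau>) *\<^sub>C (q + T q) - (of_real \<tau> - 1) *\<^sub>C v =
      (1 + z) *\<^sub>C (q - of_real (- \<tau>) *\<^sub>C T q)"
    unfolding v by (simp add: scaleC.add_left scaleC.diff_left scaleC_add_right scaleC.diff_right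
        scaleC_scaleC scaleC_one scaleC.minus_left algebra_simps)
  then have "neumann (of_real (- \<tau>)) ((z + of_real \<tau>) *\<^sub>C (q + T q) - (of_real \<tau> - 1) *\<^sub>C v) =
      (1 + z) *\<^sub>C neumann (of_real (- \<tau>)) (q - of_real (- \<tau>) *\<^sub>C T q)"
    by (simp only: N)
  then have "(z + of_real \<tau>) *\<^sub>C regularizer \<tau> q - (of_real \<tau> - 1) *\<^sub>C neumann (of_real (- \<tau>)) v =
      (1 + z) *\<^sub>C q"
    unfolding neumann_left[OF t] by (simp only: N regularizer_def)
  then show ?thesis by (simp only: q_def diff_eq_eq add.commute)
qed

text \<open>The Beta integral for $(1+T)^a$, in weak form to avoid vector-valued integrals.\<close>

lemma has_integral_binom_op:
  assumes a: "0 < a" "a < 1" and \<psi>: "bounded_linear \<psi>"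
  shows "((\<lambda>\<tau>. \<tau> powr (- a) * (1 - \<tau>) powr (a - 1) * \<psi> (regularizer \<tau> x)) has_integral
    (Beta (1 - a) a * \<psi> (binom_op a 1 x))) {0..1}"
proof -
  obtain K where K: "K \<ge> 0" "\<And>x. norm (\<psi> x) \<le> norm x * K"
    using bounded_linear.nonneg_bounded[OF \<psi>] by blast
  define b where "b = (\<lambda>k. \<psi> ((T ^^ Suc k) x))"
  have b_le: "\<bar>b k\<bar> \<le> norm x * K" for k
  proof -
    have "\<bar>b k\<bar> \<le> norm ((T ^^ Suc k) x) * K"
      using K(2)[of "(T ^^ Suc k) x"] by (simp add: b_def)
    also have "\<dots> \<le> norm x * K"
      by (intro mult_right_mono norm_pow_le K)
    finally show ?thesis .
  qed
  have "(\<lambda>n. \<psi> (binom_coeff a 1 n *\<^sub>C (T ^^ n) x)) sums \<psi> (binom_op a 1 x)"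
    unfolding binom_op_def
    using binom_summable_pos[of a 1] a
    by (intro bounded_linear.sums[OF \<psi>] opser_sums) (simp add: binom_summable_def)
  then have "(\<lambda>n. (a gchoose n) * \<psi> ((T ^^ n) x)) sums \<psi> (binom_op a 1 x)"
    by (simp add: binom_coeff_def scaleC_of_real linear_scale[OF bounded_linear.linear[OF \<psi>]])
  then have "(\<lambda>n. (a gchoose Suc n) * \<psi> ((T ^^ Suc n) x)) sums (\<psi> (binom_op a 1 x) - \<psi> x)"
    by (subst sums_Suc_iff) simp
  then have eq: "\<psi> x + (\<Sum>k. (a gchoose Suc k) * b k) = \<psi> (binom_op a 1 x)"
    by (simp add: sums_iff b_def)
  have "\<tau> powr (- a) * (1 - \<tau>) powr (a - 1) * (\<psi> x + (1 - \<tau>) * (\<Sum>k. (- \<tau>) ^ k * b k)) =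
      \<tau> powr (- a) * (1 - \<tau>) powr (a - 1) * \<psi> (regularizer \<tau> x)" if "\<tau> \<in> {0..1}" for \<tau>
  \<comment> \<open>At \<tau> = 1 the Neumann series behind \<open>regularizer\<close> need not
    converge; the weight is 0 there because \<open>0 powr (a - 1) = 0\<close>.\<close>
  proof (cases "\<tau> = 1")
    case False
    with that have \<tau>: "0 \<le> \<tau>" "\<tau> < 1" by auto
    have "(\<lambda>n. \<psi> (of_real (- \<tau>) ^ n *\<^sub>C (T ^^ n) (T x))) sums \<psi> (neumann (of_real (- \<tau>)) (T x))"
      unfolding neumann_def using \<tau>
      by (intro bounded_linear.sums[OF \<psi>] opser_sums summable_neumann) simp
    then have "(\<lambda>n. (- \<tau>) ^ n * b n) sums \<psi> (neumann (of_real (- \<tau>)) (T x))"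
      by (simp only: of_real_power[symmetric] scaleC_of_real b_def funpow_swap1 funpow.simps o_apply
          linear_scale[OF bounded_linear.linear[OF \<psi>]] real_scaleR_def)
    then have "(\<Sum>k. (- \<tau>) ^ k * b k) = \<psi> (neumann (of_real (- \<tau>)) (T x))"
      by (simp add: sums_iff)
    then show ?thesis
      unfolding regularizer_eq[OF \<tau>]
      by (simp add: linear_scale[OF bounded_linear.linear[OF \<psi>]]
          linear_add[OF bounded_linear.linear[OF \<psi>]])
  qed simp
  from has_integral_eq[OF this has_integral_gbinomial_series[OF a b_le, of "\<psi> x"]]
  show ?thesis by (simp only: eq)
qed

end

section \<open>Transfer of the resolvent condition\<close>

text \<open>The two endpoint singularities are separated at \<tau> = 1/2. Above it \<tau>^(-a) \<le>
  2; below it both (1-\<tau>)^(a-1) and the cutoff factor are at most 2, which explains the term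
  with 4. The exponent -g-1 arises as (a-1) + (g-1) with a = 1 - 2g.\<close>

lemma cutoff_weight_le:
  fixes a g d \<tau> :: real
  assumes a: "0 < a" "a < 1" and g: "a = 1 - 2 * g" and d: "0 < d" and \<tau>: "0 < \<tau>" "\<tau> < 1"
  shows "\<tau> powr (- a) * (1 - \<tau>) powr (a - 1) *
      (if 1 - \<tau> \<le> d then d powr (- a) else d powr g * (1 - \<tau>) powr (g - 1)) \<le>
    2 * (if 1 - \<tau> \<le> d then d powr (- a) * (1 - \<tau>) powr (a - 1)
      else d powr g * (1 - \<tau>) powr (- g - 1)) + 4 * \<tau> powr (- a)"
proof -
  define s where "s = 1 - \<tau>"
  define \<phi> where "\<phi> = (if s \<le> d then d powr (- a) else d powr g * s powr (g - 1))"
  have s: "0 < s" "s < 1" using \<tau> by (auto simp: s_def)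
  have two: "x powr (- b) \<le> 2" if "1 / 2 \<le> x" "0 < b" "b < 1" for x b :: real
  proof -
    have "x powr (- b) \<le> (1 / 2) powr (- b)"
      using that by (intro powr_mono2') auto
    also have "\<dots> = 2 powr b" by (simp add: powr_minus powr_divide)
    also have "\<dots> \<le> 2 powr 1" using that by (intro powr_mono) auto
    finally show ?thesis by simp
  qed
  define W where "W = (if s \<le> d then d powr (- a) * s powr (a - 1) else d powr g * s powr (- g - 1))"
  have W: "W \<ge> 0" by (simp add: W_def)
  have eq: "s powr (a - 1) * \<phi> = W"
  proof -
    have "s powr (a - 1) * s powr (g - 1) = s powr (- g - 1)"
      by (simp add: g flip: powr_add)
    then show ?thesis by (simp add: \<phi>_def W_def mult_ac)
  qed
  have "\<tau> powr (- a) * (s powr (a - 1) * \<phi>) \<le> 2 * W + 4 * \<tau> powr (- a)"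
  proof (cases "1 / 2 \<le> \<tau>")
    case True
    have "\<tau> powr (- a) * W \<le> 2 * W"
      using two[OF True a] W by (intro mult_right_mono) auto
    then show ?thesis
      unfolding eq by (simp add: add_increasing2)
  next
    case False
    then have s2: "1 / 2 \<le> s" by (simp add: s_def)
    have "\<phi> \<le> s powr (- a)"
    proof (cases "s \<le> d")
      case True
      then show ?thesis using a s by (auto simp: \<phi>_def intro: powr_mono2')
    next
      case False
      have "d powr g * s powr (g - 1) \<le> s powr g * s powr (g - 1)"
        using False d a g by (intro mult_right_mono powr_mono2) auto
      also have "\<dots> = s powr (- a)"
        by (simp add: g flip: powr_add)
      finally show ?thesis using False by (simp add: \<phi>_def)
    qed
    also have "\<dots> \<le> 2" by (rule two[OF s2 a])
    finally have "\<phi> \<le> 2" .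
    moreover have "s powr (a - 1) \<le> 2"
      using two[OF s2, of "1 - a"] a by simp
    ultimately have "s powr (a - 1) * \<phi> \<le> 2 * 2"
      by (intro mult_mono) (auto simp: \<phi>_def)
    then have "\<tau> powr (- a) * (s powr (a - 1) * \<phi>) \<le> \<tau> powr (- a) * (2 * 2)"
      by (intro mult_left_mono) auto
    then show ?thesis using W by simp
  qed
  then show ?thesis by (simp only: \<phi>_def W_def s_def mult.assoc)
qed

lemma one_plus_pos: "cmod z < 1 \<Longrightarrow> 0 < cmod (1 + z)"
  using norm_triangle_ineq2[of 1 "- z"] by (simp del: zero_less_norm_iff)

lemma one_minus_norm_square_le:
  assumes "cmod z < 1"
  shows "0 < 1 - (cmod z)\<^sup>2" "1 - (cmod z)\<^sup>2 \<le> 2 * cmod (1 + z)"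
proof -
  show "0 < 1 - (cmod z)\<^sup>2" using assms by (simp add: abs_square_less_1)
  have "1 - cmod z \<le> cmod (1 + z)"
    using norm_triangle_ineq2[of 1 "- z"] by (simp del: zero_less_norm_iff)
  then have "2 * (1 - cmod z) \<le> 2 * cmod (1 + z)" by simp
  moreover have "(1 - cmod z) * (1 + cmod z) \<le> (1 - cmod z) * 2"
    using assms by (intro mult_left_mono) auto
  ultimately show "1 - (cmod z)\<^sup>2 \<le> 2 * cmod (1 + z)"
    by (simp add: power2_eq_square algebra_simps)
qed

section \<open>Absorbing the singularity at z = -1 into the fractional power\<close>

context contraction_operator
begin

context
  fixes a g m :: real and E :: "'x \<Rightarrow> 'y::complex_hilbert"
  assumes a: "0 < a" "a < 1" and g: "a = 1 - 2 * g" and E: "bounded_clinear E" and m: "0 \<le> m"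
    and bound: "\<And>z v. cmod z < 1 \<Longrightarrow> norm (E (neumann z v)) \<le>
      m * cmod (1 + z) powr (- a) * (1 - (cmod z)\<^sup>2) powr (- g) * norm v"
begin

lemma E_regularizer_near:
  assumes z: "cmod z < 1" and \<tau>: "0 \<le> \<tau>" "\<tau> < 1"
  shows "norm (E (regularizer \<tau> (neumann z v))) \<le>
    4 * m * (1 - (cmod z)\<^sup>2) powr (- g) * norm v * (2 * cmod (1 + z)) powr (- a)"
proof -
  define P where "P = (1 - (cmod z)\<^sup>2) powr (- g)"
  define \<delta> where "\<delta> = cmod (1 + z)"
  have \<delta>: "0 < \<delta>" using one_plus_pos[OF z] by (simp add: \<delta>_def)
  have "norm (E (regularizer \<tau> (neumann z v))) \<le> m * \<delta> powr (- a) * P * norm (regularizer \<tau> v)"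
    using bound[OF z, of "regularizer \<tau> v"] by (simp add: neumann_regularizer[OF z \<tau>] P_def \<delta>_def)
  also have "\<dots> \<le> m * \<delta> powr (- a) * P * (2 * norm v)"
    using m by (intro mult_left_mono norm_regularizer_le \<tau>) (auto simp: P_def)
  also have "\<dots> = 2 * m * P * norm v * \<delta> powr (- a)" by simp
  also have "\<dots> \<le> 2 * m * P * norm v * (2 * (2 * \<delta>) powr (- a))"
  proof (rule mult_left_mono)
    have "2 powr a \<le> (2::real) powr 1" using a by (intro powr_mono) auto
    then have "\<delta> powr (- a) \<le> 2 * (2 powr (- a) * \<delta> powr (- a))"
      using \<delta> by (simp add: powr_minus field_simps)
    then show "\<delta> powr (- a) \<le> 2 * (2 * \<delta>) powr (- a)"
      using \<delta> by (simp add: powr_mult)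
  qed (use m in \<open>simp add: P_def\<close>)
  finally show ?thesis by (simp add: P_def \<delta>_def mult_ac)
qed

text \<open>The resolvent identity is divided by z+\<tau>, whose modulus is comparable to s =
  1-\<tau>. The resolvent at -\<tau> contributes s^g, and in front of the resolvent at z the factor
  1+z reduces |1+z|^(-a) to |1+z|^(2g).\<close>

lemma E_regularizer_far:
  assumes z: "cmod z < 1" and \<tau>: "0 \<le> \<tau>" "\<tau> < 1" and far: "2 * cmod (1 + z) < 1 - \<tau>"
  shows "norm (E (regularizer \<tau> (neumann z v))) \<le>
    4 * m * (1 - (cmod z)\<^sup>2) powr (- g) * norm v * ((2 * cmod (1 + z)) powr g * (1 - \<tau>) powr (g - 1))"
proof -
  define P where "P = (1 - (cmod z)\<^sup>2) powr (- g)"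
  define d where "d = 2 * cmod (1 + z)"
  define s where "s = 1 - \<tau>"
  define q where "q = neumann z v"
  have d: "0 < d" "d < s" using one_plus_pos[OF z] far by (simp_all add: d_def s_def)
  have g_pos: "0 < g" using a g by simp
  have P: "0 < P" using one_minus_norm_square_le(1)[OF z] by (simp add: P_def)
  \<comment> \<open>The term s^g comes without the factor \<open>P\<close>. Since 1 - |z|^2 \<le> d,
    \<open>P\<close> is at least d^(-g), so multiplying by \<open>P * d powr g\<close> only enlarges
    it.\<close>
  have Pd: "1 \<le> P * d powr g"
  proof -
    have "d powr (- g) \<le> P"
      unfolding P_def d_def using one_minus_norm_square_le[OF z] g_pos by (intro powr_mono2') auto
    then have "d powr (- g) * d powr g \<le> P * d powr g" by (rule mult_right_mono) simp
    then show ?thesis using d by (simp flip: powr_add)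
  qed
  have t: "cmod (of_real (- \<tau>)) < 1" using \<tau> by simp
  have Et: "norm (E (neumann (of_real (- \<tau>)) v)) \<le> m * s powr (- a) * s powr (- g) * norm v"
  proof -
    have "cmod (1 + of_real (- \<tau>)) = s"
    proof -
      have "1 + of_real (- \<tau>) = complex_of_real s" by (simp add: s_def)
      then show ?thesis using \<tau> by (simp only: norm_of_real) (simp add: s_def)
    qed
    moreover have "(1 - (cmod (of_real (- \<tau>)))\<^sup>2) powr (- g) \<le> s powr (- g)"
    proof (rule powr_mono2')
      have "\<tau> * \<tau> \<le> 1 * \<tau>" using \<tau> by (intro mult_right_mono) auto
      then show "s \<le> 1 - (cmod (of_real (- \<tau>)))\<^sup>2"
        by (simp add: s_def power2_eq_square)
    qed (use g_pos d in auto)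
    ultimately show ?thesis
      using m by (intro order_trans[OF bound[OF t]]) (auto intro!: mult_right_mono mult_left_mono)
  qed
  have Eq: "norm (E q) \<le> m * cmod (1 + z) powr (- a) * P * norm v"
    unfolding q_def P_def by (rule bound[OF z])
  \<comment> \<open>By the triangle inequality |z+\<tau>| is at least s - |1+z| = s - d/2, and d <
    s; this is why the cutoff is at 2|1+z|.\<close>
  have "s / 2 \<le> cmod (z + of_real \<tau>)"
  proof -
    have "z + of_real \<tau> = (1 + z) - of_real s" by (simp add: s_def)
    then have "cmod (of_real s) - cmod (1 + z) \<le> cmod (z + of_real \<tau>)"
      using norm_triangle_ineq2[of "of_real s" "1 + z"] by (metis norm_minus_commute)
    then show ?thesis using d by (simp add: d_def)
  qed
  then have "s / 2 * norm (E (regularizer \<tau> q)) \<le>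
      cmod (z + of_real \<tau>) * norm (E (regularizer \<tau> q))"
    by (rule mult_right_mono) simp
  also have "\<dots> = norm (E ((z + of_real \<tau>) *\<^sub>C regularizer \<tau> q))"
    by (simp add: bounded_clinear_scaleC[OF E] norm_scaleC)
  also have "\<dots> \<le> cmod (of_real \<tau> - 1) * norm (E (neumann (of_real (- \<tau>)) v)) + cmod (1 + z) * norm (E q)"
    unfolding q_def regularizer_neumann[OF z \<tau>]
    by (simp only: bounded_clinear_add[OF E] bounded_clinear_scaleC[OF E] norm_scaleC[symmetric]
        norm_triangle_ineq)
  also have "cmod (of_real \<tau> - 1) = s"
  proof -
    have "of_real \<tau> - 1 = complex_of_real (- s)" by (simp add: s_def)
    then show ?thesis using \<tau> by (simp only: norm_of_real) (simp add: s_def)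
  qed
  also have "s * norm (E (neumann (of_real (- \<tau>)) v)) + cmod (1 + z) * norm (E q) \<le>
      s * (m * s powr (- a) * s powr (- g) * norm v) +
      cmod (1 + z) * (m * cmod (1 + z) powr (- a) * P * norm v)"
    using d by (intro add_mono mult_left_mono Et Eq) auto
  also have "\<dots> = m * norm v * (s powr g + (d / 2) powr g * (d / 2) powr g * P)"
  proof -
    have "x * (x powr (- a) * y) = x powr g * x powr g * y" if "0 < x" for x y :: real
    proof -
      have "x * x powr (- a) = x powr (1 + (- a))" using that powr_add[of x 1 "- a"] by simp
      also have "1 + (- a) = g + g" using g by simp
      also have "x powr (g + g) = x powr g * x powr g" by (rule powr_add)
      finally show ?thesis by (simp flip: mult.assoc)
    qed
    note * = this
    have "s * (s powr (- a) * s powr (- g)) = s powr g * s powr g * s powr (- g)"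
      using d by (intro *) simp
    also have "\<dots> = s powr g" using d by (simp add: powr_minus)
    finally have 1: "s * (s powr (- a) * s powr (- g)) = s powr g" .
    have 2: "cmod (1 + z) * (cmod (1 + z) powr (- a) * P) = (d / 2) powr g * (d / 2) powr g * P"
      using *[of "cmod (1 + z)" P] d by (simp add: d_def)
    have "s * (m * s powr (- a) * s powr (- g) * norm v) +
        cmod (1 + z) * (m * cmod (1 + z) powr (- a) * P * norm v) =
        m * norm v * (s * (s powr (- a) * s powr (- g)) + cmod (1 + z) * (cmod (1 + z) powr (- a) * P))"
      by (simp only: distrib_left mult_ac)
    then show ?thesis by (simp only: 1 2)
  qed
  also have "\<dots> \<le> m * norm v * (s powr g * (P * d powr g) + s powr g * d powr g * P)"
  proof (intro mult_left_mono add_mono)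
    show "s powr g \<le> s powr g * (P * d powr g)" using Pd by (simp add: mult_le_cancel_left1)
    show "(d / 2) powr g * (d / 2) powr g * P \<le> s powr g * d powr g * P"
      using d g_pos P by (intro mult_right_mono mult_mono powr_mono2) auto
  qed (use m in auto)
  finally have "norm (E (regularizer \<tau> q)) \<le> 4 * m * P * norm v * (d powr g * (s powr g / s))"
    using d by (simp add: field_simps)
  also have "s powr g / s = s powr (g - 1)" using d by (simp add: powr_diff)
  finally show ?thesis by (simp add: q_def P_def d_def s_def)
qed

text \<open>If |1+z| is at least 1/2, the singular factor is at most 2 and boundedness of (1+T)^a is
  enough. Otherwise the Beta integral is estimated by the near and far bounds on the two sides of
  1-\<tau> = d.\<close>

lemma resolvent_estimate:
  obtains K where "\<And>z v. cmod z < 1 \<Longrightarrow>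
    norm (E (binom_op a 1 (neumann z v))) \<le> K * (1 - (cmod z)\<^sup>2) powr (- g) * norm v"
proof -
  define I0 where "I0 = 2 / a + 2 / g + 4 / (1 - a)"
  define \<beta> where "\<beta> = Beta (1 - a) a"
  have g_pos: "0 < g" using a g by simp
  have \<beta>: "\<beta> > 0" using a by (auto simp: \<beta>_def Beta_def intro!: mult_pos_pos Gamma_real_pos)
  have I0: "I0 \<ge> 0" using a g_pos by (simp add: I0_def)
  have B: "binom_summable a 1" using a by (intro binom_summable_pos) auto
  have "norm (E (binom_op a 1 (neumann z v))) \<le>
      (4 * m + 4 * m * I0 / \<beta>) * (1 - (cmod z)\<^sup>2) powr (- g) * norm v" if z: "cmod z < 1" for z v
  proof -
    define P where "P = (1 - (cmod z)\<^sup>2) powr (- g)"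
    define d where "d = 2 * cmod (1 + z)"
    have d: "0 < d" using one_plus_pos[OF z] by (simp add: d_def)
    have P: "0 \<le> P" by (simp add: P_def)
    show ?thesis
    proof (cases "d < 1")
      case False
      have "binom_op a 1 (neumann z v) = neumann z (binom_op a 1 v)"
        unfolding neumann_def
        by (rule commute_opser[OF summable_neumann[OF z] clinear_binom_op[OF B]])
          (use B in \<open>simp add: binom_op_def T_opser binom_summable_def\<close>)
      then have "norm (E (binom_op a 1 (neumann z v))) \<le>
          m * cmod (1 + z) powr (- a) * P * norm (binom_op a 1 v)"
        using bound[OF z] by (simp add: P_def)
      also have "\<dots> \<le> m * 2 * P * (2 * norm v)"
      proof (intro mult_mono)
        have "cmod (1 + z) powr (- a) \<le> (1 / 2) powr (- a)"
          using a False by (intro powr_mono2') (auto simp: d_def)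
        also have "\<dots> = 2 powr a" by (simp add: powr_minus powr_divide)
        also have "\<dots> \<le> 2 powr 1" using a by (intro powr_mono) auto
        finally show "cmod (1 + z) powr (- a) \<le> 2" by simp
        show "norm (binom_op a 1 v) \<le> 2 * norm v"
          using a by (intro norm_binom_op_pos_le) auto
      qed (use m P in auto)
      also have "\<dots> \<le> (4 * m + 4 * m * I0 / \<beta>) * P * norm v"
      proof -
        have "0 \<le> 4 * m * I0 / \<beta> * P * norm v" using m I0 \<beta> P by simp
        then show ?thesis by (simp add: algebra_simps)
      qed
      finally show ?thesis by (simp add: P_def)
    next
      case True
      define q where "q = neumann z v"
      \<comment> \<open>The weak Beta integral is tested against the vector to be estimated. This
        gives the square of its norm on the left and one factor \<open>norm y\<close> in
        \<open>C\<close>, which cancels at the end.\<close>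
      define y where "y = E (binom_op a 1 q)"
      define C where "C = 4 * m * P * norm v * norm y"
      have C: "C \<ge> 0" using m P by (simp add: C_def)
      obtain I where I: "I \<le> I0" and
        weight: "((\<lambda>\<tau>. 2 * (if 1 - \<tau> \<le> d then d powr (- a) * (1 - \<tau>) powr (a - 1)
          else d powr g * (1 - \<tau>) powr (- g - 1)) + 4 * \<tau> powr (- a)) has_integral I) {0..1}"
        using has_integral_cutoff_weight[OF a g_pos d True] unfolding I0_def by blast
      have "bounded_linear (\<lambda>x. inner (E x) y)"
        by (intro bounded_linear_compose[OF bounded_linear_inner_left]
            bounded_clinear_imp_bounded_linear E)
      from has_integral_binom_op[OF a this, of q]
      have "((\<lambda>\<tau>. \<tau> powr (- a) * (1 - \<tau>) powr (a - 1) * inner (E (regularizer \<tau> q)) y)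
          has_integral \<beta> * (norm y)\<^sup>2) {0..1}"
        by (simp add: \<beta>_def y_def power2_norm_eq_inner)
      moreover note has_integral_mult_right[OF weight, of C]
      moreover have "\<tau> powr (- a) * (1 - \<tau>) powr (a - 1) * inner (E (regularizer \<tau> q)) y \<le>
          C * (2 * (if 1 - \<tau> \<le> d then d powr (- a) * (1 - \<tau>) powr (a - 1)
            else d powr g * (1 - \<tau>) powr (- g - 1)) + 4 * \<tau> powr (- a))" (is "_ \<le> C * ?w")
        if "\<tau> \<in> {0..1}" for \<tau>
      proof (cases "\<tau> = 0 \<or> \<tau> = 1")
        case True
        have "?w \<ge> 0" by simp
        with C have "C * ?w \<ge> 0" by (rule mult_nonneg_nonneg)
        then show ?thesis using True by auto
      next
        case False
        with that have \<tau>: "0 < \<tau>" "\<tau> < 1" by auto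
        let ?\<phi> = "if 1 - \<tau> \<le> d then d powr (- a) else d powr g * (1 - \<tau>) powr (g - 1)"
        have "norm (E (regularizer \<tau> q)) \<le> 4 * m * P * norm v * ?\<phi>"
          using E_regularizer_near[OF z, of \<tau> v] E_regularizer_far[OF z, of \<tau> v] \<tau>
          by (auto simp: q_def P_def d_def not_le)
        then have "norm (E (regularizer \<tau> q)) * norm y \<le> 4 * m * P * norm v * ?\<phi> * norm y"
          by (rule mult_right_mono) simp
        then have "inner (E (regularizer \<tau> q)) y \<le> C * ?\<phi>"
          using norm_cauchy_schwarz[of "E (regularizer \<tau> q)" y] by (simp add: C_def mult_ac)
        then have "\<tau> powr (- a) * (1 - \<tau>) powr (a - 1) * inner (E (regularizer \<tau> q)) y \<le>
            \<tau> powr (- a) * (1 - \<tau>) powr (a - 1) * (C * ?\<phi>)"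
          by (intro mult_left_mono) auto
        also have "\<dots> = C * (\<tau> powr (- a) * (1 - \<tau>) powr (a - 1) * ?\<phi>)"
          by (simp only: mult_ac)
        also have "\<dots> \<le> C * ?w"
          by (intro mult_left_mono cutoff_weight_le a g d \<tau> C)
        finally show ?thesis .
      qed
      ultimately have "\<beta> * (norm y)\<^sup>2 \<le> C * I"
        by (rule has_integral_le)
      also have "\<dots> \<le> C * I0"
        by (intro mult_left_mono I C)
      finally have "\<beta> * norm y * norm y \<le> 4 * m * P * norm v * I0 * norm y"
        by (simp add: C_def power2_eq_square mult_ac)
      then have "\<beta> * norm y \<le> 4 * m * P * norm v * I0"
        using m P I0 by (cases "y = 0") (auto simp: mult_le_cancel_right)
      then have "norm y \<le> 4 * m * I0 / \<beta> * P * norm v"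
        using \<beta> by (simp add: field_simps)
      also have "\<dots> \<le> (4 * m + 4 * m * I0 / \<beta>) * P * norm v"
        using m P by (intro mult_right_mono) auto
      finally show ?thesis by (simp add: y_def q_def P_def)
    qed
  qed
  then show ?thesis by (rule that)
qed

end

end

section \<open>Laguerre expansion of the semigroup\<close>

definition laguerre_fun_deriv :: "real \<Rightarrow> nat \<Rightarrow> real \<Rightarrow> real" where
  "laguerre_fun_deriv a n t =
    (- 1) ^ n * exp (- t) * (2 * laguerre_deriv a n (2 * t) - laguerre a n (2 * t))"

lemma DERIV_laguerre_fun:
  "(laguerre_fun a n has_real_derivative laguerre_fun_deriv a n t) (at t within X)"
proof -
  have "((\<lambda>t. 2 * t) has_real_derivative 2) (at t)"
    by (auto intro!: derivative_eq_intros)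
  from DERIV_chain2[OF DERIV_laguerre this]
  have "((\<lambda>t. laguerre a n (2 * t)) has_real_derivative laguerre_deriv a n (2 * t) * 2) (at t)" .
  then have "((\<lambda>t. (- 1) ^ n * exp (- t) * laguerre a n (2 * t)) has_real_derivative
      laguerre_fun_deriv a n t) (at t)"
    by (auto intro!: derivative_eq_intros simp: laguerre_fun_deriv_def algebra_simps)
  then show ?thesis
    unfolding laguerre_fun_def[abs_def] by (rule has_field_derivative_at_within)
qed

text \<open>The coefficient of z^(n+1) in (1+z) F' + (1-z) F = 0, where F is the generating function
  and the prime is the derivative in t.\<close>

lemma laguerre_fun_recurrence:
  "laguerre_fun_deriv a (Suc n) t + laguerre_fun a (Suc n) t +
    laguerre_fun_deriv a n t - laguerre_fun a n t = 0"
  by (simp add: laguerre_fun_deriv_def laguerre_fun_def laguerre_deriv_Suc algebra_simps)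

lemma laguerre_fun_recurrence_0: "laguerre_fun_deriv a 0 t + laguerre_fun a 0 t = 0"
  by (simp add: laguerre_fun_deriv_def laguerre_fun_def laguerre_deriv_def)

lemma laguerre_fun_at_0: "laguerre_fun a n 0 = (- 1 - a) gchoose n"
  by (simp add: laguerre_fun_def neg_gbinomial_conv_laguerre)

lemma laguerre_fun_bound:
  assumes r: "0 \<le> r" "r < 1" and t: "0 \<le> t"
  obtains K \<rho> where "0 \<le> \<rho>" "\<rho> < 1" "\<And>n s. 0 \<le> s \<Longrightarrow> s \<le> t \<Longrightarrow> r ^ n * \<bar>laguerre_fun a n s\<bar> \<le> K * \<rho> ^ n"
    "\<And>n s. 0 \<le> s \<Longrightarrow> s \<le> t \<Longrightarrow> r ^ n * \<bar>laguerre_fun_deriv a n s\<bar> \<le> K * \<rho> ^ n"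
proof -
  \<comment> \<open>Any q > 1 with r q < 1 would serve; this choice also covers r = 0.\<close>
  define q where "q = 2 / (1 + r)"
  have q: "q > 1" and rq: "r * q < 1" using r by (simp_all add: q_def)
  obtain K b where K: "K > 0" "b > 0"
    and L: "\<And>n u. u \<ge> 0 \<Longrightarrow> \<bar>laguerre a n u\<bar> \<le> K * q ^ n * exp (b * u)"
    and L': "\<And>n u. u \<ge> 0 \<Longrightarrow> \<bar>laguerre_deriv a n u\<bar> \<le> K * q ^ n * exp (b * u)"
    using laguerre_bound[OF q] by metis
  define M where "M = K * exp (b * (2 * t))"
  have bnd: "K * q ^ n * exp (b * (2 * s)) \<le> M * q ^ n" if "0 \<le> s" "s \<le> t" for n s
    using that K q by (simp add: M_def mult_ac)
  have Ls: "\<bar>laguerre a n (2 * s)\<bar> \<le> M * q ^ n" and Ls': "\<bar>laguerre_deriv a n (2 * s)\<bar> \<le> M * q ^ n"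
    if "0 \<le> s" "s \<le> t" for n s
    using order_trans[OF L bnd[OF that]] order_trans[OF L' bnd[OF that]] that by auto
  have exp: "x * exp (- s) \<le> x" if "0 \<le> x" "0 \<le> s" for x s :: real
    using that by (simp add: mult_left_le)
  have M: "M \<ge> 0" using K by (simp add: M_def)
  have f: "\<bar>laguerre_fun a n s\<bar> \<le> 3 * M * q ^ n" if "0 \<le> s" "s \<le> t" for n s
  proof -
    have "\<bar>laguerre_fun a n s\<bar> = \<bar>laguerre a n (2 * s)\<bar> * exp (- s)"
      by (simp add: laguerre_fun_def abs_mult power_abs)
    also have "\<dots> \<le> M * q ^ n"
      using that by (intro order_trans[OF exp Ls]) auto
    also have "\<dots> \<le> 3 * M * q ^ n" using M q by simp
    finally show ?thesis .
  qed
  have f': "\<bar>laguerre_fun_deriv a n s\<bar> \<le> 3 * M * q ^ n" if "0 \<le> s" "s \<le> t" for n s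
  proof -
    have "\<bar>laguerre_fun_deriv a n s\<bar> =
        \<bar>2 * laguerre_deriv a n (2 * s) - laguerre a n (2 * s)\<bar> * exp (- s)"
      by (simp add: laguerre_fun_deriv_def abs_mult power_abs)
    also have "\<dots> \<le> \<bar>2 * laguerre_deriv a n (2 * s) - laguerre a n (2 * s)\<bar>"
      using exp that by simp
    also have "\<dots> \<le> 2 * (M * q ^ n) + M * q ^ n"
      using Ls[OF that, of n] Ls'[OF that, of n] by linarith
    finally show ?thesis by simp
  qed
  show ?thesis
  proof (rule that[of "r * q" "3 * M"])
    show "0 \<le> r * q" "r * q < 1" using r q rq by auto
    show "r ^ n * \<bar>laguerre_fun a n s\<bar> \<le> 3 * M * (r * q) ^ n" if "0 \<le> s" "s \<le> t" for n s
      using mult_left_mono[OF f[OF that, of n], of "r ^ n"] r by (simp add: power_mult_distrib mult_ac)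
    show "r ^ n * \<bar>laguerre_fun_deriv a n s\<bar> \<le> 3 * M * (r * q) ^ n" if "0 \<le> s" "s \<le> t" for n s
      using mult_left_mono[OF f'[OF that, of n], of "r ^ n"] r by (simp add: power_mult_distrib mult_ac)
  qed
qed

context contraction_operator
begin

text \<open>
  Since the Laguerre functions have the generating function
  $(1+z)^{-1-a} \exp(-t (1-z)/(1+z))$, this is $(1+rT)^{-1-a} e^{t A_r}$ with the bounded
  approximation $A_r = -(1-rT)(1+rT)^{-1}$ of the generator.
\<close>

definition laguerre_op :: "real \<Rightarrow> real \<Rightarrow> real \<Rightarrow> 'x \<Rightarrow> 'x" where
  "laguerre_op a r t = opser (\<lambda>n. of_real (r ^ n * laguerre_fun a n t))"

lemma summable_laguerre_op:
  assumes "0 \<le> r" "r < 1" "0 \<le> t"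
  shows "summable (\<lambda>n. cmod (of_real (r ^ n * laguerre_fun a n t)))"
proof -
  obtain K \<rho> where K: "0 \<le> \<rho>" "\<rho> < 1" "\<And>n s. 0 \<le> s \<Longrightarrow> s \<le> t \<Longrightarrow> r ^ n * \<bar>laguerre_fun a n s\<bar> \<le> K * \<rho> ^ n"
    using laguerre_fun_bound[OF assms, of a] by metis
  show ?thesis
  proof (rule summable_comparison_test')
    show "summable (\<lambda>n. K * \<rho> ^ n)" using K by (intro summable_mult summable_geometric) simp
    show "norm (cmod (of_real (r ^ n * laguerre_fun a n t))) \<le> K * \<rho> ^ n" for n
      unfolding norm_of_real using K(3)[OF assms(3), of n] assms by (simp add: abs_mult)
  qed
qed

lemma laguerre_op_sums:
  assumes "0 \<le> r" "r < 1" "0 \<le> t"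
  shows "(\<lambda>n. (r ^ n * laguerre_fun a n t) *\<^sub>R (T ^^ n) v) sums laguerre_op a r t v"
  using opser_sums[OF summable_laguerre_op[OF assms, of a], of v]
  by (simp only: scaleC_of_real laguerre_op_def)

lemma laguerre_op_0: "laguerre_op a r 0 v = binom_op (- 1 - a) r v"
  unfolding laguerre_op_def binom_op_def
  by (rule opser_cong) (simp add: binom_coeff_def laguerre_fun_at_0)

text \<open>Truncation makes the derivative in t a finite sum; the price is an explicit remainder in
  the differential equation.\<close>

definition laguerre_partial :: "real \<Rightarrow> real \<Rightarrow> nat \<Rightarrow> 'x \<Rightarrow> real \<Rightarrow> 'x" where
  "laguerre_partial a r N v t = (\<Sum>n<N. (r ^ n * laguerre_fun a n t) *\<^sub>R (T ^^ n) v)"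

definition laguerre_partial_deriv :: "real \<Rightarrow> real \<Rightarrow> nat \<Rightarrow> 'x \<Rightarrow> real \<Rightarrow> 'x" where
  "laguerre_partial_deriv a r N v t = (\<Sum>n<N. (r ^ n * laguerre_fun_deriv a n t) *\<^sub>R (T ^^ n) v)"

lemma has_vector_derivative_laguerre_partial:
  "(laguerre_partial a r N v has_vector_derivative laguerre_partial_deriv a r N v t) (at t within X)"
  unfolding laguerre_partial_def[abs_def] laguerre_partial_deriv_def
proof (rule has_vector_derivative_sum)
  fix n
  have "((\<lambda>t. r ^ n * laguerre_fun a n t) has_real_derivative r ^ n * laguerre_fun_deriv a n t)
      (at t within X)"
    by (intro DERIV_cmult DERIV_laguerre_fun)
  then show "((\<lambda>t. (r ^ n * laguerre_fun a n t) *\<^sub>R (T ^^ n) v) has_vector_derivative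
      (r ^ n * laguerre_fun_deriv a n t) *\<^sub>R (T ^^ n) v) (at t within X)"
    using has_vector_derivative_scaleR[OF _ has_vector_derivative_const] by fastforce
qed

text \<open>Truncated form of (1+rT) w' = -(1-rT) w. The recurrence cancels every power of T except
  the first one beyond the truncation.\<close>

lemma laguerre_partial_ode:
  fixes a r t v N
  defines "w \<equiv> laguerre_partial a r (Suc N) v t" and "w' \<equiv> laguerre_partial_deriv a r (Suc N) v t"
  shows "w' + r *\<^sub>R T w' + w - r *\<^sub>R T w =
    (r ^ Suc N * (laguerre_fun_deriv a N t - laguerre_fun a N t)) *\<^sub>R (T ^^ Suc N) v"
  unfolding w_def w'_def
proof (induction N)
  case 0
  have "laguerre_fun_deriv a 0 t = - laguerre_fun a 0 t"
    using laguerre_fun_recurrence_0[of a t] by simp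
  moreover have "T (- (laguerre_fun a 0 t *\<^sub>R v)) = - (laguerre_fun a 0 t *\<^sub>R T v)"
    using bounded_clinear_scaleR[OF clinear_T, of "- laguerre_fun a 0 t" v] by simp
  ultimately show ?case
    by (simp add: laguerre_partial_def laguerre_partial_deriv_def
        bounded_clinear_scaleR[OF clinear_T] algebra_simps)
      (simp flip: scaleR_add_left)
next
  case (Suc N)
  have deriv: "laguerre_fun_deriv a N t - laguerre_fun a N t =
      - (laguerre_fun_deriv a (Suc N) t + laguerre_fun a (Suc N) t)"
    using laguerre_fun_recurrence[of a N t] by simp
  define e where "e = laguerre_fun a (Suc N) t"
  define e' where "e' = laguerre_fun_deriv a (Suc N) t"
  define w where "w = laguerre_partial a r (Suc N) v t"
  define w' where "w' = laguerre_partial_deriv a r (Suc N) v t"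
  define y where "y = r ^ Suc N *\<^sub>R (T ^^ Suc N) v"
  have Ty: "T y = r ^ Suc N *\<^sub>R (T ^^ Suc (Suc N)) v"
    by (simp only: y_def bounded_clinear_scaleR[OF clinear_T] funpow.simps o_apply)
  have "laguerre_partial a r (Suc (Suc N)) v t = w + e *\<^sub>R y"
    "laguerre_partial_deriv a r (Suc (Suc N)) v t = w' + e' *\<^sub>R y"
    by (simp_all add: laguerre_partial_def laguerre_partial_deriv_def w_def w'_def e_def e'_def y_def mult.commute)
  moreover have "(r ^ Suc (Suc N) * (e' - e)) *\<^sub>R (T ^^ Suc (Suc N)) v = (r * (e' - e)) *\<^sub>R T y"
    unfolding Ty by simp
  moreover have "w' + r *\<^sub>R T w' + w - r *\<^sub>R T w = - (e' + e) *\<^sub>R y"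
    using Suc.IH unfolding w_def[symmetric] w'_def[symmetric] deriv
    by (simp add: e_def e'_def y_def mult.commute)
  ultimately show ?case
    by (simp add: e_def[symmetric] e'_def[symmetric] bounded_clinear_add[OF clinear_T]
        bounded_clinear_scaleR[OF clinear_T] algebra_simps)
qed

text \<open>Here 1 - 2(1+rT)^(-1) = -(1-rT)(1+rT)^(-1) is the approximate generator A_r. With v = y
  + rTy the inner product is |rTy|^2 - |y|^2, so contractivity of T is dissipativity of A_r.\<close>

lemma inner_yosida_nonpos:
  assumes "0 \<le> r" "r < 1"
  shows "inner v (v - 2 *\<^sub>R neumann (of_real (- r)) v) \<le> 0"
proof -
  define y where "y = neumann (of_real (- r)) v"
  have "cmod (of_real (- r)) < 1" using assms by simp
  from neumann_right[OF this, of v] have "y - (- r) *\<^sub>R T y = v"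
    by (simp only: scaleC_of_real y_def)
  then have v: "v = y + r *\<^sub>R T y" by simp
  have "inner v (v - 2 *\<^sub>R y) = (r * norm (T y))\<^sup>2 - (norm y)\<^sup>2"
    unfolding v power_mult_distrib power2_norm_eq_inner
    by (simp add: inner_simps inner_commute power2_eq_square algebra_simps)
  moreover have "(r * norm (T y))\<^sup>2 \<le> (norm y)\<^sup>2"
  proof (rule power_mono)
    have "r * norm (T y) \<le> 1 * norm y" using assms norm_T_le by (intro mult_mono) auto
    then show "r * norm (T y) \<le> norm y" by simp
  qed (use assms in simp)
  ultimately show ?thesis by (simp add: y_def)
qed

end

section \<open>Energy estimate and comparison with the semigroup\<close>

lemma energy_estimate:
  fixes p p' :: "real \<Rightarrow> 'a::real_inner"
  assumes t: "0 \<le> t"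
    and deriv: "\<And>s. 0 \<le> s \<Longrightarrow> s \<le> t \<Longrightarrow> (p has_vector_derivative p' s) (at s within {0..t})"
    and le: "\<And>s. 0 \<le> s \<Longrightarrow> s \<le> t \<Longrightarrow> inner (p s) (p' s) \<le> norm (p s) * e"
  shows "(norm (p t))\<^sup>2 \<le> exp t * ((norm (p 0))\<^sup>2 + t * e\<^sup>2)"
proof -
  \<comment> \<open>Gronwall for the square, which stays differentiable where p vanishes: 2 |p| e
    \<le> |p|^2 + e^2, and the weight exp (- s) removes the term |p|^2.\<close>
  define \<phi> where "\<phi> = (\<lambda>s. exp (- s) * inner (p s) (p s) - e\<^sup>2 * s)"
  have d: "(\<phi> has_real_derivative
      exp (- s) * (inner (p s) (p' s) + inner (p' s) (p s)) - exp (- s) * inner (p s) (p s) - e\<^sup>2)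
      (at s within {0..t})" if "0 \<le> s" "s \<le> t" for s
  proof -
    have "((\<lambda>s. inner (p s) (p s)) has_real_derivative (inner (p s) (p' s) + inner (p' s) (p s)))
        (at s within {0..t})"
      unfolding has_field_derivative_def
      by (rule has_derivative_eq_rhs[OF has_derivative_inner[OF
              deriv[OF that, unfolded has_vector_derivative_def]
              deriv[OF that, unfolded has_vector_derivative_def]]])
        (simp add: fun_eq_iff algebra_simps)
    then show ?thesis
      unfolding \<phi>_def by (auto intro!: derivative_eq_intros)
  qed
  have "\<phi> t \<le> \<phi> 0"
  proof (cases "t = 0")
    case False
    with t have "0 < t" by simp
    have nonpos: "exp (- s) * (inner (p s) (p' s) + inner (p' s) (p s)) -
        exp (- s) * inner (p s) (p s) - e\<^sup>2 \<le> 0" if "0 \<le> s" "s \<le> t" for s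
    proof -
      have "0 \<le> (norm (p s) - e)\<^sup>2" by simp
      then have "inner (p s) (p' s) + inner (p' s) (p s) - inner (p s) (p s) \<le> e\<^sup>2"
        using le[OF that] by (simp add: power2_diff inner_commute power2_norm_eq_inner)
      then have "exp (- s) * (inner (p s) (p' s) + inner (p' s) (p s) - inner (p s) (p s)) \<le> exp (- s) * e\<^sup>2"
        by (intro mult_left_mono) auto
      also have "\<dots> \<le> 1 * e\<^sup>2" using that by (intro mult_right_mono) auto
      finally show ?thesis by (simp add: right_diff_distrib)
    qed
    show ?thesis
    proof (rule DERIV_nonpos_imp_decreasing_open[OF t])
      fix s assume s: "0 < s" "s < t"
      then have "at s within {0..t} = at s" by (intro at_within_Icc_at)
      with d[of s] nonpos[of s] s
      show "\<exists>y. (\<phi> has_real_derivative y) (at s) \<and> y \<le> 0" by auto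
    next
      show "continuous_on {0..t} \<phi>"
        by (rule DERIV_continuous_on) (use d in auto)
    qed
  qed simp
  then have "exp (- t) * (norm (p t))\<^sup>2 \<le> (norm (p 0))\<^sup>2 + t * e\<^sup>2"
    by (simp add: \<phi>_def power2_norm_eq_inner mult.commute)
  then have "exp t * (exp (- t) * (norm (p t))\<^sup>2) \<le> exp t * ((norm (p 0))\<^sup>2 + t * e\<^sup>2)"
    by (rule mult_left_mono) simp
  then show ?thesis by (simp add: exp_minus flip: mult.assoc)
qed

context contraction_semigroup
begin

text \<open>The difference p of the two orbits solves p' = A_r p + (A_r - A) S(s)z + J b, with z =
  (1+T)q and b the truncation remainder. The middle term equals 2 S(s)(q - regularizer r q), small
  as r -> 1 uniformly in s; the norm of J = (1+rT)^(-1) gives the factor 1/(1-r). The vectors v and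
  q are unrelated here: their mismatch enters only at time 0.\<close>

lemma laguerre_partial_estimate:
  assumes r: "0 \<le> r" "r < 1" and t: "0 \<le> t"
    and err: "\<And>s. 0 \<le> s \<Longrightarrow> s \<le> t \<Longrightarrow>
      r ^ Suc N * \<bar>laguerre_fun_deriv a N s - laguerre_fun a N s\<bar> * norm v \<le> e"
  shows "(norm (laguerre_partial a r (Suc N) v t - S t (q + T q)))\<^sup>2 \<le>
    exp t * ((norm (laguerre_partial a r (Suc N) v 0 - (q + T q)))\<^sup>2 +
      t * (2 * norm (q - regularizer r q) + e / (1 - r))\<^sup>2)"
proof -
  define J where "J = neumann (of_real (- r))"
  have cr: "cmod (of_real (- r)) < 1" using r by simp
  have lin: "bounded_clinear J" unfolding J_def by (rule clinear_neumann[OF cr])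
  have J_left: "J (x + r *\<^sub>R T x) = x" for x
    using neumann_left[OF cr, of x] by (simp only: scaleC_of_real J_def) simp
  define w where "w = laguerre_partial a r (Suc N) v"
  define w' where "w' = laguerre_partial_deriv a r (Suc N) v"
  define z where "z = q + T q"
  define p where "p = (\<lambda>s. w s - S s z)"
  define p' where "p' = (\<lambda>s. w' s - S s (A z))"
  have z: "z \<in> DA" "A z = T q - q"
    unfolding z_def by (rule one_plus_cayley_in_DA A_one_plus_cayley)+
  have p'_eq: "inner (p s) (p' s) \<le> norm (p s) * (2 * norm (q - regularizer r q) + e / (1 - r))"
    if s: "0 \<le> s" "s \<le> t" for s
  proof -
    define b where "b = (r ^ Suc N * (laguerre_fun_deriv a N s - laguerre_fun a N s)) *\<^sub>R (T ^^ Suc N) v"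
    have "w' s + r *\<^sub>R T (w' s) + w s - r *\<^sub>R T (w s) = b"
      unfolding w_def w'_def b_def by (rule laguerre_partial_ode)
    then have "w' s + r *\<^sub>R T (w' s) = (w s + r *\<^sub>R T (w s)) - 2 *\<^sub>R w s + b"
      by (simp add: scaleR_2 algebra_simps)
    then have "J (w' s + r *\<^sub>R T (w' s)) = J ((w s + r *\<^sub>R T (w s)) - 2 *\<^sub>R w s + b)"
      by (simp only:)
    then have w': "w' s = w s - 2 *\<^sub>R J (w s) + J b"
      by (simp only: bounded_clinear_add[OF lin, of "_ - _"] bounded_clinear_diff[OF lin] J_left
          bounded_clinear_scaleR[OF lin])
    define \<sigma> where "\<sigma> = S s q"
    have Sz: "S s z = \<sigma> + T \<sigma>"
      using s by (simp add: z_def \<sigma>_def bounded_clinear_add[OF clinear_S] S_cayley)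
    have SAz: "S s (A z) = T \<sigma> - \<sigma>"
      using s by (simp add: z \<sigma>_def bounded_clinear_diff[OF clinear_S] S_cayley)
    have reg: "regularizer r (S s q) = S s (regularizer r q)"
      using s by (simp add: regularizer_def neumann_def commute_opser[OF summable_neumann[OF cr] clinear_S]
          S_cayley bounded_clinear_add[OF clinear_S] flip: of_real_minus)
    have JSz: "J (S s z) = regularizer r \<sigma>"
      unfolding Sz J_def regularizer_def ..
    have Jp: "J (p s) = J (w s) - regularizer r \<sigma>"
      unfolding p_def by (simp only: bounded_clinear_diff[OF lin] JSz)
    have "p' s = (p s - 2 *\<^sub>R J (p s)) + 2 *\<^sub>R (\<sigma> - regularizer r \<sigma>) + J b"
      unfolding p'_def Jp w' SAz unfolding p_def Sz by (simp add: scaleR_2 algebra_simps)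
    then have "inner (p s) (p' s) = inner (p s) (p s - 2 *\<^sub>R J (p s)) +
        inner (p s) (2 *\<^sub>R (\<sigma> - regularizer r \<sigma>)) + inner (p s) (J b)"
      by (simp only: inner_add_right)
    also have "\<dots> \<le> 0 + norm (p s) * norm (2 *\<^sub>R (\<sigma> - regularizer r \<sigma>)) + norm (p s) * norm (J b)"
      unfolding J_def by (intro add_mono inner_yosida_nonpos r norm_cauchy_schwarz)
    also have "\<dots> \<le> norm (p s) * (2 * norm (q - regularizer r q)) + norm (p s) * (e / (1 - r))"
      unfolding add_0
    proof (intro add_mono mult_left_mono)
      have "\<sigma> - regularizer r \<sigma> = S s (q - regularizer r q)"
        unfolding \<sigma>_def reg using s by (simp add: bounded_clinear_diff[OF clinear_S])
      then show "norm (2 *\<^sub>R (\<sigma> - regularizer r \<sigma>)) \<le> 2 * norm (q - regularizer r q)"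
        using norm_S_le[OF s(1)] by simp
      have "norm b \<le> r ^ Suc N * \<bar>laguerre_fun_deriv a N s - laguerre_fun a N s\<bar> * norm v"
        unfolding b_def norm_scaleR abs_mult using r
        by (intro mult_mono norm_pow_le) auto
      then have "norm b \<le> e" using err[OF s] by linarith
      then have "norm b / (1 - r) \<le> e / (1 - r)" using r by (intro divide_right_mono) auto
      then show "norm (J b) \<le> e / (1 - r)"
        using norm_neumann_le[OF cr, of b] r by (simp add: J_def)
    qed auto
    finally show ?thesis by (simp add: distrib_left)
  qed
  have deriv: "(p has_vector_derivative p' s) (at s within {0..t})" if "0 \<le> s" "s \<le> t" for s
    unfolding p_def p'_def w_def w'_def
    using that
    by (intro has_vector_derivative_diff has_vector_derivative_laguerre_partial
        has_vector_derivative_within_subset[OF has_vector_derivative_S[OF z(1)]]) auto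
  show ?thesis
    using energy_estimate[OF t deriv p'_eq] by (simp add: p_def w_def z_def S_0)
qed

lemma laguerre_op_estimate:
  assumes r: "0 \<le> r" "r < 1" and t: "0 \<le> t"
  shows "(norm (laguerre_op a r t v - S t (q + T q)))\<^sup>2 \<le>
    exp t * ((norm (laguerre_op a r 0 v - (q + T q)))\<^sup>2 + t * (2 * norm (q - regularizer r q))\<^sup>2)"
proof -
  obtain K \<rho> where \<rho>: "0 \<le> \<rho>" "\<rho> < 1"
    and K: "\<And>n s. 0 \<le> s \<Longrightarrow> s \<le> t \<Longrightarrow> r ^ n * \<bar>laguerre_fun a n s\<bar> \<le> K * \<rho> ^ n"
      "\<And>n s. 0 \<le> s \<Longrightarrow> s \<le> t \<Longrightarrow> r ^ n * \<bar>laguerre_fun_deriv a n s\<bar> \<le> K * \<rho> ^ n"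
    using laguerre_fun_bound[OF r t, of a] by metis
  have lim: "(\<lambda>N. laguerre_partial a r (Suc N) v s) \<longlonglongrightarrow> laguerre_op a r s v" if "0 \<le> s" for s
    using laguerre_op_sums[OF r that, of a v]
    unfolding sums_def laguerre_partial_def by (rule LIMSEQ_Suc)
  have lim_err: "(\<lambda>N. 2 * norm (q - regularizer r q) + 2 * K * \<rho> ^ N * norm v / (1 - r)) \<longlonglongrightarrow>
      2 * norm (q - regularizer r q) + 2 * K * 0 * norm v / (1 - r)"
    using \<rho> r by (intro tendsto_intros LIMSEQ_realpow_zero) auto
  have "(norm (laguerre_partial a r (Suc N) v t - S t (q + T q)))\<^sup>2 \<le>
      exp t * ((norm (laguerre_partial a r (Suc N) v 0 - (q + T q)))\<^sup>2 +
        t * (2 * norm (q - regularizer r q) + 2 * K * \<rho> ^ N * norm v / (1 - r))\<^sup>2)" for N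
  proof (rule laguerre_partial_estimate[OF r t])
    fix s assume s: "0 \<le> s" "s \<le> t"
    have "r ^ Suc N * \<bar>laguerre_fun_deriv a N s - laguerre_fun a N s\<bar> \<le>
        r ^ N * \<bar>laguerre_fun_deriv a N s - laguerre_fun a N s\<bar>"
      using r by (intro mult_right_mono power_decreasing) auto
    also have "\<dots> \<le> r ^ N * (\<bar>laguerre_fun_deriv a N s\<bar> + \<bar>laguerre_fun a N s\<bar>)"
      using r by (intro mult_left_mono) auto
    also have "\<dots> \<le> 2 * K * \<rho> ^ N"
      using K(1)[OF s, of N] K(2)[OF s, of N] by (simp add: distrib_left)
    finally show "r ^ Suc N * \<bar>laguerre_fun_deriv a N s - laguerre_fun a N s\<bar> * norm v \<le>
        2 * K * \<rho> ^ N * norm v"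
      by (rule mult_right_mono) simp
  qed
  then have "(norm (laguerre_op a r t v - S t (q + T q)))\<^sup>2 \<le>
      exp t * ((norm (laguerre_op a r 0 v - (q + T q)))\<^sup>2 +
        t * (2 * norm (q - regularizer r q) + 2 * K * 0 * norm v / (1 - r))\<^sup>2)"
    by (intro LIMSEQ_le[OF
          tendsto_power[OF tendsto_diff[OF lim[OF t] tendsto_const, THEN tendsto_norm]]
          tendsto_mult_left[OF tendsto_add[OF
              tendsto_power[OF tendsto_diff[OF lim[OF order_refl] tendsto_const, THEN tendsto_norm]]
              tendsto_mult_left[OF tendsto_power[OF lim_err]]]]] exI[of _ 0]) auto
  then show ?thesis by simp
qed

section \<open>Strong limits from the dense range of 1 + T\<close>

lemma tendsto_of_dense:
  fixes L :: "real \<Rightarrow> 'x \<Rightarrow> 'x"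
  assumes lin: "\<And>r. 0 \<le> r \<Longrightarrow> r < 1 \<Longrightarrow> bounded_clinear (L r)"
    and le: "\<And>r x. 0 \<le> r \<Longrightarrow> r < 1 \<Longrightarrow> norm (L r x) \<le> K * norm x"
    and lim: "\<And>q. ((\<lambda>r. L r (q + T q)) \<longlongrightarrow> q + T q) (at_left 1)"
  shows "((\<lambda>r. L r y) \<longlongrightarrow> y) (at_left 1)"
proof (rule tendstoI)
  fix e :: real assume e: "0 < e"
  have K: "0 < \<bar>K\<bar> + 1" by simp
  obtain z where z: "z \<in> DA" "norm (y - z) < e / 2 / (\<bar>K\<bar> + 1)"
    using DA_dense[of "e / 2 / (\<bar>K\<bar> + 1)" y] e K by (metis divide_pos_pos zero_less_numeral)
  obtain q where q: "z = q + T q" using DA_eq_range[OF z(1)] .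
  have "\<forall>\<^sub>F r in at_left (1::real). r \<in> {0<..<1}"
    by (rule eventually_at_left_real) simp
  moreover have "\<forall>\<^sub>F r in at_left 1. dist (L r z) z < e / 2"
    using tendstoD[OF lim[of q], of "e / 2"] e by (simp add: q)
  ultimately show "\<forall>\<^sub>F r in at_left 1. dist (L r y) y < e"
  proof eventually_elim
    case (elim r)
    then have r: "0 \<le> r" "r < 1" by auto
    have "norm (L r y - y) \<le> norm (L r (y - z)) + norm (L r z - z) + norm (y - z)"
    proof -
      have "L r y - y = L r (y - z) + (L r z - z) - (y - z)"
        by (simp add: bounded_clinear_diff[OF lin[OF r]])
      then show ?thesis
        using norm_triangle_ineq4[of "L r (y - z) + (L r z - z)" "y - z"]
          norm_triangle_ineq[of "L r (y - z)" "L r z - z"] by simp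
    qed
    also have "norm (L r (y - z)) \<le> \<bar>K\<bar> * norm (y - z)"
      using le[OF r, of "y - z"] by (smt (verit) mult_right_mono norm_ge_zero)
    finally have "norm (L r y - y) \<le> (\<bar>K\<bar> + 1) * norm (y - z) + norm (L r z - z)"
      by (simp add: distrib_right)
    moreover have "(\<bar>K\<bar> + 1) * norm (y - z) < e / 2"
      using z(2) K by (simp add: pos_less_divide_eq algebra_simps)
    ultimately show ?case using elim by (simp add: dist_norm)
  qed
qed

lemma eventually_at_left_1: "\<forall>\<^sub>F r in at_left (1::real). 0 \<le> r \<and> r < 1"
  using eventually_at_left_real[of 0 1] by (auto elim!: eventually_mono)

text \<open>On a vector (1+T)q the correction term in \<open>regularizer_eq\<close> is 1-r times T
  times the regularizer of q, which stays bounded.\<close>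

lemma regularizer_tendsto: "((\<lambda>r. regularizer r y) \<longlongrightarrow> y) (at_left 1)"
proof (rule tendsto_of_dense)
  fix q :: 'x
  have "((\<lambda>r. (1 - r) * (2 * norm q)) \<longlongrightarrow> 0) (at_left (1::real))"
    by (auto intro!: tendsto_eq_intros)
  then have "((\<lambda>r. regularizer r (q + T q) - (q + T q)) \<longlongrightarrow> 0) (at_left 1)"
  proof (rule Lim_null_comparison[rotated])
    show "\<forall>\<^sub>F r in at_left 1. norm (regularizer r (q + T q) - (q + T q)) \<le> (1 - r) * (2 * norm q)"
      using eventually_at_left_1
    proof eventually_elim
      case (elim r)
      then have r: "0 \<le> r" "r < 1" and cr: "cmod (of_real (- r)) < 1" by auto
      have "regularizer r (q + T q) - (q + T q) = (1 - r) *\<^sub>R T (regularizer r q)"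
        using regularizer_eq[OF r, of "q + T q"]
        by (simp only: T_neumann[OF cr] regularizer_def[of r q]) simp
      then have "norm (regularizer r (q + T q) - (q + T q)) = (1 - r) * norm (T (regularizer r q))"
        using r by simp
      also have "\<dots> \<le> (1 - r) * (2 * norm q)"
        using r by (intro mult_left_mono order_trans[OF norm_T_le norm_regularizer_le]) auto
      finally show ?case .
    qed
  qed
  then show "((\<lambda>r. regularizer r (q + T q)) \<longlongrightarrow> q + T q) (at_left 1)"
    by (rule LIM_zero_cancel)
qed (rule clinear_regularizer norm_regularizer_le; assumption)+

end

section \<open>The initial value of the Abel sums\<close>

context contraction_operator
begin

lemma T_binom_op: "binom_summable b r \<Longrightarrow> T (binom_op b r x) = binom_op b r (T x)"
  unfolding binom_op_def binom_summable_def by (rule T_opser)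

lemma binom_op_1_regularizer:
  assumes "0 \<le> r" "r < 1"
  shows "binom_op 1 r (regularizer r y) = y + T y"
proof -
  have "cmod (of_real (- r)) < 1" using assms by simp
  from neumann_right[OF this, of "y + T y"] show ?thesis
    unfolding binom_op_1 regularizer_def by (simp only: scaleC_of_real) simp
qed

text \<open>Since y + T y is (1+rT) applied to \<open>regularizer r y\<close>, X is
  (1+rT)^(-1-a)(1+T)y. Both terms on the left are then powers of order a of one vector X, with
  parameters 1 and r, and their difference falls under \<open>norm_binom_op_diff_le\<close>.\<close>

lemma binom_op_defect:
  fixes y :: 'x
  assumes a: "0 < a" "a < 1" and r: "0 \<le> r" "r < 1"
  defines "X \<equiv> binom_op (- a) r (regularizer r y)"
  shows "binom_op (- 1 - a) r (binom_op a 1 (y + T y)) - regularizer r y = binom_op a 1 X - binom_op a r X"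
proof -
  note sr = binom_summable_less[OF r]
  have B: "binom_summable a 1" using a by (intro binom_summable_pos) auto
  have X: "X = binom_op (- 1 - a) r (y + T y)"
    unfolding X_def
    using binom_op_mult[OF sr sr, of "- 1 - a" 1 "regularizer r y"]
    by (simp add: binom_op_1_regularizer[OF r])
  have "binom_op (- 1 - a) r (binom_op a 1 (y + T y)) = binom_op a 1 X"
    unfolding X binom_op_def[of "- 1 - a"]
    using sr[of "- 1 - a"] T_binom_op[OF B]
    by (intro commute_opser[symmetric] clinear_binom_op B) (simp_all add: binom_summable_def)
  moreover have "binom_op a r X = regularizer r y"
    unfolding X using binom_op_mult[OF sr sr, of a "- 1 - a" "y + T y"]
    by (simp add: binom_op_minus_1 regularizer_def)
  ultimately show ?thesis by simp
qed

text \<open>The powers (1-r)^a and (1-r)^(-a) cancel exactly. This yields a bound uniform in r but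
  no convergence yet.\<close>

lemma norm_binom_op_defect_le:
  assumes a: "0 < a" "a < 1" and r: "0 \<le> r" "r < 1"
  shows "norm (binom_op (- 1 - a) r (binom_op a 1 (y + T y)) - regularizer r y) \<le> 2 * norm y"
proof -
  have "norm (binom_op (- 1 - a) r (binom_op a 1 (y + T y)) - regularizer r y) \<le>
      (1 - r) powr a * norm (binom_op (- a) r (regularizer r y))"
    unfolding binom_op_defect[OF a r] using a by (intro norm_binom_op_diff_le r) auto
  also have "\<dots> \<le> (1 - r) powr a * ((1 - r) powr (- a) * norm (regularizer r y))"
    using a by (intro mult_left_mono norm_binom_op_neg_le r) auto
  also have "\<dots> = norm (regularizer r y)"
    using r by (simp add: powr_minus)
  also have "\<dots> \<le> 2 * norm y" by (rule norm_regularizer_le[OF r])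
  finally show ?thesis .
qed

text \<open>For y in the range of 1 + T one more factor 1 + rT can be split off, which raises the
  exponent -a to 1-a > 0. That power is bounded uniformly in r, so the rate (1-r)^a survives; 8 is 2
  for this power times 2 for each of two regularizers.\<close>

lemma norm_binom_op_defect_range_le:
  fixes p :: 'x
  assumes a: "0 < a" "a < 1" and r: "0 \<le> r" "r < 1"
  defines "y \<equiv> p + T p"
  shows "norm (binom_op (- 1 - a) r (binom_op a 1 (y + T y)) - regularizer r y) \<le>
    (1 - r) powr a * (8 * norm p)"
proof -
  note sr = binom_summable_less[OF r]
  have cr: "cmod (of_real (- r)) < 1" using r by simp
  have "regularizer r (T x) = T (regularizer r x)" for x
    by (simp only: regularizer_def T_neumann[OF cr] bounded_clinear_add[OF clinear_T])
  then have "regularizer r y = binom_op 1 r (regularizer r (regularizer r p))"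
    unfolding y_def binom_op_1_regularizer[OF r, of p, symmetric] binom_op_def
    using sr[of 1] by (intro commute_opser clinear_regularizer r) (simp_all add: binom_summable_def)
  then have X: "binom_op (- a) r (regularizer r y) = binom_op (1 - a) r (regularizer r (regularizer r p))"
    using binom_op_mult[OF sr sr, of "- a" 1 "regularizer r (regularizer r p)"] by simp
  have "norm (binom_op (- 1 - a) r (binom_op a 1 (y + T y)) - regularizer r y) \<le>
      (1 - r) powr a * norm (binom_op (1 - a) r (regularizer r (regularizer r p)))"
    unfolding binom_op_defect[OF a r] X using a by (intro norm_binom_op_diff_le r) auto
  also have "\<dots> \<le> (1 - r) powr a * (2 * (2 * (2 * norm p)))"
    using a r
    by (intro mult_left_mono order_trans[OF norm_binom_op_pos_le]
        order_trans[OF norm_regularizer_le[OF r]] norm_regularizer_le) auto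
  finally show ?thesis by simp
qed

end

context contraction_semigroup
begin

lemma initial_value_tendsto:
  assumes a: "0 < a" "a < 1"
  shows "((\<lambda>r. binom_op (- 1 - a) r (binom_op a 1 (y + T y))) \<longlongrightarrow> y) (at_left 1)"
proof (rule tendsto_of_dense[where K = 4])
  fix r :: real assume r: "0 \<le> r" "r < 1"
  show "bounded_clinear (\<lambda>y. binom_op (- 1 - a) r (binom_op a 1 (y + T y)))"
    using a r
    by (intro bounded_clinear_compose[OF clinear_binom_op] bounded_clinear_compose[OF clinear_binom_op]
        clinear_one_plus_T binom_summable_less binom_summable_pos) auto
  show "norm (binom_op (- 1 - a) r (binom_op a 1 (y + T y))) \<le> 4 * norm y" for y
    using norm_triangle_sub[of "binom_op (- 1 - a) r (binom_op a 1 (y + T y))" "regularizer r y"]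
      norm_binom_op_defect_le[OF a r, of y] norm_regularizer_le[OF r, of y] by linarith
next
  fix p :: 'x
  define y where "y = p + T p"
  have "\<forall>\<^sub>F r in at_left (1::real). 0 \<le> 1 - r"
    by (rule eventually_mono[OF eventually_at_left_1]) simp
  with a have "((\<lambda>r. (1 - r) powr a) \<longlongrightarrow> (1 - 1) powr a) (at_left (1::real))"
    by (intro tendsto_powr' tendsto_diff tendsto_const tendsto_ident_at) simp
  from tendsto_mult_right[OF this, of "8 * norm p"]
  have "((\<lambda>r. (1 - r) powr a * (8 * norm p)) \<longlongrightarrow> 0) (at_left (1::real))"
    by simp
  then have "((\<lambda>r. binom_op (- 1 - a) r (binom_op a 1 (y + T y)) - regularizer r y) \<longlongrightarrow> 0) (at_left 1)"
  proof (rule Lim_null_comparison[rotated])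
    show "\<forall>\<^sub>F r in at_left 1. norm (binom_op (- 1 - a) r (binom_op a 1 (y + T y)) - regularizer r y) \<le>
        (1 - r) powr a * (8 * norm p)"
      using eventually_at_left_1
      by eventually_elim (simp only: y_def norm_binom_op_defect_range_le a)
  qed
  from tendsto_add[OF this regularizer_tendsto[of y]]
  show "((\<lambda>r. binom_op (- 1 - a) r (binom_op a 1 ((p + T p) + T (p + T p)))) \<longlongrightarrow> p + T p) (at_left 1)"
    by (simp add: y_def)
qed

lemma laguerre_op_tendsto:
  assumes a: "0 < a" "a < 1" and t: "0 \<le> t"
  shows "((\<lambda>r. laguerre_op a r t (binom_op a 1 (y + T y))) \<longlongrightarrow> S t y) (at_left 1)"
proof (rule tendstoI)
  fix e :: real assume e: "0 < e"
  define v where "v = binom_op a 1 (y + T y)"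
  \<comment> \<open>The energy comparison needs an orbit starting in the domain, so y is replaced by
    z within \<eta>. With this \<eta> the initial mismatch contributes less than (e/2)^2 even after
    the factor exp t, and \<eta> \<le> e/2 controls S(t)z - S(t)y.\<close>
  define \<eta> where "\<eta> = e / (2 * exp t)"
  have \<eta>: "0 < \<eta>" using e by (simp add: \<eta>_def)
  obtain z where z: "z \<in> DA" "norm (y - z) < \<eta>" using DA_dense[OF \<eta>] .
  obtain q where q: "z = q + T q" using DA_eq_range[OF z(1)] .
  have "((\<lambda>r. laguerre_op a r 0 v) \<longlongrightarrow> y) (at_left 1)"
    unfolding laguerre_op_0 v_def by (rule initial_value_tendsto[OF a])
  then have "((\<lambda>r. exp t * ((norm (laguerre_op a r 0 v - (q + T q)))\<^sup>2 +
      t * (2 * norm (q - regularizer r q))\<^sup>2)) \<longlongrightarrow>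
      exp t * ((norm (y - (q + T q)))\<^sup>2 + t * (2 * norm (q - q))\<^sup>2)) (at_left 1)"
    by (intro tendsto_intros regularizer_tendsto)
  moreover have "exp t * ((norm (y - (q + T q)))\<^sup>2 + t * (2 * norm (q - q))\<^sup>2) < (e / 2)\<^sup>2"
  proof -
    have "(norm (y - z))\<^sup>2 < \<eta>\<^sup>2" using z(2) by (intro power_strict_mono) auto
    then have "exp t * (norm (y - z))\<^sup>2 < exp t * \<eta>\<^sup>2" by simp
    also have "\<dots> = (e / 2)\<^sup>2 * (1 / exp t)"
      by (simp add: \<eta>_def power2_eq_square field_simps)
    also have "\<dots> \<le> (e / 2)\<^sup>2 * 1" using t by (intro mult_left_mono) auto
    finally show ?thesis by (simp add: q)
  qed
  ultimately have "\<forall>\<^sub>F r in at_left 1. exp t * ((norm (laguerre_op a r 0 v - (q + T q)))\<^sup>2 +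
      t * (2 * norm (q - regularizer r q))\<^sup>2) < (e / 2)\<^sup>2"
    by (rule order_tendstoD(2))
  then show "\<forall>\<^sub>F r in at_left 1. dist (laguerre_op a r t (binom_op a 1 (y + T y))) (S t y) < e"
    using eventually_at_left_1
  proof eventually_elim
    case (elim r)
    then have r: "0 \<le> r" "r < 1" by auto
    have "(norm (laguerre_op a r t v - S t z))\<^sup>2 < (e / 2)\<^sup>2"
      using laguerre_op_estimate[OF r t, of a v q] elim(1) by (simp add: q)
    then have "norm (laguerre_op a r t v - S t z) < e / 2"
      by (rule power2_less_imp_less) (use e in simp)
    moreover have "norm (S t z - S t y) < e / 2"
    proof -
      have "norm (S t z - S t y) \<le> norm (z - y)"
        using norm_S_le[OF t, of "z - y"] by (simp add: bounded_clinear_diff[OF clinear_S[OF t]])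
      also have "\<dots> < \<eta>" using z(2) by (simp add: norm_minus_commute)
      also have "\<dots> \<le> e / 2"
      proof -
        have "1 * e \<le> exp t * e" using t e by (intro mult_right_mono) auto
        then show ?thesis by (simp add: \<eta>_def field_simps)
      qed
      finally show ?thesis .
    qed
    ultimately have "norm ((laguerre_op a r t v - S t z) + (S t z - S t y)) < e"
      using norm_triangle_ineq[of "laguerre_op a r t v - S t z" "S t z - S t y"] by linarith
    then show ?case by (simp add: v_def dist_norm)
  qed
qed

end

section \<open>From coefficients to the weighted integral by Fatou's lemma\<close>

lemma nn_integral_limit_le:
  fixes f :: "nat \<Rightarrow> 'a \<Rightarrow> ennreal"
  assumes meas: "\<And>n. f n \<in> borel_measurable M"
    and lim: "\<And>x. (\<lambda>n. f n x) \<longlonglongrightarrow> g x"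
    and le: "\<And>n. (\<integral>\<^sup>+x. f n x \<partial>M) \<le> B"
  shows "g \<in> borel_measurable M" "(\<integral>\<^sup>+x. g x \<partial>M) \<le> B"
proof -
  show "g \<in> borel_measurable M"
    by (rule borel_measurable_LIMSEQ_order[OF lim meas])
  have "(\<integral>\<^sup>+x. g x \<partial>M) = (\<integral>\<^sup>+x. liminf (\<lambda>n. f n x) \<partial>M)"
    using lim_imp_Liminf[OF sequentially_bot lim] by simp
  also have "\<dots> \<le> liminf (\<lambda>n. \<integral>\<^sup>+x. f n x \<partial>M)"
    by (rule nn_integral_liminf[OF meas])
  also have "\<dots> \<le> liminf (\<lambda>_::nat. B)"
    by (intro Liminf_mono always_eventually allI le)
  also have "\<dots> = B" by (simp add: Liminf_const)
  finally show "(\<integral>\<^sup>+x. g x \<partial>M) \<le> B" .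
qed

lemma Re_cayley_transform:
  assumes "cmod z < 1"
  shows "Re ((1 - z) / (1 + z)) = (1 - (cmod z)\<^sup>2) / (cmod (1 + z))\<^sup>2"
proof -
  have "Re ((1 - z) / (1 + z)) = Re ((1 - z) * cnj (1 + z)) / (cmod (1 + z))\<^sup>2"
    by (subst complex_div_cnj) (simp flip: of_real_power)
  also have "Re ((1 - z) * cnj (1 + z)) = 1 - (cmod z)\<^sup>2"
    unfolding cmod_power2 by (simp add: power2_eq_square algebra_simps)
  finally show ?thesis .
qed

context contraction_semigroup
begin

text \<open>Fatou's lemma is used twice: for N to infinity at fixed r, then for r -> 1. The bound B
  persists because r^n \<le> 1, and measurability of \<open>G r\<close> is inherited from the finite
  sums.\<close>

lemma weighted_integral_le:
  fixes E :: "'x \<Rightarrow> 'y::complex_hilbert"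
  assumes a: "0 < a" "a < 1" and E: "bounded_clinear E"
    and le: "(\<Sum>n. ennreal ((1 + real n) powr a * (norm (E (binom_op a 1 ((T ^^ n) (y + T y)))))\<^sup>2)) \<le> B"
  shows "(\<integral>\<^sup>+t\<in>{0..}. ennreal (t powr a * (norm (E (S t y)))\<^sup>2) \<partial>lborel) \<le> B"
proof -
  define x where "x = y + T y"
  define D where "D = (\<lambda>n. E (binom_op a 1 ((T ^^ n) x)))"
  define h where "h = (\<lambda>t u. ennreal (t powr a * (norm (u :: 'y))\<^sup>2) * indicator {0..} t)"
  define F where "F = (\<lambda>r N t. h t (\<Sum>n<N. laguerre_fun a n t *\<^sub>R (r ^ n *\<^sub>R D n)))"
  define G where "G = (\<lambda>r t. h t (E (laguerre_op a r t (binom_op a 1 x))))"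
  have binom: "binom_summable a 1" using a by (intro binom_summable_pos) auto
  have h_lim: "((\<lambda>i. h t (u i)) \<longlongrightarrow> h t l) F'" if "0 \<le> t \<Longrightarrow> (u \<longlongrightarrow> l) F'" for t u l and F' :: "'i filter"
  proof (cases "0 \<le> t")
    case True
    then show ?thesis
      using that[OF True] unfolding h_def by (simp, intro tendsto_intros)
  qed (simp add: h_def)
  have F_meas: "F r N \<in> borel_measurable lborel" for r N
  proof -
    have "continuous_on UNIV (laguerre_fun a n)" for n
      unfolding laguerre_fun_def[abs_def]
      by (intro continuous_intros continuous_on_compose2[OF continuous_on_laguerre]) auto
    then have [measurable]: "(\<lambda>t. norm (\<Sum>n<N. laguerre_fun a n t *\<^sub>R (r ^ n *\<^sub>R D n))) \<in> borel_measurable borel"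
      by (intro borel_measurable_continuous_onI continuous_intros)
    show ?thesis unfolding F_def h_def by measurable
  qed
  have F_le: "(\<integral>\<^sup>+t. F r N t \<partial>lborel) \<le> B" if r: "0 \<le> r" "r < 1" for r N
  proof -
    have "(\<integral>\<^sup>+t. F r N t \<partial>lborel) \<le> (\<Sum>n<N. ennreal ((1 + real n) powr a * (norm (r ^ n *\<^sub>R D n))\<^sup>2))"
      unfolding F_def h_def by (rule laguerre_fun_bessel[OF a])
    also have "\<dots> \<le> (\<Sum>n<N. ennreal ((1 + real n) powr a * (norm (D n))\<^sup>2))"
    proof (intro sum_mono ennreal_leI mult_left_mono power_mono)
      fix n
      have "r ^ n * norm (D n) \<le> 1 * norm (D n)"
        using r by (intro mult_right_mono power_le_one) auto
      then show "norm (r ^ n *\<^sub>R D n) \<le> norm (D n)" using r by simp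
    qed auto
    also have "\<dots> \<le> (\<Sum>n. ennreal ((1 + real n) powr a * (norm (D n))\<^sup>2))"
      by (intro sum_le_suminf summableI) auto
    also have "\<dots> \<le> B" using le by (simp add: D_def x_def)
    finally show ?thesis .
  qed
  have F_lim: "(\<lambda>N. F r N t) \<longlonglongrightarrow> G r t" if r: "0 \<le> r" "r < 1" for r t
    unfolding F_def G_def
  proof (rule h_lim)
    assume t: "0 \<le> t"
    have comm: "(T ^^ n) (binom_op a 1 x) = binom_op a 1 ((T ^^ n) x)" for n
      unfolding binom_op_def using binom
      by (intro commute_opser clinear_pow) (simp_all add: binom_summable_def funpow_swap1)
    have "(\<lambda>n. E ((r ^ n * laguerre_fun a n t) *\<^sub>R (T ^^ n) (binom_op a 1 x))) sums
        E (laguerre_op a r t (binom_op a 1 x))"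
      by (intro bounded_linear.sums[OF bounded_clinear_imp_bounded_linear[OF E]] laguerre_op_sums r t)
    then show "(\<lambda>N. \<Sum>n<N. laguerre_fun a n t *\<^sub>R (r ^ n *\<^sub>R D n)) \<longlonglongrightarrow>
        E (laguerre_op a r t (binom_op a 1 x))"
      by (simp add: sums_def comm D_def bounded_clinear_scaleR[OF E] mult.commute)
  qed
  have G_meas: "G r \<in> borel_measurable lborel" and G_le: "(\<integral>\<^sup>+t. G r t \<partial>lborel) \<le> B"
    if "0 \<le> r" "r < 1" for r
    using nn_integral_limit_le[OF F_meas F_lim[OF that] F_le[OF that]] by auto
  \<comment> \<open>Fatou's lemma needs a sequence, so r -> 1 is taken along these values in
    [0,1).\<close>
  define \<rho> where "\<rho> = (\<lambda>k. 1 - inverse (real (Suc k)))"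
  have \<rho>: "0 \<le> \<rho> k" "\<rho> k < 1" for k
    by (simp_all add: \<rho>_def inverse_le_1_iff)
  have "\<rho> \<longlonglongrightarrow> 1 - 0"
    unfolding \<rho>_def by (intro tendsto_diff tendsto_const LIMSEQ_inverse_real_of_nat)
  then have \<rho>_lim: "filterlim \<rho> (at_left 1) sequentially"
    unfolding filterlim_at using \<rho>(2) by (auto simp: less_imp_neq)
  have "(\<lambda>k. G (\<rho> k) t) \<longlonglongrightarrow> h t (E (S t y))" for t
    unfolding G_def
  proof (rule h_lim)
    assume "0 \<le> t"
    from filterlim_compose[OF laguerre_op_tendsto[OF a this, of y] \<rho>_lim]
    show "(\<lambda>k. E (laguerre_op a (\<rho> k) t (binom_op a 1 x))) \<longlonglongrightarrow> E (S t y)"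
      unfolding x_def
      by (rule bounded_linear.tendsto[OF bounded_clinear_imp_bounded_linear[OF E]])
  qed
  from nn_integral_limit_le(2)[OF G_meas[OF \<rho>] this G_le[OF \<rho>]]
  show ?thesis by (simp add: h_def)
qed

section \<open>The resolvent of the generator in disc coordinates\<close>

lemma resolvent_eq:
  fixes v :: 'x
  assumes z: "cmod z < 1"
  defines "q \<equiv> ((1 + z) / 2) *\<^sub>C neumann z v"
  shows "resolvent DA A ((1 - z) / (1 + z)) v = q + T q"
proof -
  define l where "l = (1 - z) / (1 + z)"
  have nz: "1 + z \<noteq> 0" using one_plus_pos[OF z] by auto
  have l: "0 < Re l"
    unfolding l_def Re_cayley_transform[OF z]
    using one_minus_norm_square_le(1)[OF z] one_plus_pos[OF z] by simp
  \<comment> \<open>The resolvent is an \<open>inv_into\<close>, so a solution of the resolvent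
    equation is its value only by injectivity; this follows from dissipativity and Re l > 0.\<close>
  have inj: "inj_on (\<lambda>x. l *\<^sub>C x - A x) DA"
  proof
    fix x x' assume x: "x \<in> DA" "x' \<in> DA" "l *\<^sub>C x - A x = l *\<^sub>C x' - A x'"
    have "l *\<^sub>C (x - x') = A (x - x')"
      using x by (simp add: A_diff scaleC.diff_right algebra_simps)
    moreover have "inner (l *\<^sub>C (x - x')) (x - x') = Re l * (norm (x - x'))\<^sup>2"
      by (simp add: inner_eq_Re_cinner cinner_scaleC_left cinner_self)
    ultimately have "Re l * (norm (x - x'))\<^sup>2 \<le> 0"
      using inner_A_nonpos[OF DA_diff[OF x(1,2)]] by simp
    then show "x = x'" using l by (simp add: mult_le_0_iff)
  qed
  \<comment> \<open>In these coordinates l - A becomes a multiple of 1 - zT: the coefficients l + 1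
    and l - 1 of q and Tq are 2/(1+z) and -2z/(1+z). The factor (1+z)/2 in \<open>q\<close>
    normalizes this.\<close>
  have "l *\<^sub>C (q + T q) - A (q + T q) = (l + 1) *\<^sub>C q + (l - 1) *\<^sub>C T q"
    by (simp add: A_one_plus_cayley scaleC_add_right scaleC.add_left scaleC.diff_left scaleC_one)
  also have "l + 1 = 2 / (1 + z)"
    using nz by (simp add: l_def divide_simps)
  also have "l - 1 = - (2 * z / (1 + z))"
    using nz by (simp add: l_def divide_simps)
  also have "(2 / (1 + z)) *\<^sub>C q + (- (2 * z / (1 + z))) *\<^sub>C T q = neumann z v - z *\<^sub>C T (neumann z v)"
  proof -
    have "2 / w * (w / 2) = 1" "2 * z / w * (w / 2) = z" if "w \<noteq> 0" for w :: complex
      using that by simp_all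
    from this[OF nz] show ?thesis
      by (simp only: q_def bounded_clinear_scaleC[OF clinear_T] scaleC_scaleC mult_minus_left
          scaleC.minus_left scaleC_one add_uminus_conv_diff)
  qed
  also have "\<dots> = v" by (rule neumann_right[OF z])
  finally show ?thesis
    unfolding resolvent_def l_def[symmetric]
    using inv_into_f_f[OF inj one_plus_cayley_in_DA] by metis
qed

lemma continuous_resolvent_condition_imp_bound:
  fixes C :: "'x \<Rightarrow> 'y::complex_hilbert"
  assumes a: "a = 1 - 2 * g" and E: "bounded_clinear (\<lambda>v. C (v + T v))"
    and cond: "continuous_resolvent_condition a DA A C"
  obtains m where "0 \<le> m" "\<And>z v. cmod z < 1 \<Longrightarrow> norm (C (neumann z v + T (neumann z v))) \<le>
    m * cmod (1 + z) powr (- a) * (1 - (cmod z)\<^sup>2) powr (- g) * norm v"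
proof -
  have g: "(1 - a) / 2 = g" using a by simp
  obtain m where m: "\<And>l. Re l > 0 \<Longrightarrow> Re l powr g * onorm (C \<circ> resolvent DA A l) \<le> m"
    using cond unfolding continuous_resolvent_condition_def bdd_above_def g by auto
  have "norm (C (neumann z v + T (neumann z v))) \<le>
      2 * \<bar>m\<bar> * cmod (1 + z) powr (- a) * (1 - (cmod z)\<^sup>2) powr (- g) * norm v"
    if z: "cmod z < 1" for z v
  proof -
    define l where "l = (1 - z) / (1 + z)"
    define c where "c = cmod (1 + z)"
    define P where "P = 1 - (cmod z)\<^sup>2"
    have c: "0 < c" and P: "0 < P"
      using one_plus_pos[OF z] one_minus_norm_square_le[OF z] by (simp_all add: c_def P_def)
    have l: "Re l = P / c\<^sup>2" unfolding l_def c_def P_def by (rule Re_cayley_transform[OF z])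
    then have l_pos: "0 < Re l" using c P by simp
    have R: "(C \<circ> resolvent DA A l) v = ((1 + z) / 2) *\<^sub>C C (neumann z v + T (neumann z v))" for v
      using resolvent_eq[OF z, of v]
        bounded_clinear_scaleC[OF E, of "(1 + z) / 2" "neumann z v"]
      by (simp add: l_def)
    have "bounded_linear (\<lambda>v. ((1 + z) / 2) *\<^sub>C C (neumann z v + T (neumann z v)))"
      by (intro bounded_linear_compose[OF scaleC.bounded_linear_right]
          bounded_clinear_imp_bounded_linear bounded_clinear_compose[OF E] clinear_neumann z)
    then have lin: "bounded_linear (C \<circ> resolvent DA A l)"
      by (simp only: R[symmetric])
    have "c / 2 * norm (C (neumann z v + T (neumann z v))) = norm ((C \<circ> resolvent DA A l) v)"
      unfolding R by (simp add: norm_scaleC c_def norm_divide)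
    also have "\<dots> \<le> onorm (C \<circ> resolvent DA A l) * norm v"
      by (rule onorm[OF lin])
    also have "\<dots> \<le> (\<bar>m\<bar> * Re l powr (- g)) * norm v"
    proof (rule mult_right_mono)
      have "Re l powr g * onorm (C \<circ> resolvent DA A l) \<le> \<bar>m\<bar>"
        using m[OF l_pos] by linarith
      then show "onorm (C \<circ> resolvent DA A l) \<le> \<bar>m\<bar> * Re l powr (- g)"
        using l_pos by (simp add: powr_minus field_simps)
    qed simp
    \<comment> \<open>Re l = P/c^2 contributes c^(2g). Dividing by the factor c/2 of the resolvent
      leaves c^(2g-1) = c^(-a): the origin of the singularity at z = -1.\<close>
    also have "Re l powr (- g) = P powr (- g) * c powr (2 * g)"
    proof -
      have "Re l = P * c powr (- 2)"
        unfolding l using c by (simp add: powr_minus powr_numeral divide_inverse)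
      then show ?thesis using c P by (simp add: powr_mult powr_powr)
    qed
    finally have "norm (C (neumann z v + T (neumann z v))) \<le>
        2 * \<bar>m\<bar> * (c powr (2 * g) / c) * P powr (- g) * norm v"
      using c by (simp add: field_simps)
    also have "c powr (2 * g) / c = c powr (- a)"
      using c powr_diff[of c "2 * g" 1] by (simp add: a)
    finally show ?thesis by (simp add: c_def P_def)
  qed
  then show ?thesis by (intro that[of "2 * \<bar>m\<bar>"]) auto
qed

text \<open>The graph norm of v + T v is at most 4 times the norm of v, as A maps it to T v - v.
  Composition with 1 + T thus trades C, meaningful only on the domain, for a bounded operator on the
  whole space.\<close>

lemma bounded_clinear_of_bounded_on_domain:
  fixes C :: "'x \<Rightarrow> 'y::complex_hilbert"
  assumes "bounded_on_domain DA A C"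
  shows "bounded_clinear (\<lambda>v. C (v + T v))"
proof -
  have add: "C (x + y) = C x + C y" if "x \<in> DA" "y \<in> DA" for x y
    using assms that by (simp add: bounded_on_domain_def)
  have scaleC: "C (c *\<^sub>C x) = c *\<^sub>C C x" if "x \<in> DA" for c x
    using assms that by (simp add: bounded_on_domain_def)
  obtain K where K: "\<And>x. x \<in> DA \<Longrightarrow> norm (C x) \<le> K * (norm x + norm (A x))"
    using assms unfolding bounded_on_domain_def by blast
  have E_scaleC: "C (c *\<^sub>C v + T (c *\<^sub>C v)) = c *\<^sub>C C (v + T v)" for c v
    using scaleC[OF one_plus_cayley_in_DA, of c v]
    by (simp add: bounded_clinear_scaleC[OF clinear_T] scaleC_add_right)
  have "bounded_linear (\<lambda>v. C (v + T v))"
  proof (rule bounded_linear_intro)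
    fix v w :: 'x and r :: real
    show "C (v + w + T (v + w)) = C (v + T v) + C (w + T w)"
      using add[OF one_plus_cayley_in_DA one_plus_cayley_in_DA, of v w]
      by (simp add: bounded_clinear_add[OF clinear_T] add_ac)
    show "C (r *\<^sub>R v + T (r *\<^sub>R v)) = r *\<^sub>R C (v + T v)"
      using E_scaleC[of "of_real r" v] by (simp add: scaleC_of_real)
    have "norm (v + T v) \<le> 2 * norm v" "norm (T v - v) \<le> 2 * norm v"
      using norm_triangle_ineq[of v "T v"] norm_triangle_ineq4[of "T v" v] norm_T_le[of v] by linarith+
    then have "norm (v + T v) + norm (T v - v) \<le> 4 * norm v" by simp
    then have "\<bar>K\<bar> * (norm (v + T v) + norm (T v - v)) \<le> \<bar>K\<bar> * (4 * norm v)"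
      by (intro mult_left_mono) auto
    moreover have "K * (norm (v + T v) + norm (T v - v)) \<le> \<bar>K\<bar> * (norm (v + T v) + norm (T v - v))"
      by (intro mult_right_mono) auto
    ultimately have "norm (C (v + T v)) \<le> \<bar>K\<bar> * (4 * norm v)"
      using K[OF one_plus_cayley_in_DA, of v] unfolding A_one_plus_cayley by linarith
    then show "norm (C (v + T v)) \<le> norm v * (4 * \<bar>K\<bar>)"
      by (simp add: mult_ac)
  qed
  with E_scaleC show ?thesis by (simp add: bounded_clinear_def)
qed

end

theorem theorem2p3:
  fixes \<alpha> :: real
    and S :: "real \<Rightarrow> 'x::complex_hilbert \<Rightarrow> 'x"
    and DA :: "'x set" and A :: "'x \<Rightarrow> 'x"
  assumes "0 < \<alpha>" and "\<alpha> < 1"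
    and "contractive_C0_semigroup S"
    and "is_generator S DA A"
    and "\<forall>D :: 'x \<Rightarrow> 'y::complex_hilbert.
           bounded_clinear D \<longrightarrow> discrete_resolvent_condition \<alpha> (cayley DA A) D \<longrightarrow>
           discrete_admissible \<alpha> (cayley DA A) D"
  shows "\<forall>C :: 'x \<Rightarrow> 'y.
           bounded_on_domain DA A C \<longrightarrow> continuous_resolvent_condition \<alpha> DA A C \<longrightarrow>
           admissible \<alpha> S DA C"
proof (intro allI impI)
  fix C :: "'x \<Rightarrow> 'y"
  assume C: "bounded_on_domain DA A C" and cond: "continuous_resolvent_condition \<alpha> DA A C"
  interpret contraction_semigroup S DA A
    using assms(3,4) by unfold_locales
  note \<alpha> = assms(1,2)
  \<comment> \<open>Half of 1 - \<alpha> is the exponent in both resolvent conditions; \<alpha> = 1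
    - 2g is the form in which the exponents combine.\<close>
  define g where "g = (1 - \<alpha>) / 2"
  have g: "\<alpha> = 1 - 2 * g" by (simp add: g_def field_simps)
  define E where "E = (\<lambda>v. C (v + cayley DA A v))"
  define D where "D = (\<lambda>v. E (binom_op \<alpha> 1 v))"
  have E: "bounded_clinear E"
    unfolding E_def by (rule bounded_clinear_of_bounded_on_domain[OF C])
  have D: "bounded_clinear D"
    unfolding D_def using \<alpha> by (intro bounded_clinear_compose[OF E] clinear_binom_op binom_summable_pos) auto
  obtain m where m: "0 \<le> m" "\<And>z v. cmod z < 1 \<Longrightarrow>
      norm (E (neumann z v)) \<le> m * cmod (1 + z) powr (- \<alpha>) * (1 - (cmod z)\<^sup>2) powr (- g) * norm v"
    unfolding E_def using continuous_resolvent_condition_imp_bound[OF g _ cond] E[unfolded E_def] by metis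
  obtain K where K: "\<And>z v. cmod z < 1 \<Longrightarrow>
      norm (D (neumann z v)) \<le> K * (1 - (cmod z)\<^sup>2) powr (- g) * norm v"
    using resolvent_estimate[OF \<alpha> g E m] unfolding D_def by metis
  have "discrete_resolvent_condition \<alpha> (cayley DA A) D"
    unfolding discrete_resolvent_condition_def g_def[symmetric]
  proof (rule bdd_aboveI2)
    fix w :: complex assume "w \<in> {w. cmod w < 1}"
    then have w: "cmod (cnj w) < 1" by simp
    define P where "P = 1 - (cmod w)\<^sup>2"
    have P: "0 < P" using one_minus_norm_square_le(1)[OF w] by (simp add: P_def)
    have "onorm (D \<circ> neumann (cnj w)) \<le> \<bar>K\<bar> * P powr (- g)"
    proof (rule onorm_bound)
      fix v
      have "norm (D (neumann (cnj w) v)) \<le> K * (P powr (- g) * norm v)"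
        using K[OF w, of v] by (simp add: P_def mult.assoc)
      also have "\<dots> \<le> \<bar>K\<bar> * (P powr (- g) * norm v)" by (intro mult_right_mono) auto
      finally show "norm ((D \<circ> neumann (cnj w)) v) \<le> \<bar>K\<bar> * P powr (- g) * norm v"
        by (simp add: mult.assoc)
    qed simp
    then have "P powr g * onorm (D \<circ> neumann (cnj w)) \<le> P powr g * (\<bar>K\<bar> * P powr (- g))"
      by (rule mult_left_mono) simp
    also have "\<dots> = \<bar>K\<bar>" using P by (simp add: powr_minus)
    finally show "(1 - (cmod w)\<^sup>2) powr g *
        onorm (D \<circ> inv (\<lambda>x. x - cnj w *\<^sub>C cayley DA A x)) \<le> \<bar>K\<bar>"
      by (simp add: inv_eq_neumann[OF w] P_def)
  qed
  with assms(5) D have "discrete_admissible \<alpha> (cayley DA A) D" by blast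
  then obtain M where M: "M > 0" "\<And>x. (\<Sum>n. ennreal ((1 + real n) powr \<alpha> *
      (norm (D ((cayley DA A ^^ n) x)))\<^sup>2)) \<le> ennreal (M\<^sup>2 * (norm x)\<^sup>2)"
    unfolding discrete_admissible_def by blast
  show "admissible \<alpha> S DA C"
    unfolding admissible_def
  \<comment> \<open>The constant of the discrete inequality is reused: it is applied to x = y + T y
    itself, where it bounds the weighted integral of E along the orbit of y, that is, of C along the
    orbit of x.\<close>
  proof (intro exI[of _ M] conjI ballI M(1))
    fix x assume "x \<in> DA"
    then obtain y where y: "x = y + cayley DA A y" by (rule DA_eq_range)
    have "C (S t x) = E (S t y)" if "t \<ge> 0" for t
      using that by (simp add: y E_def bounded_clinear_add[OF clinear_S] S_cayley)
    then have "(\<integral>\<^sup>+t\<in>{0..}. ennreal (t powr \<alpha> * (norm (C (S t x)))\<^sup>2) \<partial>lborel) =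
        (\<integral>\<^sup>+t\<in>{0..}. ennreal (t powr \<alpha> * (norm (E (S t y)))\<^sup>2) \<partial>lborel)"
      by (intro nn_integral_cong) (auto simp: indicator_def)
    also have "\<dots> \<le> ennreal (M\<^sup>2 * (norm x)\<^sup>2)"
      using M(2)[of x] unfolding D_def y by (rule weighted_integral_le[OF \<alpha> E])
    finally show "(\<integral>\<^sup>+t\<in>{0..}. ennreal (t powr \<alpha> * (norm (C (S t x)))\<^sup>2) \<partial>lborel) \<le>
        ennreal (M\<^sup>2 * (norm x)\<^sup>2)" .
  qed
qed

end
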